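(* Let $k$ be a finite field, let $r\ge 2$, and let $A$ be a finitely generated metabelian Lie algebra over $k$. Then the following are equivalent: (1) $A\in \mathrm{ucl}(F_r)$; (2) $A$ is a $\Phi_r$-algebra; (3) there exists $s\in\mathbb{N}$ such that $A$ is (isomorphic to) a subalgebra of $F_{r,s}$.
   Context: All Lie algebras are over $k$; products are left-normed, $uvw=(uv)w$. A Lie algebra is metabelian if it satisfies $(x_1x_2)(x_3x_4)=0$. $F_n$ denotes the free metabelian Lie algebra over $k$ of rank $n$ with free base $a_1,\dots,a_n$. The Fitting radical $\mathrm{Fit}(B)$ of a Lie algebra $B$ is the sum of all nilpotent ideals of $B$; one has $\mathrm{Fit}(F_n)=F_n^2$, which is a module over $R_n=k[x_1,\dots,x_n]$ via $u\cdot x_i=ua_i$; write $R=R_r$. In a metabelian Lie algebra, for $u$ in the derived algebra and elements $b_1,\dots,b_n$, $u\cdot f(b_1,\dots,b_n)$ for $f\in k[x_1,\dots,x_n]$ means: a monomial $x_{i_1}\cdots x_{i_t}$ acts by $u\mapsto u b_{i_1}\cdots b_{i_t}$ (left-normed products), extended linearly (constants act as scalars); this same Lie-term expression $y\cdot f(x_1,\dots,x_n)$ is used with variables. Direct module extension: for a torsion-free $R_n$-module $M$, $F_n\oplus M$ is the Lie algebra on the vector space $F_n\oplus M$ in which $F_n$ is a subalgebra, $MM=0$, and for $m\in M$, $u\in F_n$ with $u\equiv \sum\alpha_ia_i \bmod F_n^2$, $mu=-um=m\cdot(\sum_i\alpha_ix_i)$ (so $F_n^2$ acts trivially on $M$).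 $F_{r,s}=F_r\oplus R^s$ with $R^s$ the free $R$-module of rank $s$. $\mathrm{ucl}(F_r)$ is the class of all Lie algebras over $k$ satisfying every universal sentence of the first-order language $L$ of Lie algebras over $k$ (symbols $0,+,-$, the Lie product, and unary scalar multiplication by each $\alpha\in k$) that is true in $F_r$. Formulas of $L$: $\mathrm{Fit}(x)\equiv\forall y\,(xyx=0)$; for $n\le r+1$, $\varphi(x_1,\dots,x_n)\equiv\bigwedge_{(\alpha_1,\dots,\alpha_n)\in k^n\setminus\{0\}}\neg\mathrm{Fit}(\alpha_1x_1+\dots+\alpha_nx_n)$ (a finite conjunction since $k$ is finite). The collection $\Phi_r$ consists of: $\Phi1$: $\forall x_1,x_2,x_3,x_4\ (x_1x_2)(x_3x_4)=0$. $\Phi2$: $\forall x,y\ (xyx=0\wedge xyy=0\to xy=0)$. $\Phi3$: $\forall x,y,z\ (x\ne0\wedge xy=0\wedge xz=0\to yz=0)$. $\Phi4$: $\forall x_1,\dots,x_{r+1}\ \neg\varphi(x_1,\dots,x_{r+1})$. $\Phi5$: for every $n\le r$ and every nonzero $f\in k[x_1,\dots,x_n]$: $\forall z_1,z_2,x_1,\dots,x_n\ \big((z_1z_2)\cdot f(x_1,\dots,x_n)=0\wedge z_1z_2\ne0\to\neg\varphi(x_1,\dots,x_n)\big)$. $\Phi6$: for every $n\le r$ and every nonzero element $l(a_1,\dots,a_n)$ of $F_n$ (written as a Lie polynomial in $a_1,\dots,a_n$): $\forall x_1,\dots,x_n\ (\varphi(x_1,\dots,x_n)\to l(x_1,\dots,x_n)\ne0)$.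 $\Phi7$: for every $n\le r$ and every finite system $S$ of module equations $y_1f_{i1}+\dots+y_lf_{il}=c_i$ ($i=1,\dots,m$; $f_{ij}\in R_n$; $c_i\in\mathrm{Fit}(F_n)$) which has no solution in the localisation $\mathrm{Fit}(F_n)_\Delta=(R_n\setminus\Delta)^{-1}\mathrm{Fit}(F_n)$, $\Delta=(x_1,\dots,x_n)$: $\forall x_1,\dots,x_n\,\forall y_1,\dots,y_l\ \big(\varphi(x_1,\dots,x_n)\wedge\bigwedge_{j=1}^l\bigwedge_{i=1}^n y_jx_iy_j=0\to\bigvee_{i=1}^m h_i\ne0\big)$, where $h_i=y_1\cdot f_{i1}(x_1,\dots,x_n)+\dots+y_l\cdot f_{il}(x_1,\dots,x_n)-c_i(x_1,\dots,x_n)$ and $c_i(x_1,\dots,x_n)$ is obtained from a Lie polynomial representing $c_i$ by replacing each $a_j$ by $x_j$. A $\Phi_r$-algebra is a Lie algebra over $k$ satisfying all formulas of $\Phi_r$. *)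

theory Defs
  imports Main "HOL-Library.Poly_Mapping"
begin

record ('k, 'a) liealg =
  carrier :: "'a set"
  zero :: 'a
  add :: "'a \<Rightarrow> 'a \<Rightarrow> 'a"
  neg :: "'a \<Rightarrow> 'a"
  br :: "'a \<Rightarrow> 'a \<Rightarrow> 'a"
  sm :: "'k \<Rightarrow> 'a \<Rightarrow> 'a"

definition lie_alg :: "('k::field, 'a) liealg \<Rightarrow> bool" where
  "lie_alg A \<longleftrightarrow>
    zero A \<in> carrier A \<and>
    (\<forall>x\<in>carrier A. \<forall>y\<in>carrier A. add A x y \<in> carrier A \<and> br A x y \<in> carrier A) \<and>
    (\<forall>x\<in>carrier A. neg A x \<in> carrier A \<and> (\<forall>a. sm A a x \<in> carrier A)) \<and>
    (\<forall>x\<in>carrier A. \<forall>y\<in>carrier A. \<forall>z\<in>carrier A.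
        add A (add A x y) z = add A x (add A y z) \<and>
        br A (add A x y) z = add A (br A x z) (br A y z) \<and>
        br A x (add A y z) = add A (br A x y) (br A x z) \<and>
        add A (add A (br A (br A x y) z) (br A (br A y z) x)) (br A (br A z x) y) = zero A) \<and>
    (\<forall>x\<in>carrier A. \<forall>y\<in>carrier A. add A x y = add A y x \<and>
        (\<forall>a. sm A a (add A x y) = add A (sm A a x) (sm A a y) \<and>
             br A (sm A a x) y = sm A a (br A x y) \<and>
             br A x (sm A a y) = sm A a (br A x y))) \<and>
    (\<forall>x\<in>carrier A. add A (zero A) x = x \<and> add A (neg A x) x = zero A \<and>
        br A x x = zero A \<and> sm A 1 x = x \<and>
        (\<forall>a b. sm A (a + b) x = add A (sm A a x) (sm A b x) \<and>
               sm A (a * b) x = sm A a (sm A b x)))"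

definition metabelian :: "('k, 'a) liealg \<Rightarrow> bool" where
  "metabelian A \<longleftrightarrow> (\<forall>x1\<in>carrier A. \<forall>x2\<in>carrier A. \<forall>x3\<in>carrier A. \<forall>x4\<in>carrier A.
      br A (br A x1 x2) (br A x3 x4) = zero A)"

datatype 'k ltm = V nat | Z | Pl "'k ltm" "'k ltm" | Ng "'k ltm" | Br "'k ltm" "'k ltm" | Sc 'k "'k ltm"

fun tvars :: "'k ltm \<Rightarrow> nat set" where
  "tvars (V i) = {i}"
| "tvars Z = {}"
| "tvars (Pl s t) = tvars s \<union> tvars t"
| "tvars (Ng t) = tvars t"
| "tvars (Br s t) = tvars s \<union> tvars t"
| "tvars (Sc a t) = tvars t"

fun teval :: "('k, 'a) liealg \<Rightarrow> (nat \<Rightarrow> 'a) \<Rightarrow> 'k ltm \<Rightarrow> 'a" where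
  "teval A g (V i) = g i"
| "teval A g Z = zero A"
| "teval A g (Pl s t) = add A (teval A g s) (teval A g t)"
| "teval A g (Ng t) = neg A (teval A g t)"
| "teval A g (Br s t) = br A (teval A g s) (teval A g t)"
| "teval A g (Sc a t) = sm A a (teval A g t)"

datatype 'k qfm = Eq "'k ltm" "'k ltm" | Neg "'k qfm" | Conj "'k qfm" "'k qfm" | Disj "'k qfm" "'k qfm"

fun qsat :: "('k, 'a) liealg \<Rightarrow> (nat \<Rightarrow> 'a) \<Rightarrow> 'k qfm \<Rightarrow> bool" where
  "qsat A g (Eq s t) = (teval A g s = teval A g t)"
| "qsat A g (Neg p) = (\<not> qsat A g p)"
| "qsat A g (Conj p q) = (qsat A g p \<and> qsat A g q)"
| "qsat A g (Disj p q) = (qsat A g p \<or> qsat A g q)"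

text \<open>A universal sentence is the universal closure of a quantifier-free formula
  (every universal sentence is logically equivalent to one of this shape).\<close>
definition univ_holds :: "('k, 'a) liealg \<Rightarrow> 'k qfm \<Rightarrow> bool" where
  "univ_holds A p \<longleftrightarrow> (\<forall>g. (\<forall>i. g i \<in> carrier A) \<longrightarrow> qsat A g p)"

inductive meq :: "'k::field ltm \<Rightarrow> 'k ltm \<Rightarrow> bool" where
  refl: "meq t t"
| sym: "meq s t \<Longrightarrow> meq t s"
| trans: "meq s t \<Longrightarrow> meq t u \<Longrightarrow> meq s u"
| cPl: "meq s s' \<Longrightarrow> meq t t' \<Longrightarrow> meq (Pl s t) (Pl s' t')"
| cNg: "meq s s' \<Longrightarrow> meq (Ng s) (Ng s')"
| cBr: "meq s s' \<Longrightarrow> meq t t' \<Longrightarrow> meq (Br s t) (Br s' t')"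
| cSc: "meq s s' \<Longrightarrow> meq (Sc a s) (Sc a s')"
| add_assoc: "meq (Pl (Pl x y) z) (Pl x (Pl y z))"
| add_comm: "meq (Pl x y) (Pl y x)"
| add_zero: "meq (Pl Z x) x"
| add_neg: "meq (Pl (Ng x) x) Z"
| sc_distr1: "meq (Sc a (Pl x y)) (Pl (Sc a x) (Sc a y))"
| sc_distr2: "meq (Sc (a + b) x) (Pl (Sc a x) (Sc b x))"
| sc_assoc: "meq (Sc (a * b) x) (Sc a (Sc b x))"
| sc_one: "meq (Sc 1 x) x"
| br_addl: "meq (Br (Pl x y) z) (Pl (Br x z) (Br y z))"
| br_addr: "meq (Br x (Pl y z)) (Pl (Br x y) (Br x z))"
| br_scl: "meq (Br (Sc a x) y) (Sc a (Br x y))"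
| br_scr: "meq (Br x (Sc a y)) (Sc a (Br x y))"
| br_alt: "meq (Br x x) Z"
| jacobi: "meq (Pl (Pl (Br (Br x y) z) (Br (Br y z) x)) (Br (Br z x) y)) Z"
| metab: "meq (Br (Br x1 x2) (Br x3 x4)) Z"

definition cls :: "'k::field ltm \<Rightarrow> 'k ltm set" where
  "cls t = {s. meq t s}"

definition rep :: "'k ltm set \<Rightarrow> 'k ltm" where
  "rep c = (SOME t. t \<in> c)"

text \<open>F_n with free base a_1,...,a_n, here a_i = cls (V (i-1)), i.e. variables 0..n-1.\<close>
definition Fr :: "nat \<Rightarrow> ('k::field, 'k ltm set) liealg" where
  "Fr n = \<lparr> carrier = cls ` {t. tvars t \<subseteq> {..<n}},
             zero = cls Z,
             add = (\<lambda>c d. cls (Pl (rep c) (rep d))),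
             neg = (\<lambda>c. cls (Ng (rep c))),
             br = (\<lambda>c d. cls (Br (rep c) (rep d))),
             sm = (\<lambda>a c. cls (Sc a (rep c))) \<rparr>"

inductive_set derived :: "('k, 'a) liealg \<Rightarrow> 'a set" for A where
  d_zero: "zero A \<in> derived A"
| d_br: "x \<in> carrier A \<Longrightarrow> y \<in> carrier A \<Longrightarrow> br A x y \<in> derived A"
| d_add: "u \<in> derived A \<Longrightarrow> v \<in> derived A \<Longrightarrow> add A u v \<in> derived A"
| d_sm: "u \<in> derived A \<Longrightarrow> sm A a u \<in> derived A"

type_synonym 'k mpoly = "(nat \<Rightarrow>\<^sub>0 nat) \<Rightarrow>\<^sub>0 'k"

definition mvars :: "('k::zero) mpoly \<Rightarrow> nat set" where
  "mvars f = {i. \<exists>m\<in>Poly_Mapping.keys f. i \<in> Poly_Mapping.keys m}"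

text \<open>R_n = k[x_1,...,x_n], variable x_i being index i-1.\<close>
definition Rn :: "nat \<Rightarrow> ('k::zero) mpoly set" where
  "Rn n = {f. mvars f \<subseteq> {..<n}}"

definition xvar :: "nat \<Rightarrow> ('k::{zero,one}) mpoly" where
  "xvar i = Poly_Mapping.single (Poly_Mapping.single i 1) 1"

definition lsum :: "('k, 'a) liealg \<Rightarrow> 'a list \<Rightarrow> 'a" where
  "lsum A xs = foldr (add A) xs (zero A)"

fun mono_act :: "('k, 'a) liealg \<Rightarrow> 'a \<Rightarrow> (nat \<Rightarrow> 'a) \<Rightarrow> (nat \<Rightarrow>\<^sub>0 nat) \<Rightarrow> nat \<Rightarrow> 'a" where
  "mono_act A u b m 0 = u"
| "mono_act A u b m (Suc i) = ((\<lambda>v. br A v (b i)) ^^ (Poly_Mapping.lookup m i)) (mono_act A u b m i)"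

definition act :: "('k::zero, 'a) liealg \<Rightarrow> 'a \<Rightarrow> (nat \<Rightarrow> 'a) \<Rightarrow> 'k mpoly \<Rightarrow> 'a" where
  "act A u b f = lsum A (map (\<lambda>m. sm A (Poly_Mapping.lookup f m) (mono_act A u b m (Suc (Max (insert 0 (Poly_Mapping.keys m))))))
                        (sorted_list_of_set (Poly_Mapping.keys f)))"

definition agen :: "nat \<Rightarrow> 'k::field ltm set" where
  "agen i = cls (V i)"

definition modact :: "nat \<Rightarrow> 'k::field ltm set \<Rightarrow> 'k mpoly \<Rightarrow> 'k ltm set" where
  "modact n u f = act (Fr n) u agen f"

text \<open>Solvability of a system sum_j y_j f_ij = c_i (i<m, j<l) in the localisation
  (R_n \ Delta)^{-1} Fit(F_n), Delta = (x_1,...,x_n), written out via fractions: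
  y_j = w_j / s, and w/s = c/1 iff t (w - s c) = 0 for some t outside Delta.\<close>
definition solvable_loc ::
  "nat \<Rightarrow> nat \<Rightarrow> nat \<Rightarrow> (nat \<Rightarrow> nat \<Rightarrow> ('k::field) mpoly) \<Rightarrow> (nat \<Rightarrow> 'k ltm set) \<Rightarrow> bool" where
  "solvable_loc n m l f c \<longleftrightarrow>
     (\<exists>w s t. (\<forall>j<l. w j \<in> derived (Fr n)) \<and>
        s \<in> Rn n \<and> Poly_Mapping.lookup s 0 \<noteq> 0 \<and> t \<in> Rn n \<and> Poly_Mapping.lookup t 0 \<noteq> 0 \<and>
        (\<forall>i<m. modact n (lsum (Fr n) (map (\<lambda>j. modact n (w j) (f i j)) [0..<l])) t
               = modact n (modact n (c i) s) t))"

fun tlin :: "'k::field ltm \<Rightarrow> nat \<Rightarrow> 'k" where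
  "tlin (V i) = (\<lambda>j. if j = i then 1 else 0)"
| "tlin Z = (\<lambda>j. 0)"
| "tlin (Pl s t) = (\<lambda>j. tlin s j + tlin t j)"
| "tlin (Ng t) = (\<lambda>j. - tlin t j)"
| "tlin (Br s t) = (\<lambda>j. 0)"
| "tlin (Sc a t) = (\<lambda>j. a * tlin t j)"

text \<open>Linear polynomial sum_i alpha_i x_i where u == sum_i alpha_i a_i mod F_r^2.\<close>
definition linpoly :: "nat \<Rightarrow> 'k::field ltm set \<Rightarrow> 'k mpoly" where
  "linpoly r u = (\<Sum>i<r. Poly_Mapping.single (Poly_Mapping.single i 1) (tlin (rep u) i))"

definition Frs :: "nat \<Rightarrow> nat \<Rightarrow> ('k::field, 'k ltm set \<times> (nat \<Rightarrow> 'k mpoly)) liealg" where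
  "Frs r s = \<lparr> carrier = carrier (Fr r) \<times> {v. (\<forall>j<s. v j \<in> Rn r) \<and> (\<forall>j\<ge>s. v j = 0)},
     zero = (zero (Fr r), (\<lambda>j. 0)),
     add = (\<lambda>(u, v) (u', v'). (add (Fr r) u u', (\<lambda>j. v j + v' j))),
     neg = (\<lambda>(u, v). (neg (Fr r) u, (\<lambda>j. - v j))),
     br = (\<lambda>(u, v) (u', v'). (br (Fr r) u u',
             (\<lambda>j. v j * linpoly r u' - v' j * linpoly r u))),
     sm = (\<lambda>a (u, v). (sm (Fr r) a u, (\<lambda>j. Poly_Mapping.single 0 a * v j))) \<rparr>"

definition lie_hom :: "('k, 'a) liealg \<Rightarrow> ('k, 'b) liealg \<Rightarrow> ('a \<Rightarrow> 'b) \<Rightarrow> bool" where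
  "lie_hom A B h \<longleftrightarrow> (\<forall>x\<in>carrier A. h x \<in> carrier B) \<and> h (zero A) = zero B \<and>
     (\<forall>x\<in>carrier A. h (neg A x) = neg B (h x) \<and> (\<forall>a. h (sm A a x) = sm B a (h x))) \<and>
     (\<forall>x\<in>carrier A. \<forall>y\<in>carrier A. h (add A x y) = add B (h x) (h y) \<and> h (br A x y) = br B (h x) (h y))"

definition embeds :: "('k, 'a) liealg \<Rightarrow> ('k, 'b) liealg \<Rightarrow> bool" where
  "embeds A B \<longleftrightarrow> (\<exists>h. lie_hom A B h \<and> inj_on h (carrier A))"

definition fin_gen :: "('k, 'a) liealg \<Rightarrow> bool" where
  "fin_gen A \<longleftrightarrow> (\<exists>n g. (\<forall>i<n. g i \<in> carrier A) \<and>
      carrier A = {teval A g t | t. tvars t \<subseteq> {..<n}})"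

definition in_ucl :: "nat \<Rightarrow> ('k::field, 'a) liealg \<Rightarrow> bool" where
  "in_ucl r A \<longleftrightarrow> lie_alg A \<and> (\<forall>p. univ_holds (Fr r) p \<longrightarrow> univ_holds A p)"

definition FitEl :: "('k, 'a) liealg \<Rightarrow> 'a \<Rightarrow> bool" where
  "FitEl A x \<longleftrightarrow> (\<forall>y\<in>carrier A. br A (br A x y) x = zero A)"

definition phi :: "('k::field, 'a) liealg \<Rightarrow> nat \<Rightarrow> (nat \<Rightarrow> 'a) \<Rightarrow> bool" where
  "phi A n x \<longleftrightarrow> (\<forall>\<alpha> :: nat \<Rightarrow> 'k. (\<exists>i<n. \<alpha> i \<noteq> 0) \<longrightarrow>
      \<not> FitEl A (lsum A (map (\<lambda>i. sm A (\<alpha> i) (x i)) [0..<n])))"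

definition in_car :: "('k, 'a) liealg \<Rightarrow> nat \<Rightarrow> (nat \<Rightarrow> 'a) \<Rightarrow> bool" where
  "in_car A n x \<longleftrightarrow> (\<forall>i<n. x i \<in> carrier A)"

definition Phi1 :: "('k, 'a) liealg \<Rightarrow> bool" where
  "Phi1 A = metabelian A"

definition Phi2 :: "('k, 'a) liealg \<Rightarrow> bool" where
  "Phi2 A \<longleftrightarrow> (\<forall>x\<in>carrier A. \<forall>y\<in>carrier A.
     br A (br A x y) x = zero A \<and> br A (br A x y) y = zero A \<longrightarrow> br A x y = zero A)"

definition Phi3 :: "('k, 'a) liealg \<Rightarrow> bool" where
  "Phi3 A \<longleftrightarrow> (\<forall>x\<in>carrier A. \<forall>y\<in>carrier A. \<forall>z\<in>carrier A.
     x \<noteq> zero A \<and> br A x y = zero A \<and> br A x z = zero A \<longrightarrow> br A y z = zero A)"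

definition Phi4 :: "nat \<Rightarrow> ('k::field, 'a) liealg \<Rightarrow> bool" where
  "Phi4 r A \<longleftrightarrow> (\<forall>x. in_car A (Suc r) x \<longrightarrow> \<not> phi A (Suc r) x)"

definition Phi5 :: "nat \<Rightarrow> ('k::field, 'a) liealg \<Rightarrow> bool" where
  "Phi5 r A \<longleftrightarrow> (\<forall>n\<le>r. \<forall>f \<in> Rn n. f \<noteq> 0 \<longrightarrow>
     (\<forall>z1\<in>carrier A. \<forall>z2\<in>carrier A. \<forall>x. in_car A n x \<longrightarrow>
        act A (br A z1 z2) x f = zero A \<and> br A z1 z2 \<noteq> zero A \<longrightarrow> \<not> phi A n x))"

definition Phi6 :: "nat \<Rightarrow> ('k::field, 'a) liealg \<Rightarrow> bool" where
  "Phi6 r A \<longleftrightarrow> (\<forall>n\<le>r. \<forall>l. tvars l \<subseteq> {..<n} \<and> cls l \<noteq> zero (Fr n :: ('k, 'k ltm set) liealg) \<longrightarrow>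
     (\<forall>x. in_car A n x \<longrightarrow> phi A n x \<longrightarrow> teval A x l \<noteq> zero A))"

text \<open>Phi7: c_i given by Lie polynomials ct i (in a_1..a_n) whose values lie in Fit(F_n) = F_n^2.\<close>
definition Phi7 :: "nat \<Rightarrow> ('k::field, 'a) liealg \<Rightarrow> bool" where
  "Phi7 r A \<longleftrightarrow> (\<forall>n\<le>r. \<forall>m l (f :: nat \<Rightarrow> nat \<Rightarrow> 'k mpoly) (ct :: nat \<Rightarrow> 'k ltm).
     (\<forall>i<m. \<forall>j<l. f i j \<in> Rn n) \<and>
     (\<forall>i<m. tvars (ct i) \<subseteq> {..<n} \<and> cls (ct i) \<in> derived (Fr n)) \<and>
     \<not> solvable_loc n m l f (\<lambda>i. cls (ct i)) \<longrightarrow>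
     (\<forall>x y. in_car A n x \<and> in_car A l y \<and> phi A n x \<and>
        (\<forall>j<l. \<forall>i<n. br A (br A (y j) (x i)) (y j) = zero A) \<longrightarrow>
        (\<exists>i<m. add A (lsum A (map (\<lambda>j. act A (y j) x (f i j)) [0..<l])) (neg A (teval A x (ct i)))
               \<noteq> zero A)))"

definition phi_alg :: "nat \<Rightarrow> ('k::field, 'a) liealg \<Rightarrow> bool" where
  "phi_alg r A \<longleftrightarrow> lie_alg A \<and> Phi1 A \<and> Phi2 A \<and> Phi3 A \<and> Phi4 r A \<and> Phi5 r A \<and> Phi6 r A \<and> Phi7 r A"

end

theory Submission
  imports Defs Complex_Main "HOL-Library.FuncSet"
begin

text \<open>
  \<open>F_n\<close> is studied in the Magnus representation, where an element is a pair \<open>(p, v)\<close> of its linear part and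
  its vector of Fox derivatives. Exactness of the Koszul complex gives both faithfulness and the
  description of the image by \<open>\<Sum> v_i x_i = p\<close>. In these coordinates \<open>F_r\<close> satisfies \<open>\<Phi>_r\<close>, and since the
  failure of a formula of \<open>\<Phi>_r\<close> involves finitely many elements it passes from an algebra of \<open>ucl(F_r)\<close> to
  \<open>F_r\<close>. Conversely \<open>F_r\<close> discriminates \<open>F_{r,s}\<close>, because \<open>R\<close> is infinite.

  For a finitely generated \<open>\<Phi>_r\<close>-algebra \<open>A\<close>, a basis \<open>b_1, \<dots>, b_n\<close> modulo \<open>Fit(A)\<close> generates a copy of
  \<open>F_n\<close>, and \<open>Fit(A)\<close> is a torsion-free module spanned by \<open>F_n^2\<close> and finitely many \<open>u_j\<close>. Choose a maximal
  subset of the \<open>u_j\<close> independent modulo \<open>F_n^2\<close> and relations \<open>d u_j = c_j + \<Sum> \<tau>_{ji} u_i\<close> over it with a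
  common \<open>d \<noteq> 0\<close>. By \<open>\<Phi>7\<close> these finitely many relations are solvable in the localisation, which gives
  \<open>w_j \<in> F_n^2\<close> and \<open>s\<close> with \<open>s(0) = 1\<close> such that \<open>d w_j = s c_j + \<Sum> \<tau>_{ji} w_i\<close>; by torsion-freeness all
  other relations then hold as well, so the Hilbert basis theorem is not needed. Multiplication by \<open>s\<close> on
  \<open>F_n^2\<close> is induced by an endomorphism of \<open>F_n\<close>, by the Jacobi identity, and together with the coordinates
  \<open>\<tau>_{ji}\<close> it defines the embedding.
\<close>

section \<open>Polynomials\<close>

text \<open>The obstacle in the embedding is that Fit(A) need not split over \<open>F_n^2\<close>: a
  multiple \<open>d u_j\<close> may involve a part of \<open>F_n^2\<close> that is not divisible by
  \<open>d\<close>. A retraction of Fit(A) onto \<open>F_n^2\<close> is available only after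
  inverting some \<open>s\<close>, so the map used is multiplication by \<open>s\<close> on
  \<open>F_n^2\<close> and sends \<open>u_j\<close> to \<open>w_j\<close>. It has to come from an
  endomorphism of \<open>F_n\<close> that is the identity on linear parts. The fundamental identity
  \<Sum> v_k x_k = x_i for the Fox vector of the image of \<open>a_i\<close> can then be met because
  s - 1 lies in \<Delta>; this is why \<Phi>7 localises at \<Delta> and does not invert all nonzero
  polynomials.

  The embedding is not defined on A directly. \<open>F_{n,q}\<close> maps onto A and also into
  \<open>F_{r,q}\<close>, and the identity d (s v + \<Sum> f_j w_j) = s (d v + \<Sum> f_j c_j) +
  \<Sum> (\<tau> f)_i w_i shows that both maps have the same kernel.

  Finiteness of k enters through \<phi>: there are finitely many coefficient vectors, so all
  witnesses for \<phi> fit into one formula, and \<Phi>4 becomes a count.\<close>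

declare One_nat_def [simp del]

abbreviation coeff :: "('k::zero) mpoly \<Rightarrow> (nat \<Rightarrow>\<^sub>0 nat) \<Rightarrow> 'k" where "coeff \<equiv> Poly_Mapping.lookup"
abbreviation mon :: "(nat \<Rightarrow>\<^sub>0 nat) \<Rightarrow> 'k::zero \<Rightarrow> 'k mpoly" where "mon \<equiv> Poly_Mapping.single"
abbreviation ex :: "nat \<Rightarrow> (nat \<Rightarrow>\<^sub>0 nat)" where "ex i \<equiv> Poly_Mapping.single i 1"
abbreviation const :: "'k::zero \<Rightarrow> 'k mpoly" where "const c \<equiv> Poly_Mapping.single 0 c"

text \<open>Restricting the base case to exponents that occur in \<open>f\<close> lets support
  conditions such as membership in \<open>Rn n\<close> survive the induction.\<close>

lemma poly_mapping_single_add_induct [case_names single zero add]: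
  fixes f :: "'a \<Rightarrow>\<^sub>0 'b::comm_monoid_add"
  assumes s: "\<And>m c. m \<in> Poly_Mapping.keys f \<Longrightarrow> P (Poly_Mapping.single m c)" and z: "P 0"
    and a: "\<And>f g. P f \<Longrightarrow> P g \<Longrightarrow> P (f + g)"
  shows "P f"
proof -
  have e: "f = (\<Sum>m\<in>Poly_Mapping.keys f. Poly_Mapping.single m (Poly_Mapping.lookup f m))"
    by (rule poly_mapping_eqI)
       (simp add: lookup_sum lookup_single when_def sum.delta in_keys_iff)
  have "P (\<Sum>m\<in>K. Poly_Mapping.single m (Poly_Mapping.lookup f m))"
    if "K \<subseteq> Poly_Mapping.keys f" for K
    using finite_subset[OF that finite_keys] that
    by (induction K rule: finite_induct) (auto intro: s a z)
  then show ?thesis using e by (metis subset_refl)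
qed

lemma mpoly_induct [case_names mon add]:
  fixes f :: "'k::comm_monoid_add mpoly"
  assumes s: "\<And>m c. P (mon m c)" and a: "\<And>f g. P f \<Longrightarrow> P g \<Longrightarrow> P (f + g)"
  shows "P f"
proof (rule poly_mapping_single_add_induct)
  show "P 0" using s[of 0 0] by simp
qed (use s a in auto)

lemma mono_induct [case_names zero step]:
  fixes m :: "nat \<Rightarrow>\<^sub>0 nat"
  assumes z: "P 0" and s: "\<And>m i. P m \<Longrightarrow> P (m + ex i)"
  shows "P m"
proof -
  \<comment> \<open>Translation by an arbitrary \<open>a\<close> turns the claim into one that is
    additive in \<open>m\<close>.\<close>
  have "\<forall>a. P a \<longrightarrow> P (a + m)"
  proof (induction m rule: poly_mapping_single_add_induct)
    case (single i c)
    show ?case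
    proof (induction c)
      case (Suc c)
      have e: "a + Poly_Mapping.single i (Suc c) = (a + Poly_Mapping.single i c) + ex i" for a
        by (metis Suc_eq_plus1 add.assoc single_add)
      show ?case unfolding e using Suc s by auto
    qed auto
  next
    case (add f g)
    then show ?case by (metis add.assoc)
  qed auto
  then show ?thesis using z by (metis add_0)
qed

lemma keys_add_nat: "Poly_Mapping.keys (a + b :: nat \<Rightarrow>\<^sub>0 nat) = Poly_Mapping.keys a \<union> Poly_Mapping.keys b"
  by (auto simp: in_keys_iff lookup_add)

lemma const_mult: "const (a * b) = const a * (const b :: 'k::semiring_1 mpoly)"
  by (simp add: mult_single)
lemma const_1: "const 1 = (1 :: 'k::semiring_1 mpoly)" by simp
lemma mon_mult_xvar: "mon (m + ex i) (c :: 'k::semiring_1) = mon m c * xvar i"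
  by (simp add: mult_single xvar_def)
lemma coeff_const_mult: "coeff (const c * f) m = c * coeff f (m :: nat \<Rightarrow>\<^sub>0 nat)" for f :: "'k::comm_semiring_1 mpoly"
proof (induction f rule: mpoly_induct)
  case (mon m' c') show ?case by (simp add: mult_single lookup_single when_def)
qed (simp add: distrib_left lookup_add)
lemma const_eq_0_iff [simp]: "(const c :: 'k::zero mpoly) = 0 \<longleftrightarrow> c = 0"
  by (metis lookup_single_eq lookup_zero single_zero)
lemma xvar_neq_0 [simp]: "xvar i \<noteq> (0 :: 'k::zero_neq_one mpoly)"
  unfolding xvar_def by (metis lookup_single_eq lookup_zero zero_neq_one)

lemma Rn_iff: "f \<in> Rn n \<longleftrightarrow> (\<forall>m\<in>Poly_Mapping.keys f. Poly_Mapping.keys m \<subseteq> {..<n})"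
  by (auto simp: Rn_def mvars_def)

lemma Rn_mono: "n \<le> m \<Longrightarrow> Rn n \<subseteq> Rn m"
  unfolding Rn_iff by (fastforce simp: Rn_iff)
lemma Rn_0 [simp]: "0 \<in> Rn n" by (simp add: Rn_iff)
lemma Rn_const [simp]: "const c \<in> Rn n" by (simp add: Rn_iff)
lemma Rn_1 [simp]: "1 \<in> Rn n" by (simp add: Rn_iff)
lemma Rn_add [simp]: "f \<in> Rn n \<Longrightarrow> g \<in> Rn n \<Longrightarrow> f + g \<in> Rn n"
  unfolding Rn_iff using keys_add[of f g] by blast
lemma Rn_uminus [simp]: "f \<in> Rn n \<Longrightarrow> - f \<in> Rn n" for f :: "'k::ab_group_add mpoly"
  unfolding Rn_iff by (auto simp: in_keys_iff)
lemma Rn_diff [simp]: "f \<in> Rn n \<Longrightarrow> g \<in> Rn n \<Longrightarrow> f - g \<in> Rn n" for f :: "'k::ab_group_add mpoly"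
  using Rn_add[of f n "- g"] by simp
lemma Rn_mult [simp]: "f \<in> Rn n \<Longrightarrow> g \<in> Rn n \<Longrightarrow> f * g \<in> Rn n" for f :: "'k::semiring_0 mpoly"
proof -
  assume a: "f \<in> Rn n" "g \<in> Rn n"
  have "Poly_Mapping.keys m \<subseteq> {..<n}" if "m \<in> Poly_Mapping.keys (f * g)" for m
    using keys_mult[of f g] that a unfolding Rn_iff by (fastforce simp: keys_add_nat)
  then show ?thesis by (auto simp: Rn_iff)
qed
lemma Rn_xvar [simp]: "i < n \<Longrightarrow> xvar i \<in> (Rn n :: 'k::semiring_1 mpoly set)"
  by (simp add: Rn_iff xvar_def)
lemma Rn_sum: "(\<And>i. i \<in> S \<Longrightarrow> f i \<in> Rn n) \<Longrightarrow> sum f S \<in> Rn n"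
  by (induction S rule: infinite_finite_induct) auto
lemma Rn_induct [consumes 1, case_names mon add]:
  fixes f :: "'k::comm_monoid_add mpoly"
  assumes "f \<in> Rn n" and s: "\<And>m c. Poly_Mapping.keys m \<subseteq> {..<n} \<Longrightarrow> P (mon m c)"
    and a: "\<And>f g. P f \<Longrightarrow> P g \<Longrightarrow> f \<in> Rn n \<Longrightarrow> g \<in> Rn n \<Longrightarrow> P (f + g)"
  shows "P f"
proof -
  have "f \<in> Rn n \<and> P f"
  proof (rule poly_mapping_single_add_induct)
    show "0 \<in> Rn n \<and> P 0" using s[of 0 0] by simp
    show "mon m c \<in> Rn n \<and> P (mon m c)" if "m \<in> Poly_Mapping.keys f" for m c
      using that assms(1) s by (auto simp: Rn_iff split: if_splits)
  qed (use a in auto)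
  then show ?thesis ..
qed

section \<open>Substitution homomorphisms of polynomial rings\<close>

definition msub :: "(nat \<Rightarrow> 'k::comm_semiring_1 mpoly) \<Rightarrow> (nat \<Rightarrow>\<^sub>0 nat) \<Rightarrow> 'k mpoly" where
  "msub p m = (\<Prod>i\<in>Poly_Mapping.keys m. p i ^ Poly_Mapping.lookup m i)"

definition subst :: "(nat \<Rightarrow> 'k::comm_semiring_1 mpoly) \<Rightarrow> 'k mpoly \<Rightarrow> 'k mpoly" where
  "subst p f = (\<Sum>m\<in>Poly_Mapping.keys f. const (coeff f m) * msub p m)"

lemma msub_superset:
  "finite S \<Longrightarrow> Poly_Mapping.keys m \<subseteq> S \<Longrightarrow> msub p m = (\<Prod>i\<in>S. p i ^ Poly_Mapping.lookup m i)"
  unfolding msub_def by (rule prod.mono_neutral_left) (auto simp: in_keys_iff)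

lemma msub_add: "msub p (a + b) = msub p a * msub p b"
proof -
  let ?S = "Poly_Mapping.keys a \<union> Poly_Mapping.keys b"
  have "msub p c = (\<Prod>i\<in>?S. p i ^ Poly_Mapping.lookup c i)" if "Poly_Mapping.keys c \<subseteq> ?S" for c
    using that by (intro msub_superset) auto
  then show ?thesis by (simp add: keys_add_nat lookup_add power_add prod.distrib)
qed

lemma msub_0 [simp]: "msub p 0 = 1" by (simp add: msub_def)
lemma msub_ex [simp]: "msub p (ex i) = p i" by (simp add: msub_def)

lemma subst_mon: "subst p (mon m c) = const c * msub p m"
  by (cases "c = 0") (auto simp: subst_def)
lemma subst_add: "subst p (f + g) = subst p f + subst p g"
  unfolding subst_def by (rule setsum_keys_plus_distrib) (auto simp: single_add algebra_simps)
lemma subst_0 [simp]: "subst p 0 = 0" by (simp add: subst_def)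
lemma subst_const [simp]: "subst p (const c) = const c" by (simp add: subst_mon)
lemma subst_1 [simp]: "subst p 1 = 1" using subst_const[of p 1] by (simp del: subst_const)
lemma subst_xvar [simp]: "subst p (xvar i) = p i" by (simp add: xvar_def subst_mon)
lemma subst_mult: "subst p (f * g) = subst p f * subst p g"
proof (induction f rule: mpoly_induct)
  case (mon m c)
  show ?case
  proof (induction g rule: mpoly_induct)
    case (mon m' c')
    have "subst p (mon m c * mon m' c') = const (c * c') * msub p (m + m')"
      by (simp add: mult_single subst_mon)
    then show ?case by (simp only: const_mult msub_add subst_mon ac_simps)
  qed (simp add: distrib_left subst_add)
qed (simp add: distrib_right subst_add)
lemma subst_uminus: "subst p (- f) = - subst p f" for f :: "'k::comm_ring_1 mpoly"
  using subst_add[of p f "- f"] by (simp add: add_eq_0_iff2)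
lemma subst_diff: "subst p (f - g) = subst p f - subst p g" for f :: "'k::comm_ring_1 mpoly"
  using subst_add[of p f "- g"] by (simp add: subst_uminus)
lemma subst_sum: "subst p (sum f S) = (\<Sum>i\<in>S. subst p (f i))"
  by (induction S rule: infinite_finite_induct) (auto simp: subst_add)
lemma mpoly_var_induct [consumes 1, case_names const add mult]:
  fixes f :: "'k::comm_semiring_1 mpoly"
  assumes "f \<in> Rn n" "\<And>c. P (const c)" "\<And>f g. P f \<Longrightarrow> P g \<Longrightarrow> f \<in> Rn n \<Longrightarrow> g \<in> Rn n \<Longrightarrow> P (f + g)"
    "\<And>f i. P f \<Longrightarrow> i < n \<Longrightarrow> f \<in> Rn n \<Longrightarrow> P (f * xvar i)"
  shows "P f"
  using assms(1)
proof (induction f rule: Rn_induct)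
  case (mon m c)
  then show ?case
  proof (induction m rule: mono_induct)
    case (step m i)
    then show ?case unfolding mon_mult_xvar by (intro assms(4)) (auto simp: keys_add_nat Rn_iff split: if_splits)
  qed (use assms(2) in auto)
qed (use assms(3) in auto)

lemma Rn_ex: "\<exists>n. f \<in> Rn n"
proof -
  have "finite (mvars f)" 
  proof -
    have "mvars f = (\<Union>m\<in>Poly_Mapping.keys f. Poly_Mapping.keys m)" by (auto simp: mvars_def)
    then show ?thesis by simp
  qed
  then show ?thesis unfolding Rn_def mem_Collect_eq using \<open>finite (mvars f)\<close> by (meson finite_nat_set_iff_bounded lessThan_iff subsetI)
qed

lemma subst_cong: "f \<in> Rn n \<Longrightarrow> (\<And>i. i < n \<Longrightarrow> p i = q i) \<Longrightarrow> subst p f = subst q f"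
  by (induction f rule: mpoly_var_induct) (auto simp: subst_add subst_mult)
lemma subst_Rn: "f \<in> Rn n \<Longrightarrow> (\<And>i. i < n \<Longrightarrow> p i \<in> Rn k) \<Longrightarrow> subst p f \<in> Rn k"
  by (induction f rule: mpoly_var_induct) (auto simp: subst_add subst_mult)
lemma subst_subst: "subst p (subst q f) = subst (\<lambda>i. subst p (q i)) f"
proof -
  obtain n where "f \<in> Rn n" using Rn_ex by blast
  then show ?thesis by (induction f rule: mpoly_var_induct) (auto simp: subst_add subst_mult)
qed
lemma subst_id: "subst xvar f = f"
proof -
  obtain n where "f \<in> Rn n" using Rn_ex by blast
  then show ?thesis by (induction f rule: mpoly_var_induct) (auto simp: subst_add subst_mult)
qed

text \<open>Seen as evaluation at the origin, the constant term is multiplicative; in particular the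
  complement of \<Delta> is closed under products.\<close>

lemma coeff0_eq: "const (coeff f 0) = subst (\<lambda>_. 0) f"
proof (induction f rule: mpoly_induct)
  case (mon m c)
  show ?case
  proof (cases "m = 0")
    case False
    then obtain i where "i \<in> Poly_Mapping.keys m" by (metis in_keys_iff lookup_zero poly_mapping_eqI)
    then have "msub (\<lambda>_. 0 :: 'a mpoly) m = 0" unfolding msub_def
      by (intro prod_zero bexI[of _ i]) (auto simp: in_keys_iff power_0_left)
    then show ?thesis using False by (simp add: subst_mon lookup_single)
  qed (simp add: subst_mon)
qed (simp add: lookup_add single_add subst_add)

lemma coeff0_mult: "coeff (f * g) 0 = coeff f 0 * coeff g 0" for f :: "'k::comm_semiring_1 mpoly"
proof -
  have "const (coeff (f * g) 0) = const (coeff f 0 * coeff g 0)"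
    unfolding const_mult coeff0_eq by (rule subst_mult)
  then show ?thesis by (metis lookup_single_eq)
qed
lemma coeff0_const [simp]: "coeff (const c) 0 = c" by simp
lemma coeff0_xvar [simp]: "coeff (xvar i :: 'k::zero_neq_one mpoly) 0 = 0"
proof -
  have "Poly_Mapping.lookup (ex i) i \<noteq> Poly_Mapping.lookup 0 i" by simp
  then have "ex i \<noteq> 0" by metis
  then show ?thesis by (simp add: xvar_def lookup_single)
qed
text \<open>The ideal \<Delta> is generated by the variables. Applied to s - 1, the cofactors
  \<open>D k\<close> later correct the Fox vectors of an endomorphism.\<close>

lemma const_term_zero_decomp:
  fixes f :: "'k::comm_ring_1 mpoly"
  assumes "f \<in> Rn n" "coeff f 0 = 0"
  shows "\<exists>D. (\<forall>k. D k \<in> Rn n) \<and> f = (\<Sum>k<n. D k * xvar k)"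
proof -
  \<comment> \<open>Carrying the constant term along gives a claim about every polynomial, which is
    what the induction over sums and products asks for.\<close>
  have "\<exists>D. (\<forall>k. D k \<in> Rn n) \<and> f = const (coeff f 0) + (\<Sum>k<n. D k * xvar k)"
    using assms(1)
  proof (induction f rule: mpoly_var_induct)
    case (const c) show ?case by (rule exI[of _ "\<lambda>_. 0"]) simp
  next
    case (add f g)
    then obtain D E where "\<forall>k. D k \<in> Rn n" "f = const (coeff f 0) + (\<Sum>k<n. D k * xvar k)"
      "\<forall>k. E k \<in> Rn n" "g = const (coeff g 0) + (\<Sum>k<n. E k * xvar k)" by blast
    note DE = this
    have "f + g = (const (coeff f 0) + (\<Sum>k<n. D k * xvar k)) + (const (coeff g 0) + (\<Sum>k<n. E k * xvar k))"
      by (rule arg_cong2[OF DE(2,4)])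
    also have "\<dots> = const (coeff (f + g) 0) + (\<Sum>k<n. (D k + E k) * xvar k)"
      by (simp add: lookup_add single_add sum.distrib distrib_right)
    finally have "f + g = const (coeff (f + g) 0) + (\<Sum>k<n. (D k + E k) * xvar k)" .
    then show ?case using DE(1,3) by (intro exI[of _ "\<lambda>k. D k + E k"]) auto
  next
    case (mult f i)
    then obtain D where D: "\<forall>k. D k \<in> Rn n" "f = const (coeff f 0) + (\<Sum>k<n. D k * xvar k)" by blast
    let ?E = "\<lambda>k. D k * xvar i + (if k = i then const (coeff f 0) else 0)"
    have "(\<Sum>k<n. ?E k * xvar k) = (\<Sum>k<n. D k * xvar i * xvar k) + (\<Sum>k<n. if k = i then const (coeff f 0) * xvar k else 0)"
      unfolding sum.distrib[symmetric] by (intro sum.cong) (auto simp: distrib_right)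
    also have "\<dots> = (\<Sum>k<n. D k * xvar k) * xvar i + const (coeff f 0) * xvar i"
      using mult(2) by (simp add: sum_distrib_left sum_distrib_right ac_simps sum.delta)
    also have "\<dots> = f * xvar i" using arg_cong[OF D(2), of "\<lambda>h. h * xvar i"] by (simp only: distrib_right add.commute)
    finally have "f * xvar i = (\<Sum>k<n. ?E k * xvar k)" ..
    moreover have "coeff (f * xvar i) 0 = 0" by (simp add: coeff0_mult)
    ultimately show ?case using D mult(2) by (intro exI[of _ ?E]) auto
  qed
  then show ?thesis using assms(2) by simp
qed

section \<open>Linear forms\<close>

definition Lin :: "nat \<Rightarrow> 'k::comm_semiring_1 mpoly set" where
  "Lin n = {p. \<exists>a. p = (\<Sum>i<n. const (a i) * xvar i)}"

lemma LinI: "(\<Sum>i<n. const (a i) * xvar i) \<in> Lin n" by (auto simp: Lin_def)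
lemma Lin_0 [simp]: "0 \<in> Lin n" using LinI[of "\<lambda>_. 0" n] by simp
lemma Lin_add: "p \<in> Lin n \<Longrightarrow> q \<in> Lin n \<Longrightarrow> p + q \<in> Lin n"
proof -
  assume "p \<in> Lin n" "q \<in> Lin n"
  then obtain a b where "p = (\<Sum>i<n. const (a i) * xvar i)" "q = (\<Sum>i<n. const (b i) * xvar i)" by (auto simp: Lin_def)
  then have "p + q = (\<Sum>i<n. const (a i + b i) * xvar i)"
    by (simp add: single_add distrib_right sum.distrib)
  then show ?thesis using LinI by metis
qed
lemma Lin_const_mult: "p \<in> Lin n \<Longrightarrow> const c * p \<in> Lin n"
proof -
  assume "p \<in> Lin n"
  then obtain a where "p = (\<Sum>i<n. const (a i) * xvar i)" by (auto simp: Lin_def)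
  then have "const c * p = (\<Sum>i<n. const (c * a i) * xvar i)"
    by (simp only: const_mult sum_distrib_left mult.assoc)
  then show ?thesis using LinI by metis
qed
lemma Lin_uminus: "p \<in> Lin n \<Longrightarrow> - p \<in> Lin n" for p :: "'k::comm_ring_1 mpoly"
  using Lin_const_mult[of p n "-1"] by (simp add: single_uminus const_1)
lemma Lin_sum: "(\<And>i. i \<in> S \<Longrightarrow> f i \<in> Lin n) \<Longrightarrow> sum f S \<in> Lin n"
  by (induction S rule: infinite_finite_induct) (auto intro: Lin_add)
lemma Lin_xvar: "i < n \<Longrightarrow> xvar i \<in> Lin n"
proof -
  assume "i < n"
  have "(\<Sum>j<n. const (if j = i then 1 else 0) * xvar j) = (\<Sum>j<n. if j = i then xvar j else (0 :: 'a mpoly))"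
    by (rule sum.cong) auto
  also have "\<dots> = xvar i" using \<open>i < n\<close> by (simp add: sum.delta)
  finally have "(\<Sum>j<n. const (if j = i then 1 else 0) * xvar j) = (xvar i :: 'a mpoly)" .
  then show ?thesis using LinI[of "\<lambda>j. if j = i then 1 else 0" n] by (rule subst[where P = "\<lambda>p. p \<in> Lin n"])
qed
lemma Lin_Rn: "p \<in> Lin n \<Longrightarrow> p \<in> Rn n"
  by (auto simp: Lin_def intro!: Rn_sum Rn_mult)
lemma Lin_mono: "n \<le> m \<Longrightarrow> p \<in> Lin n \<Longrightarrow> p \<in> Lin m"
proof -
  assume "n \<le> m" "p \<in> Lin n"
  then show ?thesis by (auto simp: Lin_def[of n] intro!: Lin_sum Lin_const_mult Lin_xvar)
qed

lemma coeff_xvar_ex: "coeff (xvar j :: 'k::comm_semiring_1 mpoly) (ex i) = (if i = j then 1 else 0)"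
proof -
  have "ex j = ex i \<longleftrightarrow> i = j" by (metis lookup_single_eq lookup_single_not_eq zero_neq_one)
  then show ?thesis by (auto simp: xvar_def lookup_single when_def)
qed
lemma coeff_lin: "coeff (\<Sum>j<n. const (a j) * xvar j) (ex i) = (if i < n then a i else 0)" for a :: "nat \<Rightarrow> 'k::comm_semiring_1"
  by (simp add: lookup_sum coeff_const_mult coeff_xvar_ex sum.delta if_distrib cong: if_cong)

lemma Lin_expand: "p \<in> Lin n \<Longrightarrow> p = (\<Sum>i<n. const (coeff p (ex i)) * xvar i)"
  by (auto simp: Lin_def coeff_lin intro!: sum.cong)
lemma const_sum: "const (sum f S) = (\<Sum>i\<in>S. const (f i))"
  by (induction S rule: infinite_finite_induct) (auto simp: single_add)

definition linpart :: "nat \<Rightarrow> 'k::comm_semiring_1 mpoly \<Rightarrow> 'k mpoly" where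
  "linpart n f = (\<Sum>i<n. const (coeff f (ex i)) * xvar i)"

interpretation mp: vector_space "\<lambda>(c :: 'k::field) (f :: 'k mpoly). const c * f"
  by unfold_locales (auto simp: distrib_left distrib_right single_add const_mult mult.assoc)
interpretation mpp: vector_space_pair "\<lambda>(c :: 'k::field) (f :: 'k mpoly). const c * f" "\<lambda>(c :: 'k::field) (f :: 'k mpoly). const c * f"
  ..

text \<open>Independent forms can be sent to the variables by a linear map. The resulting
  substitution is a left inverse of \<open>x_i \<mapsto> p_i\<close>, so evaluating a polynomial at
  independent forms loses no information.\<close>

lemma linear_forms_dual:
  fixes p :: "nat \<Rightarrow> 'k::field mpoly"
  assumes p: "\<And>i. i < n \<Longrightarrow> p i \<in> Lin r"
    and ind: "\<And>\<alpha>. (\<Sum>i<n. const (\<alpha> i) * p i) = 0 \<Longrightarrow> \<forall>i<n. \<alpha> i = 0"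
  shows "\<exists>q. (\<forall>j. q j \<in> Lin n) \<and> (\<forall>i<n. subst q (p i) = xvar i)"
proof -
  have inj: "inj_on p {..<n}"
  proof (rule inj_onI, rule ccontr)
    fix i j assume ij: "i \<in> {..<n}" "j \<in> {..<n}" "p i = p j" "i \<noteq> j"
    let ?\<alpha> = "\<lambda>l. (if l = i then 1 else 0) - (if l = j then 1 else 0 :: 'k)"
    have "(\<Sum>l<n. const (?\<alpha> l) * p l) = (\<Sum>l<n. (if l = i then p l else 0) - (if l = j then p l else 0))"
      by (rule sum.cong) (auto simp: single_uminus)
    also have "\<dots> = 0" using ij by (simp add: sum_subtractf sum.delta)
    finally show False using ind[of ?\<alpha>] ij by auto
  qed
  have "mp.independent (p ` {..<n})"
    unfolding mp.independent_explicit_module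
  proof (intro allI impI)
    fix t u v assume t: "finite t" "t \<subseteq> p ` {..<n}" "(\<Sum>v\<in>t. const (u v) * v) = 0" "v \<in> t"
    let ?\<alpha> = "\<lambda>i. if p i \<in> t then u (p i) else 0"
    have "(\<Sum>i<n. const (?\<alpha> i) * p i) = (\<Sum>w\<in>p ` {..<n}. (if w \<in> t then const (u w) * w else 0))"
      by (subst sum.reindex[OF inj]) (auto intro!: sum.cong)
    also have "\<dots> = (\<Sum>v\<in>t. const (u v) * v)"
      using t by (simp add: sum.inter_restrict[symmetric] Int_absorb1)
    finally have "\<forall>i<n. ?\<alpha> i = 0" using ind[of ?\<alpha>] t(3) by simp
    then show "u v = 0" using t(2,4) by force
  qed
  from mpp.linear_independent_extend[OF this, of "\<lambda>v. xvar (the_inv_into {..<n} p v)"]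
  obtain g where g: "Vector_Spaces.linear (\<lambda>(c :: 'k::field) (f :: 'k mpoly). const c * f) (\<lambda>(c :: 'k::field) (f :: 'k mpoly). const c * f) g"
    "\<forall>x\<in>p ` {..<n}. g x = xvar (the_inv_into {..<n} p x)" by blast
  interpret g: Vector_Spaces.linear "\<lambda>(c :: 'k::field) (f :: 'k mpoly). const c * f" "\<lambda>(c :: 'k::field) (f :: 'k mpoly). const c * f" g
    by (rule g(1))
  \<comment> \<open>The extended map \<open>g\<close> is linear on all polynomials but need not take
    linear forms to linear forms. Cutting down to the linear part in the first \<open>n\<close>
    variables is again linear and fixes each \<open>x_i\<close>.\<close>
  let ?q = "\<lambda>j. linpart n (g (xvar j))"
  have lin_sum: "linpart n (\<Sum>j<r. const (a j) * f j) = (\<Sum>j<r. const (a j) * linpart n (f j))" for a :: "nat \<Rightarrow> 'k" and f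
  proof -
    have "linpart n (\<Sum>j<r. const (a j) * f j) = (\<Sum>i<n. \<Sum>j<r. const (a j) * (const (coeff (f j) (ex i)) * xvar i))"
      unfolding linpart_def lookup_sum coeff_const_mult const_sum const_mult sum_distrib_right
      by (simp only: mult.assoc)
    also have "\<dots> = (\<Sum>j<r. const (a j) * linpart n (f j))"
      unfolding linpart_def sum_distrib_left by (rule sum.swap)
    finally show ?thesis .
  qed
  have "subst ?q (p i) = xvar i" if i: "i < n" for i
  proof -
    have "p i = (\<Sum>j<r. const (coeff (p i) (ex j)) * xvar j)" by (rule Lin_expand) (rule p[OF i])
    then have "subst ?q (p i) = subst ?q (\<Sum>j<r. const (coeff (p i) (ex j)) * xvar j)" by simp
    also have "\<dots> = (\<Sum>j<r. const (coeff (p i) (ex j)) * ?q j)" by (simp only: subst_sum subst_mult subst_const subst_xvar)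
    also have "\<dots> = linpart n (\<Sum>j<r. const (coeff (p i) (ex j)) * g (xvar j))" by (simp only: lin_sum)
    also have "(\<Sum>j<r. const (coeff (p i) (ex j)) * g (xvar j)) = g (\<Sum>j<r. const (coeff (p i) (ex j)) * xvar j)"
      by (simp only: g.sum g.scale)
    also have "\<dots> = g (p i)" using Lin_expand[OF p[OF i]] by simp
    also have "\<dots> = xvar i" using g(2) i the_inv_into_f_f[OF inj, of i] by auto
    also have "linpart n (xvar i) = (xvar i :: 'k mpoly)" unfolding linpart_def by (rule Lin_expand[OF Lin_xvar[OF i], symmetric])
    finally show ?thesis .
  qed
  moreover have "?q j \<in> Lin n" for j unfolding linpart_def by (rule LinI)
  ultimately show ?thesis by (intro exI[of _ ?q]) blast
qed

text \<open>Exponents are compared at the least index where they differ. With zero at the bottom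
  this is a monomial order, so \<open>m1 + m2 = m\<close> and \<open>m \<le> m1\<close> leave only
  \<open>m2 = 0\<close>.\<close>

lemma monomial_ge_0: "0 \<le> (m :: nat \<Rightarrow>\<^sub>0 nat)"
proof (cases "m = 0")
  case False
  then obtain i where i: "Poly_Mapping.lookup m i \<noteq> 0" by (metis lookup_zero poly_mapping_eqI)
  define k where "k = (LEAST i. Poly_Mapping.lookup m i \<noteq> 0)"
  have "Poly_Mapping.lookup m k \<noteq> 0" unfolding k_def by (rule LeastI[of _ i]) (rule i)
  moreover have "Poly_Mapping.lookup m j = 0" if "j < k" for j using not_less_Least that unfolding k_def by blast
  ultimately have "0 < m" by (auto simp: less_poly_mapping.rep_eq less_fun_def intro!: exI[of _ k])
  then show ?thesis by simp
qed simp

text \<open>The least monomial occurring in the coefficients \<open>g\<close> only meets the constant terms of \<open>b\<close>.\<close>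
lemma rows_independent_of_const_terms:
  fixes b :: "nat \<Rightarrow> nat \<Rightarrow> 'k::field mpoly"
  assumes ind: "\<And>\<alpha>. (\<forall>j<r. (\<Sum>i<n. \<alpha> i * coeff (b i j) 0) = 0) \<Longrightarrow> \<forall>i<n. \<alpha> i = 0"
    and g: "\<And>j. j < r \<Longrightarrow> (\<Sum>i<n. g i * b i j) = 0"
  shows "\<forall>i<n. g i = 0"
proof (rule ccontr)
  let ?K = "\<Union>i<n. Poly_Mapping.keys (g i)"
  assume "\<not> (\<forall>i<n. g i = 0)"
  then obtain i where "i < n" "g i \<noteq> 0" by blast
  then have K: "?K \<noteq> {}" "finite ?K" by (auto simp: keys_eq_empty)
  define m where "m = Min ?K"
  have m: "m \<in> ?K" and le: "\<And>m'. m' \<in> ?K \<Longrightarrow> m \<le> m'" using Min_in[OF K(2,1)] Min_le[OF K(2)] unfolding m_def by blast+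
  have key: "coeff (g i * f) m = coeff (g i) m * coeff f 0" if i: "i < n" for i and f :: "'k mpoly"
  proof (induction f rule: mpoly_induct)
    case (mon m2 c2)
    have "coeff (h * mon m2 c2) m = coeff h m * coeff (mon m2 c2) 0" if "\<forall>m'\<in>Poly_Mapping.keys h. m \<le> m'" for h :: "'k mpoly"
    proof (rule poly_mapping_single_add_induct[where f = h])
      fix m1 c1 assume "m1 \<in> Poly_Mapping.keys h"
      then have le1: "m \<le> m1" using that by blast
      have "m1 + m2 = m \<longleftrightarrow> m1 = m \<and> m2 = 0"
      proof
        assume e: "m1 + m2 = m"
        then have "m1 \<le> m" using add_left_mono[OF monomial_ge_0, of m1 m2] by simp
        then show "m1 = m \<and> m2 = 0" using le1 e by auto
      qed auto
      then show "coeff (mon m1 c1 * mon m2 c2) m = coeff (mon m1 c1) m * coeff (mon m2 c2) 0"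
        by (auto simp: mult_single lookup_single when_def)
    qed (auto simp: distrib_right lookup_add)
    then show ?case using le i by blast
  qed (simp add: distrib_left lookup_add)
  have "(\<Sum>i<n. coeff (g i) m * coeff (b i j) 0) = 0" if "j < r" for j
  proof -
    have "coeff (\<Sum>i<n. g i * b i j) m = 0" unfolding g[OF that] by simp
    moreover have "coeff (\<Sum>i<n. g i * b i j) m = (\<Sum>i<n. coeff (g i) m * coeff (b i j) 0)"
      unfolding lookup_sum by (rule sum.cong) (auto intro: key)
    ultimately show ?thesis by simp
  qed
  then have "\<forall>i<n. coeff (g i) m = 0" using ind[of "\<lambda>i. coeff (g i) m"] by simp
  then show False using m by auto
qed

text \<open>Gaussian elimination with the last diagonal entry as pivot, denominators cleared.\<close>
lemma matrix_inverse_up_to_unit: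
  fixes b :: "nat \<Rightarrow> nat \<Rightarrow> 'k::field mpoly"
  assumes "\<forall>i<n. \<forall>j<n. coeff (b i j) 0 = (if i = j then 1 else 0) \<and> b i j \<in> Rn m"
  shows "\<exists>c s. coeff s 0 = 1 \<and> s \<in> Rn m \<and> (\<forall>i<n. \<forall>k<n. c i k \<in> Rn m \<and>
     (\<Sum>j<n. c i j * b j k) = (if i = k then s else 0) \<and> (\<Sum>j<n. b i j * c j k) = (if i = k then s else 0))"
  using assms
proof (induction n arbitrary: b)
  case 0
  show ?case by (rule exI, rule exI[of _ 1]) simp
next
  case (Suc n)
  define p u v where "p = b n n" and "u = (\<lambda>i. b i n)" and "v = (\<lambda>j. b n j)"
  have p: "coeff p 0 = 1" "p \<in> Rn m" using Suc.prems by (auto simp: p_def)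
  have u: "coeff (u i) 0 = 0" "u i \<in> Rn m" "v i \<in> Rn m" if "i < n" for i
    using Suc.prems that by (auto simp: u_def v_def)
  \<comment> \<open>The Schur complement of the pivot, multiplied by \<open>p\<close>. It is again
    the identity modulo \<Delta>: \<open>p\<close> has constant term 1, and \<open>u i\<close>,
    \<open>v j\<close> have constant term 0.\<close>
  have "\<forall>i<n. \<forall>j<n. coeff (p * b i j - u i * v j) 0 = (if i = j then 1 else 0) \<and> p * b i j - u i * v j \<in> Rn m"
    using Suc.prems by (auto simp: lookup_minus coeff0_mult u p)
  from Suc.IH[OF this] obtain c s where s: "coeff s 0 = 1" "s \<in> Rn m"
    and c: "\<And>i k. i < n \<Longrightarrow> k < n \<Longrightarrow> c i k \<in> Rn m"
    and c1: "\<And>i k. i < n \<Longrightarrow> k < n \<Longrightarrow> (\<Sum>j<n. c i j * (p * b j k - u j * v k)) = (if i = k then s else 0)"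
    and c2: "\<And>i k. i < n \<Longrightarrow> k < n \<Longrightarrow> (\<Sum>j<n. (p * b i j - u i * v j) * c j k) = (if i = k then s else 0)"
    by blast
  define cu vc vcu where "cu = (\<lambda>i. \<Sum>j<n. c i j * u j)" and "vc = (\<lambda>j. \<Sum>i<n. v i * c i j)"
    and "vcu = (\<Sum>i<n. v i * cu i)"
  have mem: "cu i \<in> Rn m" "vc i \<in> Rn m" "vcu \<in> Rn m" if "i < n" for i
    using that c u by (auto simp: cu_def vc_def vcu_def intro!: Rn_sum Rn_mult)
  have vcu2: "vcu = (\<Sum>j<n. vc j * u j)"
    unfolding vcu_def cu_def vc_def sum_distrib_left sum_distrib_right
    by (subst sum.swap) (simp add: ac_simps)
  have k1: "p * (\<Sum>j<n. c i j * b j k) = (if i = k then s else 0) + cu i * v k" if "i < n" "k < n" for i k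
    unfolding c1[OF that, symmetric] cu_def sum_distrib_left sum_distrib_right sum.distrib[symmetric]
    by (rule sum.cong) (auto simp: algebra_simps)
  have k2: "p * (\<Sum>j<n. b i j * c j k) = (if i = k then s else 0) + u i * vc k" if "i < n" "k < n" for i k
    unfolding c2[OF that, symmetric] vc_def sum_distrib_left sum_distrib_right sum.distrib[symmetric]
    by (rule sum.cong) (auto simp: algebra_simps)
  have k3: "p * (\<Sum>j<n. vc j * b j k) = s * v k + vcu * v k" if k: "k < n" for k
  proof -
    have "p * (\<Sum>j<n. vc j * b j k) = (\<Sum>i<n. v i * (p * (\<Sum>j<n. c i j * b j k)))"
      unfolding vc_def sum_distrib_left sum_distrib_right by (subst sum.swap) (simp add: ac_simps)
    also have "\<dots> = (\<Sum>i<n. (if i = k then v i * s else 0) + v i * cu i * v k)"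
    proof (intro sum.cong HOL.refl)
      fix i assume "i \<in> {..<n}"
      then have i: "i < n" by simp
      show "v i * (p * (\<Sum>j<n. c i j * b j k)) = (if i = k then v i * s else 0) + v i * cu i * v k"
        unfolding k1[OF i k] by (simp add: algebra_simps)
    qed
    also have "\<dots> = s * v k + vcu * v k"
      using k by (simp add: sum.distrib sum.delta vcu_def sum_distrib_left sum_distrib_right ac_simps)
    finally show ?thesis .
  qed
  have k4: "p * (\<Sum>j<n. b i j * cu j) = s * u i + u i * vcu" if i: "i < n" for i
  proof -
    have "p * (\<Sum>j<n. b i j * cu j) = (\<Sum>k<n. (p * (\<Sum>j<n. b i j * c j k)) * u k)"
      unfolding cu_def sum_distrib_left sum_distrib_right by (subst sum.swap) (simp add: ac_simps)
    also have "\<dots> = (\<Sum>k<n. (if i = k then s * u k else 0) + u i * (vc k * u k))"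
    proof (intro sum.cong HOL.refl)
      fix k assume "k \<in> {..<n}"
      then have k: "k < n" by simp
      show "p * (\<Sum>j<n. b i j * c j k) * u k = (if i = k then s * u k else 0) + u i * (vc k * u k)"
        unfolding k2[OF i k] by (simp add: algebra_simps)
    qed
    also have "\<dots> = s * u i + u i * vcu"
      using i by (simp add: sum.distrib sum.delta vcu2 sum_distrib_left)
    finally show ?thesis .
  qed
  \<comment> \<open>The block inverse over the fraction field, computed from the inverse
    \<open>p * c / s\<close> of the Schur complement and multiplied by \<open>p * s\<close>.\<close>
  define d where "d = (\<lambda>i j. if i < n then (if j < n then p * p * c i j else - (p * cu i))
     else (if j < n then - (p * vc j) else s + vcu))"
  have "(\<Sum>j<Suc n. d i j * b j k) = (if i = k then p * s else 0) \<and> (\<Sum>j<Suc n. b i j * d j k) = (if i = k then p * s else 0)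
    \<and> d i k \<in> Rn m" if ik: "i < Suc n" "k < Suc n" for i k
  proof -
    have bn: "b i n = u i" "b n i = v i" "b n n = p" for i by (auto simp: u_def v_def p_def)
    have e1: "(\<Sum>j<n. d i j * b j k) = p * (p * (\<Sum>j<n. c i j * b j k))" if "i < n" for i k
      unfolding sum_distrib_left using that by (intro sum.cong) (auto simp: d_def ac_simps)
    have e2: "(\<Sum>j<n. d n j * b j k) = - (p * (\<Sum>j<n. vc j * b j k))" for k
      unfolding sum_distrib_left sum_negf[symmetric] by (intro sum.cong) (auto simp: d_def ac_simps)
    have e3: "(\<Sum>j<n. b i j * d j k) = p * (p * (\<Sum>j<n. b i j * c j k))" if "k < n" for i k
      unfolding sum_distrib_left using that by (intro sum.cong) (auto simp: d_def ac_simps)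
    have e4: "(\<Sum>j<n. b i j * d j n) = - (p * (\<Sum>j<n. b i j * cu j))" for i
      unfolding sum_distrib_left sum_negf[symmetric] by (intro sum.cong) (auto simp: d_def ac_simps)
    have f1: "(\<Sum>j<n. c i j * u j) = cu i" for i by (simp add: cu_def)
    have f2: "(\<Sum>j<n. v j * c j i) = vc i" for i by (simp add: vc_def)
    consider "i < n" "k < n" | "i < n" "k = n" | "i = n" "k < n" | "i = n" "k = n" using ik by linarith
    then show ?thesis
    proof cases
      case 1 then show ?thesis using p mem c
        by (simp add: e1 e3 k1 k2 bn) (simp add: d_def algebra_simps)
    next
      case 2
      have "(\<Sum>j<n. d i j * b j n) = p * (p * cu i)" using e1[OF 2(1), of n] by (simp only: bn f1)
      then show ?thesis using p mem c 2
        by (simp add: e4 k4 bn(2,3)) (simp add: d_def u_def v_def p_def algebra_simps)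
    next
      case 3
      have "(\<Sum>j<n. b n j * d j k) = p * (p * vc k)" using e3[OF 3(2), of n] by (simp only: bn f2)
      then show ?thesis using p mem c 3
        by (simp add: e2 k3) (simp add: d_def u_def v_def p_def algebra_simps)
    next
      case 4 
      have "vcu \<in> Rn m" using u c by (auto simp: cu_def vcu_def intro!: Rn_sum Rn_mult)
      moreover have "(\<Sum>j<n. d n j * b j n) = - (p * vcu)" using e2[of n] by (simp only: bn vcu2)
      moreover have "(\<Sum>j<n. b n j * d j n) = - (p * vcu)" using e4[of n] by (simp only: bn vcu_def)
      ultimately show ?thesis using 4 s
        by simp (simp add: d_def u_def v_def p_def algebra_simps)
    qed
  qed
  then show ?case using p s by (intro exI[of _ d] exI[of _ "p * s"]) (auto simp: coeff0_mult)
qed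

text \<open>A nontrivial equation \<open>a + b * g = 0\<close> has at most one solution
  \<open>g\<close>, whereas the powers of one variable already make \<open>Rn r\<close> infinite,
  even over a finite field.\<close>

lemma avoid_finite:
  fixes E :: "('k::field mpoly \<times> 'k mpoly) set"
  assumes "finite E" and "0 < r"
  shows "\<exists>g\<in>Rn r. \<forall>(a, b)\<in>E. (a, b) \<noteq> (0, 0) \<longrightarrow> a + b * g \<noteq> 0"
proof -
  have inj: "inj (\<lambda>e. mon (Poly_Mapping.single 0 e) 1 :: 'k mpoly)"
  proof (rule injI)
    fix e e' assume "mon (Poly_Mapping.single 0 e) (1::'k) = mon (Poly_Mapping.single 0 e') 1"
    then have "Poly_Mapping.single 0 e = (Poly_Mapping.single 0 e' :: nat \<Rightarrow>\<^sub>0 nat)"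
      by (metis lookup_single_eq lookup_single_not_eq zero_neq_one)
    then show "e = e'" by (metis lookup_single_eq)
  qed
  have "range (\<lambda>e. mon (Poly_Mapping.single 0 e) 1) \<subseteq> (Rn r :: 'k mpoly set)"
    using assms(2) by (auto simp: Rn_iff split: if_splits)
  then have inf: "infinite (Rn r :: 'k mpoly set)"
    using infinite_super infinite_UNIV_nat finite_imageD[OF _ inj] by blast
  have "finite {g. a + b * g = 0}" if "(a, b) \<noteq> (0, 0)" for a b :: "'k mpoly"
  proof (cases "b = 0")
    case False
    have "g = h" if "a + b * g = 0" "a + b * h = 0" for g h
      using that False by (metis add_left_cancel mult_left_cancel)
    then have "{g. a + b * g = 0} = {} \<or> (\<exists>g. {g. a + b * g = 0} = {g})" by blast
    then show ?thesis by auto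
  qed (use that in auto)
  then have "finite (\<Union>e\<in>{e\<in>E. e \<noteq> (0, 0)}. {g. fst e + snd e * g = 0})"
    using assms(1) by auto
  then obtain g where "g \<in> Rn r" "g \<notin> (\<Union>e\<in>{e\<in>E. e \<noteq> (0, 0)}. {g. fst e + snd e * g = 0})"
    using inf by (meson finite_subset subsetI)
  then show ?thesis by (intro bexI[of _ g]) auto
qed

lemma avoid_finite_vectors:
  fixes E :: "('k::field mpoly \<times> (nat \<Rightarrow> 'k mpoly)) set"
  assumes "finite E" and "0 < r"
  shows "\<exists>g. (\<forall>j. g j \<in> Rn r) \<and> (\<forall>(a, f)\<in>E. a \<noteq> 0 \<or> (\<exists>j<s. f j \<noteq> 0) \<longrightarrow> a + (\<Sum>j<s. f j * g j) \<noteq> 0)"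
proof (induction s)
  case 0 show ?case by (rule exI[of _ "\<lambda>_. 0"]) auto
next
  case (Suc s)
  then obtain g where g: "\<forall>j. g j \<in> Rn r"
    "\<forall>(a, f)\<in>E. a \<noteq> 0 \<or> (\<exists>j<s. f j \<noteq> 0) \<longrightarrow> a + (\<Sum>j<s. f j * g j) \<noteq> 0" by blast
  \<comment> \<open>The first \<open>s\<close> coordinates are evaluated, so each member of
    \<open>E\<close> leaves a condition that is affine in the one new coordinate.\<close>
  obtain h where h: "h \<in> Rn r" "\<forall>(a, b)\<in>(\<lambda>(a, f). (a + (\<Sum>j<s. f j * g j), f s)) ` E. (a, b) \<noteq> (0, 0) \<longrightarrow> a + b * h \<noteq> 0"
    using avoid_finite[OF finite_imageI[OF assms(1)] assms(2)] by blast
  let ?g = "g(s := h)"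
  have "a + (\<Sum>j<Suc s. f j * ?g j) \<noteq> 0" if af: "(a, f) \<in> E" "a \<noteq> 0 \<or> (\<exists>j<Suc s. f j \<noteq> 0)" for a f
  proof -
    have "a + (\<Sum>j<s. f j * g j) \<noteq> 0 \<or> f s \<noteq> 0" using g(2) af less_Suc_eq by fastforce
    then have "a + (\<Sum>j<s. f j * g j) + f s * h \<noteq> 0" using h(2) af(1) by fastforce
    moreover have "(\<Sum>j<s. f j * ?g j) = (\<Sum>j<s. f j * g j)" by (rule sum.cong) auto
    ultimately show ?thesis by (simp add: add.assoc)
  qed
  then show ?case using g(1) h(1) by (intro exI[of _ ?g]) auto
qed

section \<open>Polynomial actions in Lie algebras\<close>

locale lie =
  fixes A :: "('k::field, 'a) liealg"
  assumes lie_alg: "lie_alg A"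
begin

lemma closed [simp, intro]:
  "zero A \<in> carrier A"
  "x \<in> carrier A \<Longrightarrow> y \<in> carrier A \<Longrightarrow> add A x y \<in> carrier A"
  "x \<in> carrier A \<Longrightarrow> y \<in> carrier A \<Longrightarrow> br A x y \<in> carrier A"
  "x \<in> carrier A \<Longrightarrow> neg A x \<in> carrier A"
  "x \<in> carrier A \<Longrightarrow> sm A a x \<in> carrier A"
  using lie_alg unfolding lie_alg_def by blast+

lemma add_assoc: "x \<in> carrier A \<Longrightarrow> y \<in> carrier A \<Longrightarrow> z \<in> carrier A \<Longrightarrow> add A (add A x y) z = add A x (add A y z)"
  and add_comm: "x \<in> carrier A \<Longrightarrow> y \<in> carrier A \<Longrightarrow> add A x y = add A y x"
  and add_zero_left [simp]: "x \<in> carrier A \<Longrightarrow> add A (zero A) x = x"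
  and neg_add [simp]: "x \<in> carrier A \<Longrightarrow> add A (neg A x) x = zero A"
  and br_add_left: "x \<in> carrier A \<Longrightarrow> y \<in> carrier A \<Longrightarrow> z \<in> carrier A \<Longrightarrow> br A (add A x y) z = add A (br A x z) (br A y z)"
  and br_add_right: "x \<in> carrier A \<Longrightarrow> y \<in> carrier A \<Longrightarrow> z \<in> carrier A \<Longrightarrow> br A x (add A y z) = add A (br A x y) (br A x z)"
  and jacobi: "x \<in> carrier A \<Longrightarrow> y \<in> carrier A \<Longrightarrow> z \<in> carrier A \<Longrightarrow>
     add A (add A (br A (br A x y) z) (br A (br A y z) x)) (br A (br A z x) y) = zero A"
  and sm_add_right: "x \<in> carrier A \<Longrightarrow> y \<in> carrier A \<Longrightarrow> sm A a (add A x y) = add A (sm A a x) (sm A a y)"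
  and br_sm_left: "x \<in> carrier A \<Longrightarrow> y \<in> carrier A \<Longrightarrow> br A (sm A a x) y = sm A a (br A x y)"
  and br_sm_right: "x \<in> carrier A \<Longrightarrow> y \<in> carrier A \<Longrightarrow> br A x (sm A a y) = sm A a (br A x y)"
  and br_self [simp]: "x \<in> carrier A \<Longrightarrow> br A x x = zero A"
  and sm_one [simp]: "x \<in> carrier A \<Longrightarrow> sm A 1 x = x"
  and sm_add_left: "x \<in> carrier A \<Longrightarrow> sm A (a + b) x = add A (sm A a x) (sm A b x)"
  and sm_sm: "x \<in> carrier A \<Longrightarrow> sm A (a * b) x = sm A a (sm A b x)"
  using lie_alg unfolding lie_alg_def by blast+

lemma add_zero_right [simp]: "x \<in> carrier A \<Longrightarrow> add A x (zero A) = x"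
  using add_comm[of x "zero A"] by simp
lemma add_neg [simp]: "x \<in> carrier A \<Longrightarrow> add A x (neg A x) = zero A"
  using add_comm[of x "neg A x"] by simp
lemma add_left_comm: "x \<in> carrier A \<Longrightarrow> y \<in> carrier A \<Longrightarrow> z \<in> carrier A \<Longrightarrow> add A x (add A y z) = add A y (add A x z)"
  by (metis add_assoc add_comm)
lemma add_left_cancel: "x \<in> carrier A \<Longrightarrow> y \<in> carrier A \<Longrightarrow> z \<in> carrier A \<Longrightarrow> add A x y = add A x z \<longleftrightarrow> y = z"
  by (metis add_assoc add_zero_left closed(4) neg_add)
lemma add_eq_self: "x \<in> carrier A \<Longrightarrow> y \<in> carrier A \<Longrightarrow> add A x y = x \<Longrightarrow> y = zero A"
  by (metis add_left_cancel add_zero_right closed(1))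
lemma eq_neg_iff: "x \<in> carrier A \<Longrightarrow> y \<in> carrier A \<Longrightarrow> add A x y = zero A \<longleftrightarrow> y = neg A x"
  by (metis add_left_cancel add_neg closed(4))
lemma add_neg_eq_zero: "x \<in> carrier A \<Longrightarrow> y \<in> carrier A \<Longrightarrow> add A x (neg A y) = zero A \<longleftrightarrow> x = y"
  by (metis add_comm add_left_cancel closed(4) neg_add)
lemma sm_zero_right [simp]: "sm A a (zero A) = zero A"
  by (metis add_eq_self add_zero_left closed(1,5) sm_add_right)
lemma sm_zero_left [simp]: "x \<in> carrier A \<Longrightarrow> sm A 0 x = zero A"
  by (metis add.right_neutral add_eq_self closed(5) sm_add_left)
lemma neg_eq_sm: "x \<in> carrier A \<Longrightarrow> neg A x = sm A (- 1) x"
proof -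
  assume x: "x \<in> carrier A"
  have "add A x (sm A (- 1) x) = sm A (1 + - 1) x" using x sm_add_left[OF x, of 1 "- 1"] by simp
  then show ?thesis using x eq_neg_iff by simp
qed
lemma neg_zero [simp]: "neg A (zero A) = zero A" by (simp add: neg_eq_sm)
lemma br_zero [simp]: "x \<in> carrier A \<Longrightarrow> br A (zero A) x = zero A" "x \<in> carrier A \<Longrightarrow> br A x (zero A) = zero A"
  by (metis br_sm_left closed(1) sm_zero_left closed(3) sm_zero_right)
     (metis br_sm_right closed(1) sm_zero_left closed(3) sm_zero_right)
lemma br_anti: "x \<in> carrier A \<Longrightarrow> y \<in> carrier A \<Longrightarrow> br A y x = neg A (br A x y)"
proof -
  assume x: "x \<in> carrier A" "y \<in> carrier A"
  have "br A (add A x y) (add A x y) = add A (br A x (add A x y)) (br A y (add A x y))"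
    using x by (intro br_add_left) auto
  also have "\<dots> = add A (br A x y) (br A y x)" using x by (simp add: br_add_right)
  finally have "add A (br A x y) (br A y x) = zero A" using x by simp
  then show ?thesis using x eq_neg_iff by simp
qed
lemma br_eq_zero_sym: "x \<in> carrier A \<Longrightarrow> y \<in> carrier A \<Longrightarrow> br A x y = zero A \<Longrightarrow> br A y x = zero A"
  by (simp add: br_anti[of x y])
lemma sm_eq_zero_iff: "x \<in> carrier A \<Longrightarrow> sm A a x = zero A \<longleftrightarrow> a = 0 \<or> x = zero A"
  by (metis left_inverse sm_one sm_sm sm_zero_left sm_zero_right)

lemma lsum_simps [simp]: "lsum A [] = zero A" "lsum A (x # xs) = add A x (lsum A xs)"
  by (simp_all add: lsum_def)
lemma lsum_closed [simp, intro]: "set xs \<subseteq> carrier A \<Longrightarrow> lsum A xs \<in> carrier A"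
  by (induction xs) auto
lemma lsum_append: "set xs \<subseteq> carrier A \<Longrightarrow> set ys \<subseteq> carrier A \<Longrightarrow> lsum A (xs @ ys) = add A (lsum A xs) (lsum A ys)"
  by (induction xs) (auto simp: add_assoc)
lemma lsum_map_add: "(\<And>x. x \<in> set xs \<Longrightarrow> F x \<in> carrier A \<and> G x \<in> carrier A) \<Longrightarrow>
   lsum A (map (\<lambda>x. add A (F x) (G x)) xs) = add A (lsum A (map F xs)) (lsum A (map G xs))"
proof (induction xs)
  case (Cons x xs)
  then have "set (map F xs) \<subseteq> carrier A" "set (map G xs) \<subseteq> carrier A" by auto
  then have "lsum A (map F xs) \<in> carrier A" "lsum A (map G xs) \<in> carrier A" by blast+
  then show ?case using Cons by (simp add: add_assoc add_left_comm)
qed simp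
lemma lsum_map_sm: "(\<And>x. x \<in> set xs \<Longrightarrow> F x \<in> carrier A) \<Longrightarrow>
   lsum A (map (\<lambda>x. sm A a (F x)) xs) = sm A a (lsum A (map F xs))"
  by (induction xs) (auto simp: sm_add_right image_subset_iff)
lemma lsum_map_br: "(\<And>x. x \<in> set xs \<Longrightarrow> F x \<in> carrier A) \<Longrightarrow> y \<in> carrier A \<Longrightarrow>
   lsum A (map (\<lambda>x. br A (F x) y) xs) = br A (lsum A (map F xs)) y"
  by (induction xs) (auto simp: br_add_left image_subset_iff)
lemma lsum_map_zero: "(\<And>x. x \<in> set xs \<Longrightarrow> F x = zero A) \<Longrightarrow> lsum A (map F xs) = zero A"
  by (induction xs) auto
lemma lsum_remove1: "x \<in> set xs \<Longrightarrow> (\<And>y. y \<in> set xs \<Longrightarrow> F y \<in> carrier A) \<Longrightarrow>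
   lsum A (map F xs) = add A (F x) (lsum A (map F (remove1 x xs)))"
proof (induction xs)
  case (Cons y xs)
  have "set (map F (remove1 x xs)) \<subseteq> carrier A" using Cons.prems set_remove1_subset[of x xs] by auto
  then show ?case using Cons by (auto simp: add_left_comm)
qed simp
text \<open>Sums do not depend on how the support is enumerated, so the actions of two polynomials
  can be compared over one common list of monomials.\<close>

lemma lsum_support: "distinct xs \<Longrightarrow> distinct ys \<Longrightarrow> set xs \<subseteq> set ys \<Longrightarrow> (\<And>y. y \<in> set ys \<Longrightarrow> F y \<in> carrier A) \<Longrightarrow>
   (\<And>y. y \<in> set ys \<Longrightarrow> y \<notin> set xs \<Longrightarrow> F y = zero A) \<Longrightarrow> lsum A (map F xs) = lsum A (map F ys)"
proof (induction ys arbitrary: xs)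
  case (Cons y ys)
  have c: "lsum A (map F ys) \<in> carrier A" using Cons.prems(4) by (intro lsum_closed) auto
  show ?case
  proof (cases "y \<in> set xs")
    case True
    have "lsum A (map F xs) = add A (F y) (lsum A (map F (remove1 y xs)))"
      by (rule lsum_remove1) (use True Cons.prems in auto)
    also have "lsum A (map F (remove1 y xs)) = lsum A (map F ys)"
      by (rule Cons.IH) (use Cons.prems in auto)
    finally show ?thesis by simp
  next
    case False
    then have "lsum A (map F xs) = lsum A (map F ys)" by (intro Cons.IH) (use Cons.prems in auto)
    then show ?thesis using Cons.prems(5)[of y] False c by simp
  qed
qed simp

lemma lsum_single: "distinct xs \<Longrightarrow> i \<in> set xs \<Longrightarrow> F i \<in> carrier A \<Longrightarrow> (\<And>x. x \<in> set xs \<Longrightarrow> x \<noteq> i \<Longrightarrow> F x = zero A) \<Longrightarrow>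
   lsum A (map F xs) = F i"
proof -
  assume a: "distinct xs" "i \<in> set xs" "F i \<in> carrier A" "\<And>x. x \<in> set xs \<Longrightarrow> x \<noteq> i \<Longrightarrow> F x = zero A"
  have "F y \<in> carrier A" if "y \<in> set xs" for y using a that by (cases "y = i") auto
  then have "lsum A (map F [i]) = lsum A (map F xs)" using a by (intro lsum_support) auto
  then show ?thesis using a by simp
qed

end

section \<open>Monomials and polynomials acting by left-normed products\<close>

lemma mono_act_mono:
  "Poly_Mapping.keys m \<subseteq> {..<N} \<Longrightarrow> N \<le> N' \<Longrightarrow> mono_act A u b m N' = mono_act A u b m N"
proof (induction N')
  case (Suc N')
  show ?case
  proof (cases "N = Suc N'")
    case False
    then have "N \<le> N'" using Suc by simp
    then have "Poly_Mapping.lookup m N' = 0" using Suc.prems(1) by (auto simp: in_keys_iff subset_iff)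
    then show ?thesis using Suc \<open>N \<le> N'\<close> by simp
  qed simp
qed simp

text \<open>The bound built into \<open>act\<close> varies with the monomial; it is replaced by one
  bound \<open>n\<close> valid for a whole polynomial.\<close>

lemma mono_act_keys:
  "Poly_Mapping.keys m \<subseteq> {..<n} \<Longrightarrow>
   mono_act A u b m (Suc (Max (insert 0 (Poly_Mapping.keys m)))) = mono_act A u b m n"
proof -
  assume a: "Poly_Mapping.keys m \<subseteq> {..<n}"
  let ?N = "Suc (Max (insert 0 (Poly_Mapping.keys m)))"
  have "Poly_Mapping.keys m \<subseteq> {..<?N}" by (auto simp: less_Suc_eq_le)
  then show ?thesis using mono_act_mono[OF a, of "max n ?N" A u b] mono_act_mono[of m ?N "max n ?N" A u b] by simp
qed

text \<open>The conditions under which the \<open>b i\<close> act on \<open>M\<close> by commuting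
  operators, so that \<open>act\<close> makes \<open>M\<close> a module over \<open>R_n\<close>.
  Besides the derived algebra, the pairs with zero linear part and the centraliser
  \<open>Cent A\<close> are treated as such modules.\<close>

locale lie_module = lie A for A :: "('k::field, 'a) liealg" +
  fixes M :: "'a set" and b :: "nat \<Rightarrow> 'a" and n :: nat
  assumes M_sub: "M \<subseteq> carrier A"
    and M_add: "\<And>u v. u \<in> M \<Longrightarrow> v \<in> M \<Longrightarrow> add A u v \<in> M"
    and M_sm: "\<And>u a. u \<in> M \<Longrightarrow> sm A a u \<in> M"
    and M_zero: "zero A \<in> M"
    and M_br: "\<And>u i. u \<in> M \<Longrightarrow> i < n \<Longrightarrow> br A u (b i) \<in> M"
    and b_closed: "\<And>i. i < n \<Longrightarrow> b i \<in> carrier A"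
    and br_br_comm: "\<And>u i j. u \<in> M \<Longrightarrow> i < n \<Longrightarrow> j < n \<Longrightarrow> br A (br A u (b i)) (b j) = br A (br A u (b j)) (b i)"
begin

lemma M_carrier [simp, intro]: "u \<in> M \<Longrightarrow> u \<in> carrier A" using M_sub by blast

lemma br_pow_closed: "u \<in> M \<Longrightarrow> i < n \<Longrightarrow> ((\<lambda>v. br A v (b i)) ^^ e) u \<in> M"
  by (induction e) (auto intro: M_br)
lemma br_pow_add: "u \<in> M \<Longrightarrow> v \<in> M \<Longrightarrow> i < n \<Longrightarrow>
  ((\<lambda>v. br A v (b i)) ^^ e) (add A u v) = add A (((\<lambda>v. br A v (b i)) ^^ e) u) (((\<lambda>v. br A v (b i)) ^^ e) v)"
  by (induction e) (auto simp: br_add_left br_pow_closed b_closed)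
lemma br_pow_sm: "u \<in> M \<Longrightarrow> i < n \<Longrightarrow>
  ((\<lambda>v. br A v (b i)) ^^ e) (sm A a u) = sm A a (((\<lambda>v. br A v (b i)) ^^ e) u)"
  by (induction e) (auto simp: br_sm_left br_pow_closed b_closed)
lemma br_pow_comm: "u \<in> M \<Longrightarrow> i < n \<Longrightarrow> j < n \<Longrightarrow>
  ((\<lambda>v. br A v (b i)) ^^ e) (br A u (b j)) = br A (((\<lambda>v. br A v (b i)) ^^ e) u) (b j)"
  by (induction e) (auto simp: br_pow_closed br_br_comm)

lemma mono_act_closed: "u \<in> M \<Longrightarrow> N \<le> n \<Longrightarrow> mono_act A u b m N \<in> M"
  by (induction N) (auto intro: br_pow_closed)
lemma mono_act_add: "u \<in> M \<Longrightarrow> v \<in> M \<Longrightarrow> N \<le> n \<Longrightarrow>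
   mono_act A (add A u v) b m N = add A (mono_act A u b m N) (mono_act A v b m N)"
  by (induction N) (auto simp: br_pow_add mono_act_closed)
lemma mono_act_sm: "u \<in> M \<Longrightarrow> N \<le> n \<Longrightarrow> mono_act A (sm A a u) b m N = sm A a (mono_act A u b m N)"
  by (induction N) (auto simp: br_pow_sm mono_act_closed)
lemma mono_act_br: "u \<in> M \<Longrightarrow> N \<le> n \<Longrightarrow> j < n \<Longrightarrow> mono_act A (br A u (b j)) b m N = br A (mono_act A u b m N) (b j)"
  by (induction N) (auto simp: br_pow_comm mono_act_closed)
lemma mono_act_ex: "u \<in> M \<Longrightarrow> N \<le> n \<Longrightarrow> i < n \<Longrightarrow>
   mono_act A u b (m + ex i) N = (if i < N then br A (mono_act A u b m N) (b i) else mono_act A u b m N)"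
proof (induction N)
  case (Suc N)
  show ?case
  proof (cases "i = N")
    case True
    then have "Poly_Mapping.lookup (m + ex i) N = Suc (Poly_Mapping.lookup m N)" by (simp add: lookup_add)
    then show ?thesis using Suc True by simp
  next
    case False
    then have "Poly_Mapping.lookup (m + ex i) N = Poly_Mapping.lookup m N" by (simp add: lookup_add lookup_single)
    then show ?thesis using Suc False by (auto simp: br_pow_comm mono_act_closed)
  qed
qed simp

abbreviation mact :: "'a \<Rightarrow> (nat \<Rightarrow>\<^sub>0 nat) \<Rightarrow> 'a" where "mact u m \<equiv> mono_act A u b m n"

lemma mact_closed: "u \<in> M \<Longrightarrow> mact u m \<in> M" by (simp add: mono_act_closed)

lemma act_eq_lsum:
  assumes "u \<in> M" "distinct xs" "Poly_Mapping.keys f \<subseteq> set xs" "f \<in> Rn n"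
  shows "act A u b f = lsum A (map (\<lambda>m. sm A (coeff f m) (mact u m)) xs)"
proof -
  have "act A u b f = lsum A (map (\<lambda>m. sm A (coeff f m) (mact u m)) (sorted_list_of_set (Poly_Mapping.keys f)))"
    unfolding act_def by (intro arg_cong[where f = "lsum A"] map_cong)
      (use assms(4) in \<open>auto simp: Rn_iff mono_act_keys simp del: mono_act.simps\<close>)
  also have "\<dots> = lsum A (map (\<lambda>m. sm A (coeff f m) (mact u m)) xs)"
    using assms by (intro lsum_support) (auto simp: in_keys_iff mact_closed)
  finally show ?thesis .
qed

lemma ex_support: "\<exists>xs. distinct xs \<and> Poly_Mapping.keys f \<subseteq> set xs \<and> Poly_Mapping.keys g \<subseteq> set xs"
  by (metis Un_upper1 Un_upper2 finite_distinct_list finite_keys finite_UnI)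

lemma act_closed [intro]: "u \<in> M \<Longrightarrow> f \<in> Rn n \<Longrightarrow> act A u b f \<in> M"
proof -
  assume a: "u \<in> M" "f \<in> Rn n"
  have "lsum A (map (\<lambda>m. sm A (coeff f m) (mact u m)) xs) \<in> M" for xs
    by (induction xs) (auto intro: M_zero M_add M_sm mact_closed a)
  then show ?thesis using act_eq_lsum[OF a(1) _ _ a(2)] ex_support[of f f] by auto
qed

lemma act_add_right: "u \<in> M \<Longrightarrow> f \<in> Rn n \<Longrightarrow> g \<in> Rn n \<Longrightarrow> act A u b (f + g) = add A (act A u b f) (act A u b g)"
proof -
  assume a: "u \<in> M" "f \<in> Rn n" "g \<in> Rn n"
  obtain xs where xs: "distinct xs" "Poly_Mapping.keys f \<subseteq> set xs" "Poly_Mapping.keys g \<subseteq> set xs"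
    using ex_support[of f g] by (elim exE conjE)
  then have xs': "Poly_Mapping.keys (f + g) \<subseteq> set xs" using keys_add[of f g] by (meson Un_least order_trans)
  show ?thesis
    unfolding act_eq_lsum[OF a(1) xs(1,2) a(2)] act_eq_lsum[OF a(1) xs(1,3) a(3)]
      act_eq_lsum[OF a(1) xs(1) xs' Rn_add[OF a(2,3)]]
    using a by (subst lsum_map_add[symmetric]) (simp_all add: lookup_add sm_add_left mact_closed)
qed

lemma act_0: "u \<in> M \<Longrightarrow> act A u b 0 = zero A" by (simp add: act_def)

lemma act_mon: "u \<in> M \<Longrightarrow> Poly_Mapping.keys m \<subseteq> {..<n} \<Longrightarrow> act A u b (mon m c) = sm A c (mact u m)"
  using act_eq_lsum[of u "[m]" "mon m c"] by (auto simp: Rn_iff mact_closed split: if_splits)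

lemma act_const: "u \<in> M \<Longrightarrow> act A u b (const c) = sm A c u"
proof -
  have "mono_act A u b 0 N = u" for N by (induction N) auto
  then show "u \<in> M \<Longrightarrow> ?thesis" by (simp add: act_mon)
qed
lemma act_1: "u \<in> M \<Longrightarrow> act A u b 1 = u" using act_const[of u 1] by simp

lemma act_add_left: "u \<in> M \<Longrightarrow> v \<in> M \<Longrightarrow> f \<in> Rn n \<Longrightarrow> act A (add A u v) b f = add A (act A u b f) (act A v b f)"
proof -
  assume a: "u \<in> M" "v \<in> M" "f \<in> Rn n"
  obtain xs where xs: "distinct xs" "Poly_Mapping.keys f \<subseteq> set xs" using ex_support[of f f] by (elim exE conjE)
  show ?thesis
    unfolding act_eq_lsum[OF a(1) xs a(3)] act_eq_lsum[OF a(2) xs a(3)] act_eq_lsum[OF M_add[OF a(1,2)] xs a(3)]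
    using a by (subst lsum_map_add[symmetric]) (simp_all add: mono_act_add sm_add_right mact_closed)
qed

lemma act_mult_xvar: "f \<in> Rn n \<Longrightarrow> u \<in> M \<Longrightarrow> i < n \<Longrightarrow> act A u b (f * xvar i) = br A (act A u b f) (b i)"
proof (induction f rule: Rn_induct)
  case (mon m c)
  then have "Poly_Mapping.keys (m + ex i) \<subseteq> {..<n}" by (auto simp: keys_add_nat)
  then show ?case using mon unfolding mon_mult_xvar[symmetric]
    by (simp add: act_mon mono_act_ex br_sm_left mact_closed b_closed)
next
  case (add f g)
  then have "act A u b (f * xvar i + g * xvar i) = add A (br A (act A u b f) (b i)) (br A (act A u b g) (b i))"
    by (simp add: act_add_right)
  then show ?case using add by (simp add: distrib_right act_add_right br_add_left b_closed act_closed)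
qed

lemma act_const_mult: "f \<in> Rn n \<Longrightarrow> u \<in> M \<Longrightarrow> act A u b (f * const c) = sm A c (act A u b f)"
proof (induction f rule: Rn_induct)
  case (mon m d)
  then show ?case by (simp add: mult_single act_mon mult.commute[of d] sm_sm mact_closed)
next
  case (add f g)
  then show ?case by (simp add: distrib_right act_add_right sm_add_right act_closed)
qed

lemma act_mult: "g \<in> Rn n \<Longrightarrow> f \<in> Rn n \<Longrightarrow> u \<in> M \<Longrightarrow> act A u b (f * g) = act A (act A u b f) b g"
proof (induction g rule: mpoly_var_induct)
  case (const c)
  then show ?case by (simp add: act_const_mult act_const act_closed)
next
  case (add g h)
  then show ?case by (simp add: distrib_left act_add_right act_closed)
next
  case (mult g i)
  then show ?case by (simp add: mult.assoc[symmetric] act_mult_xvar act_closed)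
qed

lemma act_br: "f \<in> Rn n \<Longrightarrow> u \<in> M \<Longrightarrow> i < n \<Longrightarrow> act A (br A u (b i)) b f = br A (act A u b f) (b i)"
proof -
  assume a: "f \<in> Rn n" "u \<in> M" "i < n"
  have "act A u b (xvar i) = br A u (b i)" using act_mult_xvar[of 1 u i] a act_1 by simp
  then have "act A (br A u (b i)) b f = act A u b (xvar i * f)" using a by (simp add: act_mult)
  also have "\<dots> = br A (act A u b f) (b i)" using a by (simp add: mult.commute[of _ f] act_mult_xvar)
  finally show ?thesis .
qed

lemma act_uminus: "f \<in> Rn n \<Longrightarrow> u \<in> M \<Longrightarrow> act A u b (- f) = neg A (act A u b f)"
proof -
  assume a: "f \<in> Rn n" "u \<in> M"
  have "- f = f * const (- 1)" by (simp add: single_uminus)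
  then show ?thesis using a by (simp only: act_const_mult) (simp add: neg_eq_sm act_closed)
qed

end

text \<open>Closure is separated from the laws because the term algebra satisfies none of them,
  although homomorphisms out of it are used.\<close>

definition op_closed :: "('k, 'a) liealg \<Rightarrow> bool" where
  "op_closed A \<longleftrightarrow> zero A \<in> carrier A \<and> (\<forall>x\<in>carrier A. neg A x \<in> carrier A \<and> (\<forall>a. sm A a x \<in> carrier A) \<and>
     (\<forall>y\<in>carrier A. add A x y \<in> carrier A \<and> br A x y \<in> carrier A))"

lemma (in lie) op_closed: "op_closed A" by (auto simp: op_closed_def)

lemma op_closedD:
  assumes "op_closed A"
  shows "zero A \<in> carrier A" "x \<in> carrier A \<Longrightarrow> neg A x \<in> carrier A" "x \<in> carrier A \<Longrightarrow> sm A a x \<in> carrier A"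
    "x \<in> carrier A \<Longrightarrow> y \<in> carrier A \<Longrightarrow> add A x y \<in> carrier A" "x \<in> carrier A \<Longrightarrow> y \<in> carrier A \<Longrightarrow> br A x y \<in> carrier A"
  using assms by (auto simp: op_closed_def)

lemma lie_homD:
  assumes "lie_hom A B h"
  shows "h (zero A) = zero B" "x \<in> carrier A \<Longrightarrow> h x \<in> carrier B" "x \<in> carrier A \<Longrightarrow> h (neg A x) = neg B (h x)"
    "x \<in> carrier A \<Longrightarrow> h (sm A a x) = sm B a (h x)"
    "x \<in> carrier A \<Longrightarrow> y \<in> carrier A \<Longrightarrow> h (add A x y) = add B (h x) (h y)"
    "x \<in> carrier A \<Longrightarrow> y \<in> carrier A \<Longrightarrow> h (br A x y) = br B (h x) (h y)"
  using assms by (auto simp: lie_hom_def)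

lemma lie_hom_comp: "lie_hom A B g \<Longrightarrow> lie_hom B C h \<Longrightarrow> lie_hom A C (\<lambda>x. h (g x))"
  by (auto simp: lie_hom_def)

lemma lsum_op_closed: "op_closed A \<Longrightarrow> set xs \<subseteq> carrier A \<Longrightarrow> lsum A xs \<in> carrier A"
  by (induction xs) (auto simp: lsum_def op_closedD)

lemma lsum_hom: "lie_hom A B h \<Longrightarrow> op_closed A \<Longrightarrow> set xs \<subseteq> carrier A \<Longrightarrow> h (lsum A xs) = lsum B (map h xs)"
proof (induction xs)
  case (Cons x xs)
  then show ?case using lsum_op_closed[of A xs] by (simp add: lsum_def lie_homD)
qed (simp add: lsum_def lie_homD)

lemma teval_closed: "op_closed A \<Longrightarrow> (\<And>i. i \<in> tvars t \<Longrightarrow> g i \<in> carrier A) \<Longrightarrow> teval A g t \<in> carrier A"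
  by (induction t) (auto simp: op_closedD)

lemma teval_hom: "lie_hom A B h \<Longrightarrow> op_closed A \<Longrightarrow> (\<And>i. i \<in> tvars t \<Longrightarrow> g i \<in> carrier A) \<Longrightarrow>
   h (teval A g t) = teval B (\<lambda>i. h (g i)) t"
  by (induction t) (auto simp: lie_homD teval_closed)

lemma teval_cong: "(\<And>i. i \<in> tvars t \<Longrightarrow> g i = g' i) \<Longrightarrow> teval A g t = teval A g' t"
  by (induction t) auto

lemma mono_act_hom:
  assumes "lie_hom A B h" "op_closed A" "u \<in> carrier A" "\<And>i. i \<in> Poly_Mapping.keys m \<Longrightarrow> b i \<in> carrier A"
  shows "mono_act A u b m N \<in> carrier A \<and> h (mono_act A u b m N) = mono_act B (h u) (\<lambda>i. h (b i)) m N"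
proof (induction N)
  case (Suc N)
  have "((\<lambda>v. br A v (b N)) ^^ e) v \<in> carrier A \<and>
      h (((\<lambda>v. br A v (b N)) ^^ e) v) = ((\<lambda>v. br B v (h (b N))) ^^ e) (h v)"
    if "v \<in> carrier A" "b N \<in> carrier A" for e v
    using that by (induction e) (auto simp: lie_homD[OF assms(1)] op_closedD[OF assms(2)])
  then show ?case using Suc assms(4)[of N] by (cases "Poly_Mapping.lookup m N = 0") (auto simp: in_keys_iff)
qed (use assms in simp)

lemma act_hom:
  assumes "lie_hom A B h" "op_closed A" "u \<in> carrier A" "\<And>i. i \<in> mvars f \<Longrightarrow> b i \<in> carrier A"
  shows "h (act A u b f) = act B (h u) (\<lambda>i. h (b i)) f" "act A u b f \<in> carrier A"
proof -
  let ?m = "\<lambda>m. mono_act A u b m (Suc (Max (insert 0 (Poly_Mapping.keys m))))"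
  have m: "?m m \<in> carrier A \<and> h (?m m) = mono_act B (h u) (\<lambda>i. h (b i)) m (Suc (Max (insert 0 (Poly_Mapping.keys m))))"
    if "m \<in> Poly_Mapping.keys f" for m
    using that by (intro mono_act_hom assms) (auto simp: mvars_def)
  then have c: "set (map (\<lambda>m. sm A (coeff f m) (?m m)) (sorted_list_of_set (Poly_Mapping.keys f))) \<subseteq> carrier A"
    by (auto intro: op_closedD[OF assms(2)])
  show "act A u b f \<in> carrier A" unfolding act_def by (rule lsum_op_closed[OF assms(2) c])
  show "h (act A u b f) = act B (h u) (\<lambda>i. h (b i)) f"
    unfolding act_def lsum_hom[OF assms(1,2) c]
    by (intro arg_cong[where f = "lsum B"]) (use m in \<open>auto simp: lie_homD[OF assms(1)]\<close>)
qed

text \<open>Terms form an algebra under the term constructors, so that \<^const>\<open>teval\<close> is a homomorphism and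
  \<^const>\<open>act\<close>, \<^const>\<open>lsum\<close> over this algebra denote terms.\<close>
definition TT :: "('k, 'k ltm) liealg" where
  "TT = \<lparr> carrier = UNIV, zero = Z, add = Pl, neg = Ng, br = Br, sm = Sc \<rparr>"

lemma TT_simps [simp]: "carrier TT = UNIV" "zero TT = Z" "add TT = Pl" "neg TT = Ng" "br TT = Br" "sm TT = Sc"
  by (simp_all add: TT_def)
lemma op_closed_TT: "op_closed TT" by (simp add: op_closed_def)
lemma lie_hom_teval: "op_closed A \<Longrightarrow> (\<And>i. g i \<in> carrier A) \<Longrightarrow> lie_hom TT A (teval A g)"
  by (auto simp: lie_hom_def teval_closed op_closedD)

text \<open>This is the universal property of the free algebra: evaluation in a metabelian Lie
  algebra is well defined on classes of terms.\<close>

lemma meq_sound: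
  assumes "meq s t" "lie_alg A" "metabelian A" "\<And>i. g i \<in> carrier A"
  shows "teval A g s = teval A g t"
proof -
  interpret lie A by unfold_locales (rule assms(2))
  have c: "teval A g t \<in> carrier A" for t by (rule teval_closed[OF op_closed assms(4)])
  note commute = add_comm and jac = jacobi
  show ?thesis using assms(1)
  proof (induction rule: meq.induct)
    case (metab x1 x2 x3 x4)
    then show ?case using assms(3) c by (simp add: metabelian_def)
  next
    case (add_comm x y)
    then show ?case using c by (simp add: commute)
  next
    case (jacobi x y z)
    then show ?case using c by (simp add: jac)
  qed (use c in \<open>simp_all add: add_assoc sm_add_right sm_add_left sm_sm br_add_left br_add_right br_sm_left br_sm_right\<close>)
qed

section \<open>The Magnus representation\<close>

text \<open>The pair \<open>(p, v)\<close> stands for an element with linear part \<open>p\<close> and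
  vector \<open>v\<close> of Fox derivatives.\<close>
definition WW :: "('k::field, 'k mpoly \<times> (nat \<Rightarrow> 'k mpoly)) liealg" where
  "WW = \<lparr> carrier = UNIV, zero = (0, \<lambda>_. 0),
     add = (\<lambda>(p, v) (q, w). (p + q, \<lambda>j. v j + w j)), neg = (\<lambda>(p, v). (- p, \<lambda>j. - v j)),
     br = (\<lambda>(p, v) (q, w). (0, \<lambda>j. v j * q - w j * p)),
     sm = (\<lambda>a (p, v). (const a * p, \<lambda>j. const a * v j)) \<rparr>"

lemma WW_simps [simp]:
  "carrier WW = UNIV" "zero WW = (0, \<lambda>_. 0)" "add WW (p, v) (q, w) = (p + q, \<lambda>j. v j + w j)"
  "neg WW (p, v) = (- p, \<lambda>j. - v j)" "br WW (p, v) (q, w) = (0, \<lambda>j. v j * q - w j * p)"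
  "sm WW a (p, v) = (const a * p, \<lambda>j. const a * v j)"
  by (simp_all add: WW_def)

lemma lie_alg_WW: "lie_alg WW"
  unfolding lie_alg_def by (auto simp: algebra_simps single_add const_mult)
lemma metabelian_WW: "metabelian WW"
  unfolding metabelian_def by auto

interpretation WW: lie WW by unfold_locales (rule lie_alg_WW)

definition wgen :: "nat \<Rightarrow> 'k::field mpoly \<times> (nat \<Rightarrow> 'k mpoly)" where
  "wgen i = (xvar i, \<lambda>j. if j = i then 1 else 0)"

abbreviation dv :: "'k::field ltm \<Rightarrow> 'k mpoly \<times> (nat \<Rightarrow> 'k mpoly)" where "dv \<equiv> teval WW wgen"

text \<open>The pairs satisfying Fox's fundamental identity. They turn out to be exactly the
  coordinates of elements of \<open>F_n\<close>.\<close>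

definition WI :: "nat \<Rightarrow> ('k::field mpoly \<times> (nat \<Rightarrow> 'k mpoly)) set" where
  "WI n = {(p, v). p \<in> Lin n \<and> (\<forall>j<n. v j \<in> Rn n) \<and> (\<forall>j\<ge>n. v j = 0) \<and> (\<Sum>j<n. v j * xvar j) = p}"

lemma WI_add: "x \<in> WI n \<Longrightarrow> y \<in> WI n \<Longrightarrow> add WW x y \<in> WI n"
  by (auto simp: WI_def distrib_right sum.distrib intro: Lin_add)
lemma WI_sm: "x \<in> WI n \<Longrightarrow> sm WW a x \<in> WI n"
proof -
  assume "x \<in> WI n"
  moreover have "(\<Sum>j<n. const a * v j * xvar j) = const a * (\<Sum>j<n. v j * xvar j)" for v
    by (simp add: sum_distrib_left mult.assoc)
  ultimately show ?thesis by (auto simp: WI_def intro: Lin_const_mult)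
qed
lemma WI_neg: "x \<in> WI n \<Longrightarrow> neg WW x \<in> WI n"
  by (auto simp: WI_def sum_negf intro: Lin_uminus)
lemma WI_zero: "zero WW \<in> WI n" by (auto simp: WI_def)
lemma WI_br: "x \<in> WI n \<Longrightarrow> y \<in> WI n \<Longrightarrow> br WW x y \<in> WI n"
proof -
  assume a: "x \<in> WI n" "y \<in> WI n"
  obtain p v q w where xy: "x = (p, v)" "y = (q, w)" by (cases x, cases y)
  have "(\<Sum>j<n. (v j * q - w j * p) * xvar j) = (\<Sum>j<n. v j * xvar j) * q - (\<Sum>j<n. w j * xvar j) * p"
    unfolding sum_distrib_right sum_subtractf[symmetric] by (rule sum.cong) (auto simp: algebra_simps)
  then show ?thesis using a by (auto simp: xy WI_def Lin_Rn)
qed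
lemma wgen_WI: "i < n \<Longrightarrow> wgen i \<in> WI n"
  by (auto simp: WI_def wgen_def Lin_xvar if_distrib[where f = "\<lambda>x. x * _"] sum.delta cong: if_cong)

lemma dv_WI: "tvars t \<subseteq> {..<n} \<Longrightarrow> dv t \<in> WI n"
  by (induction t) (auto intro: WI_add WI_sm WI_neg WI_zero WI_br wgen_WI simp del: WW_simps)

lemma tlin_dv: "tlin t i = coeff (fst (dv t)) (ex i)"
proof (induction t)
  case (V j) show ?case by (simp add: wgen_def coeff_xvar_ex)
next
  case (Br s t) show ?case by (cases "dv s"; cases "dv t") simp
next
  case (Pl s t) then show ?case by (cases "dv s"; cases "dv t") (simp add: lookup_add)
next
  case (Ng s) then show ?case by (cases "dv s") simp
next
  case (Sc a s) then show ?case by (cases "dv s") (simp add: coeff_const_mult)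
qed simp

\<comment> \<open>Faithfulness of the Magnus representation, in the free algebra on countably many
  generators\<close>
quotient_type (overloaded) 'k fma = "'k::field ltm" / meq
  by (rule equivpI) (auto intro!: reflpI sympI transpI intro: meq.refl meq.sym meq.trans)

instantiation fma :: (field) ab_group_add
begin
lift_definition zero_fma :: "'a fma" is Z .
lift_definition plus_fma :: "'a fma \<Rightarrow> 'a fma \<Rightarrow> 'a fma" is Pl by (rule meq.cPl)
lift_definition uminus_fma :: "'a fma \<Rightarrow> 'a fma" is Ng by (rule meq.cNg)
lift_definition minus_fma :: "'a fma \<Rightarrow> 'a fma \<Rightarrow> 'a fma" is "\<lambda>s t. Pl s (Ng t)" by (intro meq.cPl meq.cNg)
instance
proof
  fix a b c :: "'a fma"
  show "a + b + c = a + (b + c)" by transfer (rule meq.add_assoc)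
  show "a + b = b + a" by transfer (rule meq.add_comm)
  show "0 + a = a" by transfer (rule meq.add_zero)
  show "- a + a = 0" by transfer (rule meq.add_neg)
  show "a - b = a + - b" by transfer (rule meq.refl)
qed
end

lift_definition fbr :: "'k::field fma \<Rightarrow> 'k fma \<Rightarrow> 'k fma" is Br by (rule meq.cBr)
lift_definition fsc :: "'k::field \<Rightarrow> 'k fma \<Rightarrow> 'k fma" is Sc by (rule meq.cSc)

definition FQ :: "('k::field, 'k fma) liealg" where
  "FQ = \<lparr> carrier = UNIV, zero = 0, add = (+), neg = uminus, br = fbr, sm = fsc \<rparr>"
lemma FQ_simps [simp]: "carrier FQ = UNIV" "zero FQ = 0" "add FQ = (+)" "neg FQ = uminus" "br FQ = fbr" "sm FQ = fsc"
  by (simp_all add: FQ_def)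

lemma fma_laws:
  shows "fbr (x + y) z = fbr x z + fbr y z"
    and "fbr x (y + z) = fbr x y + fbr x z"
    and "fbr (fbr x y) z + fbr (fbr y z) x + fbr (fbr z x) y = 0"
    and "fsc a (x + y) = fsc a x + fsc a y"
    and "fbr (fsc a x) y = fsc a (fbr x y)"
    and "fbr x (fsc a y) = fsc a (fbr x y)"
    and "fbr x x = 0" and "fsc 1 x = x"
    and "fsc (a + b) x = fsc a x + fsc b x" and "fsc (a * b) x = fsc a (fsc b x)"
    and "fbr (fbr x1 x2) (fbr x3 x4) = 0"
  by (transfer, rule meq.br_addl meq.br_addr meq.jacobi meq.sc_distr1 meq.br_scl meq.br_scr meq.br_alt meq.sc_one
    meq.sc_distr2 meq.sc_assoc meq.metab)+

lemma lie_alg_FQ: "lie_alg FQ"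
  unfolding lie_alg_def FQ_simps by (intro conjI ballI allI) (simp_all only: fma_laws UNIV_I add_0 left_minus add.assoc[symmetric], rule add.commute)

lemma metabelian_FQ: "metabelian FQ"
  unfolding metabelian_def FQ_simps by (simp add: fma_laws)

interpretation FQ: lie FQ by unfold_locales (rule lie_alg_FQ)

lift_definition fD :: "'k::field fma \<Rightarrow> 'k mpoly \<times> (nat \<Rightarrow> 'k mpoly)" is dv
  by (rule meq_sound[OF _ lie_alg_WW metabelian_WW]) auto

lemma fD_hom: "lie_hom (FQ :: ('k::field, 'k fma) liealg) WW fD"
proof -
  have "fD (0 :: 'k fma) = zero WW" by transfer simp
  moreover have "fD (- x) = neg WW (fD x)" for x :: "'k fma" by transfer simp
  moreover have "fD (fsc a x) = sm WW a (fD x)" for a and x :: "'k fma" by transfer simp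
  moreover have "fD (x + y) = add WW (fD x) (fD y)" for x y :: "'k fma" by transfer simp
  moreover have "fD (fbr x y) = br WW (fD x) (fD y)" for x y :: "'k fma" by transfer simp
  ultimately show ?thesis unfolding lie_hom_def by simp
qed

context lie begin

lemma derived_carrier: "u \<in> derived A \<Longrightarrow> u \<in> carrier A"
  by (induction rule: derived.induct) auto

text \<open>By the Jacobi identity the actions of \<open>x\<close> and \<open>y\<close> on
  \<open>u\<close> differ by the action of their bracket, which is zero on \<open>u\<close>.\<close>

lemma br_br_comm_of_centralizing:
  assumes "u \<in> carrier A" "x \<in> carrier A" "y \<in> carrier A" "br A (br A x y) u = zero A"
  shows "br A (br A u x) y = br A (br A u y) x"
proof -
  have "add A (add A (br A (br A u x) y) (br A (br A x y) u)) (br A (br A y u) x) = zero A"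
    using assms by (intro jacobi)
  then have "add A (br A (br A u x) y) (br A (br A y u) x) = zero A" using assms by simp
  moreover have "br A (br A y u) x = neg A (br A (br A u y) x)"
    using assms by (simp add: br_anti[of u y] neg_eq_sm br_sm_left)
  ultimately show ?thesis using assms by (simp add: add_neg_eq_zero)
qed

lemma br_derived:
  assumes "metabelian A" "u \<in> derived A" "v \<in> derived A"
  shows "br A u v = zero A"
proof -
  have 1: "br A (br A x y) v = zero A" if "x \<in> carrier A" "y \<in> carrier A" for x y
    using assms(3)
  proof (induction rule: derived.induct)
    case (d_br x' y') then show ?case using assms(1) that by (simp add: metabelian_def)
  qed (use that derived_carrier in \<open>auto simp: br_add_right br_sm_right\<close>)
  show ?thesis using assms(2)
    by (induction rule: derived.induct) (use 1 derived_carrier assms(3) in \<open>auto simp: br_add_left br_sm_left\<close>)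
qed

lemma lie_module_derived:
  assumes "metabelian A" "\<And>i. i < n \<Longrightarrow> b i \<in> carrier A"
  shows "lie_module A (derived A) b n"
proof
  show "br A (br A u (b i)) (b j) = br A (br A u (b j)) (b i)" if "u \<in> derived A" "i < n" "j < n" for u i j
    using that assms br_derived[OF assms(1) derived.d_br that(1)]
    by (intro br_br_comm_of_centralizing) (auto intro: derived_carrier)
  show "br A u (b i) \<in> derived A" if "u \<in> derived A" "i < n" for u i
    using that assms(2) by (auto intro: derived.intros derived_carrier)
qed (auto intro: derived.intros derived_carrier assms(2))

end

lift_definition fvar :: "nat \<Rightarrow> 'k::field fma" is V .

interpretation FQm: lie_module FQ "derived FQ" fvar n for n
  by (rule FQ.lie_module_derived[OF metabelian_FQ]) simp

text \<open>The action of a monomial with the number of variables hidden: every sufficiently large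
  bound gives the same value.\<close>

definition xact :: "'k::field fma \<Rightarrow> (nat \<Rightarrow>\<^sub>0 nat) \<Rightarrow> 'k fma" where
  "xact u m = mono_act FQ u fvar m (Suc (Max (insert 0 (Poly_Mapping.keys m))))"

lemma xact_eq: "Poly_Mapping.keys m \<subseteq> {..<n} \<Longrightarrow> xact u m = mono_act FQ u fvar m n"
  unfolding xact_def by (rule mono_act_keys)

lemma keys_bound: "\<exists>n. Poly_Mapping.keys (m :: nat \<Rightarrow>\<^sub>0 nat) \<subseteq> {..<n} \<and> i < n"
proof -
  obtain n where "Poly_Mapping.keys m \<subseteq> {..<n}" using finite_nat_set_iff_bounded[of "Poly_Mapping.keys m"] by auto
  then show ?thesis by (intro exI[of _ "max n (Suc i)"]) auto
qed

lemma xact_0 [simp]: "xact u 0 = u" by (simp add: xact_def)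
lemma xact_derived: "u \<in> derived FQ \<Longrightarrow> xact u m \<in> derived FQ"
  unfolding xact_def by (rule FQm.mono_act_closed[of _ _ "Suc (Max (insert 0 (Poly_Mapping.keys m)))"]) auto
lemma xact_ex: "u \<in> derived FQ \<Longrightarrow> xact u (m + ex i) = fbr (xact u m) (fvar i)"
proof -
  assume u: "u \<in> derived FQ"
  obtain n where n: "Poly_Mapping.keys m \<subseteq> {..<n}" "i < n" using keys_bound by blast
  then have "Poly_Mapping.keys (m + ex i) \<subseteq> {..<n}" by (auto simp: keys_add_nat)
  then show ?thesis using FQm.mono_act_ex[OF u order_refl n(2)] n by (simp add: xact_eq)
qed
lemma xact_br: "u \<in> derived FQ \<Longrightarrow> xact (fbr u (fvar i)) m = fbr (xact u m) (fvar i)"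
proof -
  assume u: "u \<in> derived FQ"
  obtain n where n: "Poly_Mapping.keys m \<subseteq> {..<n}" "i < n" using keys_bound by blast
  then show ?thesis using FQm.mono_act_br[OF u order_refl n(2)] by (simp add: xact_eq)
qed
lemma xact_add: "u \<in> derived FQ \<Longrightarrow> v \<in> derived FQ \<Longrightarrow> xact (u + v) m = xact u m + xact v m"
proof -
  assume u: "u \<in> derived FQ" "v \<in> derived FQ"
  obtain n where n: "Poly_Mapping.keys m \<subseteq> {..<n}" using keys_bound by blast
  then show ?thesis using FQm.mono_act_add[OF u order_refl] by (simp add: xact_eq)
qed
lemma xact_fsc: "u \<in> derived FQ \<Longrightarrow> xact (fsc a u) m = fsc a (xact u m)"
proof -
  assume u: "u \<in> derived FQ"
  obtain n where n: "Poly_Mapping.keys m \<subseteq> {..<n}" using keys_bound by blast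
  then show ?thesis using FQm.mono_act_sm[OF u order_refl] by (simp add: xact_eq)
qed
lemma fma_uminus: "- u = fsc (- 1) u" using FQ.neg_eq_sm[of u] by simp
lemma fsc_zero [simp]: "fsc a 0 = 0" "fsc 0 u = 0" using FQ.sm_zero_right[of a] FQ.sm_zero_left[of u] by simp_all
lemma fbr_zero [simp]: "fbr 0 u = 0" "fbr u 0 = 0" using FQ.br_zero[of u] by simp_all
lemma fbr_anti: "fbr y x = - fbr x y" using FQ.br_anti[of x y] by simp
lemma derived_uminus: "u \<in> derived FQ \<Longrightarrow> - u \<in> derived FQ"
  using derived.d_sm[of u FQ "- 1"] by (simp add: fma_uminus)
lemma xact_uminus: "u \<in> derived FQ \<Longrightarrow> xact (- u) m = - xact u m"
  by (simp add: fma_uminus xact_fsc)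
lemma xact_diff: "u \<in> derived FQ \<Longrightarrow> v \<in> derived FQ \<Longrightarrow> xact (u - v) m = xact u m - xact v m"
  using xact_add[of u "- v" m] by (simp add: xact_uminus derived_uminus)

abbreviation fcom :: "nat \<Rightarrow> nat \<Rightarrow> 'k::field fma" where "fcom i j \<equiv> fbr (fvar i) (fvar j)"

lemma fbr_derived: "fbr x y \<in> derived FQ" using derived.d_br[of x FQ y] by simp
text \<open>The Jacobi identity as an exchange rule: a multiple of a commutator by
  \<open>x_l\<close> is rewritten through commutators that involve \<open>x_l\<close>. This allows a
  normal form built on the least variable.\<close>

lemma fcom_jacobi: "fbr (fcom i l) (fvar j) - fbr (fcom j l) (fvar i) = fbr (fcom i j) (fvar l)"
proof -
  have "fbr (fcom i j) (fvar l) + fbr (fcom j l) (fvar i) + fbr (fcom l i) (fvar j) = 0" by (rule fma_laws(3))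
  moreover have "fbr (fcom l i) (fvar j) = - fbr (fcom i l) (fvar j)"
    unfolding fbr_anti[of "fvar l" "fvar i"] by (simp only: fma_uminus fma_laws(5))
  moreover have "d - b = a" if "a + b + c = 0" "c = - d" for a b c d :: "'a fma"
    using that by (metis add_diff_cancel_right' diff_conv_add_uminus eq_iff_diff_eq_0)
  ultimately show ?thesis by blast
qed

text \<open>On monomial vectors, a contracting homotopy of the Koszul complex; it splits off the least variable.\<close>
definition hmon :: "(nat \<Rightarrow>\<^sub>0 nat) \<Rightarrow> nat \<Rightarrow> 'k::field fma" where
  "hmon m i = (let l = Min (insert i (Poly_Mapping.keys m)) in if l < i then xact (fcom i l) (m - ex l) else 0)"

lemma exp_minus_plus: "l \<in> Poly_Mapping.keys m \<Longrightarrow> m = (m - ex l) + ex l"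
  by (rule poly_mapping_eqI) (auto simp: lookup_add lookup_minus lookup_single when_def in_keys_iff)

lemma hmon_ex:
  assumes "i \<noteq> j"
  shows "hmon (m + ex j) i - hmon (m + ex i) j = xact (fcom i j) m"
proof -
  have K: "insert i (Poly_Mapping.keys (m + ex j)) = insert i (insert j (Poly_Mapping.keys m))"
    "insert j (Poly_Mapping.keys (m + ex i)) = insert i (insert j (Poly_Mapping.keys m))"
    by (auto simp: keys_add_nat)
  define l where "l = Min (insert i (insert j (Poly_Mapping.keys m)))"
  have lin: "l \<in> insert i (insert j (Poly_Mapping.keys m))" unfolding l_def by (rule Min_in) auto
  have le: "l \<le> i" "l \<le> j" unfolding l_def by (rule Min_le; simp)+
  have h: "hmon (m + ex j) i = (if l < i then xact (fcom i l) (m + ex j - ex l) else 0)"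
    "hmon (m + ex i) j = (if l < j then xact (fcom j l) (m + ex i - ex l) else 0)"
    unfolding hmon_def K l_def[symmetric] Let_def by (rule HOL.refl)+
  \<comment> \<open>Either one of \<open>i\<close>, \<open>j\<close> is itself the least variable
    and one of the two terms is zero, or the least variable divides \<open>m\<close> and the
    exchange rule applies.\<close>
  consider "l = i" "l < j" | "l = j" "l < i" | "l < i" "l < j" using le assms by linarith
  then show ?thesis
  proof cases
    case 1
    then show ?thesis unfolding h by (simp add: fbr_anti[of "fvar j" "fvar i"] xact_uminus fbr_derived)
  next
    case 2
    then show ?thesis unfolding h by simp
  next
    case 3
    then have "l \<in> Poly_Mapping.keys m" using lin by auto
    then obtain m' where m: "m = m' + ex l" using exp_minus_plus by blast
    have "m + a - ex l = m' + a" for a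
    proof -
      have "m + a = (m' + a) + ex l" unfolding m by (simp add: ac_simps)
      then show ?thesis by (simp only: add_diff_cancel_right')
    qed
    then show ?thesis unfolding h using 3
      by (simp add: m xact_ex fbr_derived xact_br[symmetric] xact_diff[symmetric] fcom_jacobi)
  qed
qed

definition flin :: "((nat \<Rightarrow>\<^sub>0 nat) \<Rightarrow> 'k fma) \<Rightarrow> 'k::field mpoly \<Rightarrow> 'k fma" where
  "flin F f = (\<Sum>m\<in>Poly_Mapping.keys f. fsc (coeff f m) (F m))"

lemma flin_add: "flin F (f + g) = flin F f + flin F g"
  unfolding flin_def by (rule setsum_keys_plus_distrib) (auto simp: fma_laws)
lemma flin_mon: "flin F (mon m c) = fsc c (F m)" by (cases "c = 0") (auto simp: flin_def)
lemma flin_0 [simp]: "flin F 0 = 0" by (simp add: flin_def)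
lemma flin_const_mult: "flin F (const a * f) = fsc a (flin F f)"
  by (induction f rule: mpoly_induct) (auto simp: mult_single flin_mon flin_add distrib_left fma_laws)
lemma flin_diff: "flin F (f - g) = flin F f - flin F g"
  using flin_add[of F "f - g" g] by (simp add: algebra_simps)

text \<open>The left inverse of the Fox vector on the derived algebra; faithfulness follows from its
  existence.\<close>

definition hvec :: "nat \<Rightarrow> (nat \<Rightarrow> 'k::field mpoly) \<Rightarrow> 'k fma" where
  "hvec n v = (\<Sum>i<n. flin (\<lambda>m. hmon m i) (v i))"

text \<open>Only the indices of the commutators are bounded by \<open>n\<close>: they alone decide
  which components of the Fox vector are nonzero, while the exponent is free.\<close>

inductive_set fspan :: "nat \<Rightarrow> 'k::field fma set" for n where
  zero: "0 \<in> fspan n"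
| add: "u \<in> fspan n \<Longrightarrow> v \<in> fspan n \<Longrightarrow> u + v \<in> fspan n"
| fsc: "u \<in> fspan n \<Longrightarrow> fsc a u \<in> fspan n"
| gen: "i < n \<Longrightarrow> j < n \<Longrightarrow> xact (fcom i j) m \<in> fspan n"

lemma fspan_derived: "u \<in> fspan n \<Longrightarrow> u \<in> derived FQ"
  by (induction rule: fspan.induct)
     (use derived.d_zero[of FQ] derived.d_add[of _ FQ] derived.d_sm[of _ FQ] in \<open>auto intro: xact_derived fbr_derived\<close>)
lemma fspan_uminus: "u \<in> fspan n \<Longrightarrow> - u \<in> fspan n"
  by (simp add: fma_uminus fspan.fsc)
lemma fspan_sum: "(\<And>i. i \<in> S \<Longrightarrow> f i \<in> fspan n) \<Longrightarrow> sum f S \<in> fspan n"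
  by (induction S rule: infinite_finite_induct) (auto intro: fspan.intros)
lemma fspan_br: "u \<in> fspan n \<Longrightarrow> l < n \<Longrightarrow> fbr u (fvar l) \<in> fspan n"
  by (induction rule: fspan.induct)
     (auto simp: fma_laws xact_ex[symmetric] fbr_derived intro: fspan.intros)

lemma fD_fvar: "fD (fvar i) = wgen i" by transfer simp
lemma fD_xact: "u \<in> derived FQ \<Longrightarrow> fD u = (0, v) \<Longrightarrow> fD (xact u m) = (0, \<lambda>j. v j * mon m 1)"
proof (induction m rule: mono_induct)
  case (step m i)
  have "fD (fbr (xact u m) (fvar i)) = br WW (fD (xact u m)) (fD (fvar i))"
    using lie_homD(6)[OF fD_hom] by simp
  then show ?case using step by (simp add: xact_ex fD_fvar wgen_def mon_mult_xvar mult.assoc)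
qed simp

lemma fD_fcom: "fD (fcom i j :: 'k::field fma) = (0, \<lambda>k. (if k = i then xvar j else 0) - (if k = j then xvar i else 0))"
proof -
  have "fD (fcom i j :: 'k fma) = br WW (wgen i) (wgen j)" using lie_homD(6)[OF fD_hom, of "fvar i" "fvar j"] by (simp add: fD_fvar)
  then show ?thesis by (simp add: wgen_def) (auto simp: fun_eq_iff)
qed

text \<open>Both sides are linear, so it suffices to treat a monomial multiple of a commutator. Its
  Fox vector is \<open>x_j m e_i - x_i m e_j\<close>, and \<open>hmon_ex\<close> evaluates the
  homotopy on that.\<close>

lemma hvec_fD:
  assumes "u \<in> fspan n"
  shows "\<exists>v. fD u = (0, v) \<and> hvec n v = u"
  using assms
proof (induction rule: fspan.induct)
  case zero
  have "fD 0 = (0, \<lambda>_. 0)" using lie_homD(1)[OF fD_hom] by simp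
  then show ?case by (intro exI[of _ "\<lambda>_. 0"]) (simp add: hvec_def)
next
  case (add u v)
  then obtain x y where "fD u = (0, x)" "hvec n x = u" "fD v = (0, y)" "hvec n y = v" by blast
  moreover have "fD (u + v) = add WW (fD u) (fD v)" using lie_homD(5)[OF fD_hom] by simp
  ultimately show ?case by (auto simp: hvec_def flin_add sum.distrib)
next
  case (fsc u a)
  then obtain x where x: "fD u = (0, x)" "hvec n x = u" by blast
  have "fD (fsc a u) = sm WW a (fD u)" using lie_homD(4)[OF fD_hom] by simp
  moreover have "hvec n (\<lambda>j. const a * x j) = fsc a (hvec n x)"
  proof -
    have "fsc a (sum f {..<n}) = (\<Sum>i<n. fsc a (f i))" for f :: "nat \<Rightarrow> 'a fma"
      by (induction n) (auto simp: fma_laws)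
    then show ?thesis by (simp add: hvec_def flin_const_mult)
  qed
  ultimately show ?case using x by auto
next
  case (gen i j m)
  let ?v = "\<lambda>k. ((if k = i then xvar j else 0) - (if k = j then xvar i else 0)) * mon m 1 :: 'a mpoly"
  have "hvec n ?v = xact (fcom i j) m"
  proof (cases "i = j")
    case True
    then have "fcom i j = (0 :: 'a fma)" by (simp add: fma_laws)
    moreover have "xact 0 m = (0 :: 'a fma)"
      using xact_fsc[of "0 :: 'a fma" 0 m] derived.d_zero[of "FQ :: ('a, 'a fma) liealg"] by simp
    moreover have "?v = (\<lambda>_. 0)" using True by auto
    ultimately show ?thesis using True by (simp add: hvec_def)
  next
    case False
    have v: "?v k = (if k = i then mon (m + ex j) 1 else 0) - (if k = j then mon (m + ex i) 1 else 0)" for k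
      by (auto simp: mon_mult_xvar mult.commute)
    have "hvec n ?v = (\<Sum>k<n. (if k = i then hmon (m + ex j) k else 0) - (if k = j then hmon (m + ex i) k else 0))"
      unfolding hvec_def v by (rule sum.cong) (use False in \<open>auto simp: flin_diff flin_mon fma_laws\<close>)
    also have "\<dots> = hmon (m + ex j) i - hmon (m + ex i) j"
      using gen by (simp add: sum_subtractf sum.delta)
    finally show ?thesis using hmon_ex[OF False] by simp
  qed
  moreover have "fD (xact (fcom i j) m) = (0, ?v)" by (rule fD_xact[OF fbr_derived fD_fcom])
  ultimately show ?case by blast
qed

lemma fbr_sum_left: "fbr (sum f S) y = (\<Sum>i\<in>S. fbr (f i) y)"
  by (induction S rule: infinite_finite_induct) (auto simp: fma_laws)
lemma fbr_sum_right: "fbr y (sum f S) = (\<Sum>i\<in>S. fbr y (f i))"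
  by (induction S rule: infinite_finite_induct) (auto simp: fma_laws)

text \<open>Brackets of linear parts give commutators, and brackets of a linear part with a member
  of \<open>fspan n\<close> are actions of variables; hence everything beyond the linear part lies
  in \<open>fspan n\<close>.\<close>

lemma fma_decomp:
  assumes "tvars t \<subseteq> {..<n}"
  shows "\<exists>s\<in>fspan n. abs_fma t = (\<Sum>i<n. fsc (tlin t i) (fvar i)) + s"
  using assms
proof (induction t)
  case (V j)
  have "abs_fma (V j) = fvar j" by (simp add: fvar.abs_eq)
  also have "fvar j = (\<Sum>i<n. if i = j then fvar i else 0)" using V by (simp add: sum.delta)
  also have "\<dots> = (\<Sum>i<n. fsc (tlin (V j) i) (fvar i))" by (rule sum.cong) (auto simp: fma_laws)
  finally show ?case using fspan.zero by force
next
  case Z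
  have "abs_fma Z = 0" by (simp add: zero_fma.abs_eq)
  then show ?case by (intro bexI[of _ 0]) (auto simp: fspan.zero)
next
  case (Pl s t)
  then obtain u v where "u \<in> fspan n" "abs_fma s = (\<Sum>i<n. fsc (tlin s i) (fvar i)) + u"
    "v \<in> fspan n" "abs_fma t = (\<Sum>i<n. fsc (tlin t i) (fvar i)) + v" by auto
  then show ?case
    by (intro bexI[of _ "u + v"]) (auto simp: plus_fma.abs_eq[symmetric] fma_laws sum.distrib fspan.add)
next
  case (Ng s)
  then obtain u where "u \<in> fspan n" "abs_fma s = (\<Sum>i<n. fsc (tlin s i) (fvar i)) + u" by auto
  moreover have "fsc (- a) w = - fsc a w" for a :: 'a and w
    using fma_laws(9)[of a "- a" w] by (simp add: eq_neg_iff_add_eq_0 add.commute)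
  ultimately show ?case
    by (intro bexI[of _ "- u"]) (auto simp: uminus_fma.abs_eq[symmetric] sum_negf fspan_uminus)
next
  case (Sc a s)
  then obtain u where "u \<in> fspan n" "abs_fma s = (\<Sum>i<n. fsc (tlin s i) (fvar i)) + u" by auto
  moreover have "fsc a (sum f {..<n}) = (\<Sum>i<n. fsc a (f i))" for f :: "nat \<Rightarrow> 'a fma"
    by (induction n) (auto simp: fma_laws)
  ultimately show ?case
    by (intro bexI[of _ "fsc a u"]) (auto simp: fsc.abs_eq[symmetric] fma_laws fspan.fsc)
next
  case (Br s t)
  then obtain u v where uv: "u \<in> fspan n" "abs_fma s = (\<Sum>i<n. fsc (tlin s i) (fvar i)) + u"
    "v \<in> fspan n" "abs_fma t = (\<Sum>i<n. fsc (tlin t i) (fvar i)) + v" by auto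
  let ?L = "\<lambda>s. \<Sum>i<n. fsc (tlin s i) (fvar i)"
  \<comment> \<open>The one kind of product not covered by the spanning set disappears by the
    metabelian law.\<close>
  have "fbr u v = 0" using FQ.br_derived[OF metabelian_FQ fspan_derived[OF uv(1)] fspan_derived[OF uv(3)]] by simp
  then have e: "abs_fma (Br s t) = fbr (?L s) (?L t) + fbr u (?L t) - fbr v (?L s)"
    unfolding fbr.abs_eq[symmetric] uv fma_laws using fbr_anti[of "?L s" v] by simp
  have L: "fbr w (?L t) \<in> fspan n" if "w \<in> fspan n" for w t
    using that by (auto simp: fbr_sum_right fma_laws intro!: fspan_sum fspan.fsc fspan_br)
  have "fcom i j \<in> fspan n" if "i < n" "j < n" for i j using fspan.gen[OF that, of 0] by simp
  then have "fbr (?L s) (?L t) \<in> fspan n"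
    unfolding fbr_sum_left fbr_sum_right fma_laws by (intro fspan_sum fspan.fsc) auto
  then have "fbr (?L s) (?L t) + fbr u (?L t) + - fbr v (?L s) \<in> fspan n"
    by (rule fspan.add[OF fspan.add[OF _ L[OF uv(1)]] fspan_uminus[OF L[OF uv(3)]]])
  then have "abs_fma (Br s t) \<in> fspan n" unfolding e by simp
  then show ?case by (intro bexI[of _ "abs_fma (Br s t)"]) auto
qed

text \<open>A difference with zero coordinates has no linear part, so it lies in
  \<open>fspan n\<close>, where \<open>hvec\<close> recovers it from its zero Fox vector.\<close>

theorem meq_iff_dv: "meq s t \<longleftrightarrow> dv s = dv t"
proof
  assume "dv s = dv t"
  let ?u = "Pl s (Ng t)"
  have D': "dv ?u = zero WW" unfolding teval.simps \<open>dv s = dv t\<close> using WW.add_neg[of "dv t"] by simp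
  then have D: "fD (abs_fma ?u) = (0, \<lambda>_. 0)" by (simp add: fD.abs_eq)
  have "\<exists>n. tvars w \<subseteq> {..<n}" for w :: "'a ltm"
  proof -
    have "finite (tvars w)" by (induction w) auto
    then show ?thesis using finite_nat_set_iff_bounded[of "tvars w"] by auto
  qed
  then obtain n where n: "tvars ?u \<subseteq> {..<n}" by blast
  obtain x where x: "x \<in> fspan n" "abs_fma ?u = (\<Sum>i<n. fsc (tlin ?u i) (fvar i)) + x"
    using fma_decomp[OF n] by blast
  have "tlin ?u i = 0" for i unfolding tlin_dv D' by simp
  then have "abs_fma ?u = x" using x by simp
  then have "abs_fma ?u = hvec n (\<lambda>_. 0)" using hvec_fD[OF x(1)] D by auto
  then have "abs_fma s - abs_fma t = 0" by (simp add: hvec_def minus_fma.abs_eq)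
  then have "abs_fma s = abs_fma t" by simp
  then show "meq s t" by (simp add: fma.abs_eq_iff)
qed (rule meq_sound[OF _ lie_alg_WW metabelian_WW], auto)

section \<open>Coordinates on \<open>F_n\<close>\<close>

definition fcoord :: "'k::field ltm set \<Rightarrow> 'k mpoly \<times> (nat \<Rightarrow> 'k mpoly)" where
  "fcoord c = dv (rep c)"

lemma meq_rep_cls: "meq t (rep (cls t))"
  unfolding rep_def by (rule someI2[of _ t]) (auto simp: cls_def intro: meq.refl)
lemma cls_eq_iff: "cls s = cls t \<longleftrightarrow> meq s t"
  unfolding cls_def by (auto intro: meq.refl meq.sym meq.trans)
lemma fcoord_cls [simp]: "fcoord (cls t) = dv t"
  unfolding fcoord_def meq_iff_dv[symmetric] by (rule meq.sym[OF meq_rep_cls])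
lemma cls_eq_iff_dv: "cls s = cls t \<longleftrightarrow> dv s = dv t"
  by (simp add: cls_eq_iff meq_iff_dv)

lemma cls_op:
  "cls (Pl (rep (cls s)) (rep (cls t))) = cls (Pl s t)" "cls (Ng (rep (cls s))) = cls (Ng s)"
  "cls (Br (rep (cls s)) (rep (cls t))) = cls (Br s t)" "cls (Sc a (rep (cls s))) = cls (Sc a s)"
  by (auto simp: cls_eq_iff intro: meq.sym meq_rep_cls meq.cPl meq.cNg meq.cBr meq.cSc)

lemma Fr_simps [simp]:
  "zero (Fr n) = cls Z" "add (Fr n) (cls s) (cls t) = cls (Pl s t)" "neg (Fr n) (cls s) = cls (Ng s)"
  "br (Fr n) (cls s) (cls t) = cls (Br s t)" "sm (Fr n) a (cls s) = cls (Sc a s)"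
  by (simp_all add: Fr_def cls_op)

lemma carrier_Fr: "carrier (Fr n) = cls ` {t. tvars t \<subseteq> {..<n}}" by (simp add: Fr_def)
lemma carrier_FrE: "u \<in> carrier (Fr n) \<Longrightarrow> (\<And>t. u = cls t \<Longrightarrow> tvars t \<subseteq> {..<n} \<Longrightarrow> thesis) \<Longrightarrow> thesis"
  by (auto simp: carrier_Fr)
lemma cls_in_Fr: "tvars t \<subseteq> {..<n} \<Longrightarrow> cls t \<in> carrier (Fr n)" by (auto simp: carrier_Fr)

lemma op_closed_Fr: "op_closed (Fr n)"
  unfolding op_closed_def by (intro conjI ballI allI; (elim carrier_FrE)?; simp add: cls_in_Fr)

lemma fcoord_hom: "lie_hom (Fr n) WW fcoord"
  unfolding lie_hom_def by (auto elim!: carrier_FrE simp del: WW_simps(2-6)) 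

lemma fcoord_inj: "u \<in> carrier (Fr n) \<Longrightarrow> v \<in> carrier (Fr m) \<Longrightarrow> fcoord u = fcoord v \<Longrightarrow> u = v"
  by (elim carrier_FrE) (simp add: cls_eq_iff_dv)
lemma inj_on_fcoord: "inj_on fcoord (carrier (Fr n))" by (meson fcoord_inj inj_onI)

text \<open>Identities can be checked after an injective homomorphism, so the laws of
  \<open>F_n\<close> are inherited from the coordinates without handling representatives.\<close>

lemma lie_alg_inj:
  assumes h: "lie_hom A B h" "inj_on h (carrier A)" and A: "op_closed A" and B: "lie_alg B"
  shows "lie_alg A"
proof -
  interpret B: lie B by unfold_locales (rule B)
  have eq: "x = y" if "x \<in> carrier A" "y \<in> carrier A" "h x = h y" for x y
    using h(2) that by (meson inj_onD)
  show ?thesis unfolding lie_alg_def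
    by (intro conjI ballI allI; (intro eq)?)
       (simp_all add: op_closedD[OF A] lie_homD[OF h(1)] B.jacobi B.sm_add_right B.sm_add_left B.sm_sm
          B.br_add_left B.br_add_right B.br_sm_left B.br_sm_right,
        (rule B.add_assoc B.add_comm; simp add: lie_homD[OF h(1)])+)
qed

lemma lie_alg_Fr: "lie_alg (Fr n)"
  by (rule lie_alg_inj[OF fcoord_hom inj_on_fcoord op_closed_Fr lie_alg_WW])

interpretation Fr: lie "Fr n" for n by unfold_locales (rule lie_alg_Fr)

lemma metabelian_Fr: "metabelian (Fr n)"
  unfolding metabelian_def by (intro ballI, elim carrier_FrE) (simp add: cls_eq_iff meq.metab)

lemma fcoord_WI: "u \<in> carrier (Fr n) \<Longrightarrow> fcoord u \<in> WI n"
  by (auto elim!: carrier_FrE intro: dv_WI)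

lemma fcoord_simps [simp]:
  assumes "u \<in> carrier (Fr n)"
  shows "fcoord (neg (Fr n) u) = neg WW (fcoord u)" "fcoord (sm (Fr n) a u) = sm WW a (fcoord u)"
    "v \<in> carrier (Fr n) \<Longrightarrow> fcoord (add (Fr n) u v) = add WW (fcoord u) (fcoord v)"
    "v \<in> carrier (Fr n) \<Longrightarrow> fcoord (br (Fr n) u v) = br WW (fcoord u) (fcoord v)"
  using assms by (simp_all add: lie_homD[OF fcoord_hom[of n]])
lemma fcoord_zero [simp]: "fcoord (cls Z) = zero WW" by simp

lemma fst_WW: "fst (add WW x y) = fst x + fst y" "fst (br WW x y) = 0" "fst (sm WW a x) = const a * fst x"
    "fst (neg WW x) = - fst x"
  by (cases x; cases y; simp)+
lemma snd_WW: "snd (add WW x y) j = snd x j + snd y j" "snd (sm WW a x) j = const a * snd x j"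
    "snd (neg WW x) j = - snd x j" "snd (br WW x y) j = snd x j * fst y - snd y j * fst x"
  by (cases x; cases y; simp)+

lemma fst_fcoord_derived: "u \<in> derived (Fr n) \<Longrightarrow> fst (fcoord u) = 0"
proof (induction rule: derived.induct)
  case d_zero show ?case by simp
qed (auto simp: fst_WW Fr.derived_carrier)

lemma linpoly_eq: "u \<in> carrier (Fr r) \<Longrightarrow> linpoly r u = fst (fcoord u)"
proof -
  assume u: "u \<in> carrier (Fr r)"
  have "fst (fcoord u) \<in> Lin r" using fcoord_WI[OF u] by (auto simp: WI_def)
  then have "fst (fcoord u) = (\<Sum>i<r. const (coeff (fst (fcoord u)) (ex i)) * xvar i)" by (rule Lin_expand)
  also have "\<dots> = linpoly r u" unfolding linpoly_def
    by (intro sum.cong) (auto simp: tlin_dv fcoord_def xvar_def mult_single)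
  finally show ?thesis ..
qed

lemma fcoord_agen: "fcoord (agen i) = wgen i" by (simp add: agen_def)
lemma agen_in_Fr: "i < n \<Longrightarrow> agen i \<in> carrier (Fr n)" by (auto simp: agen_def intro: cls_in_Fr)

lemma WW_module: "lie_module WW {x. fst x = 0} b n"
proof
  show "br WW (br WW u (b i)) (b j) = br WW (br WW u (b j)) (b i)" if "u \<in> {x. fst x = 0}" for u i j
    by (cases u; cases "b i"; cases "b j") (use that in \<open>auto simp: algebra_simps\<close>)
qed (auto simp: fst_WW simp del: WW_simps(3-6))

text \<open>The bracket of \<open>(0, v)\<close> with \<open>(q, w)\<close> is
  \<open>(0, v q)\<close>: on elements without linear part only the linear parts of the
  \<open>b i\<close> act, and they act by multiplication.\<close>

lemma act_WW:
  assumes "f \<in> Rn n"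
  shows "act WW (0, v) b f = (0, \<lambda>j. v j * subst (\<lambda>i. fst (b i)) f)"
proof -
  interpret lie_module WW "{x. fst x = 0}" b n by (rule WW_module)
  show ?thesis using assms
  proof (induction f rule: mpoly_var_induct)
    case (const c)
    show ?case by (simp add: act_const mult.commute)
  next
    case (add f g)
    then show ?case by (simp add: act_add_right subst_add distrib_left)
  next
    case (mult f i)
    then show ?case by (cases "b i") (simp add: act_mult_xvar subst_mult mult.assoc)
  qed
qed

lemma fcoord_act:
  assumes "f \<in> Rn n" "u \<in> carrier (Fr r)" "fcoord u = (0, v)" "\<And>i. i < n \<Longrightarrow> b i \<in> carrier (Fr r)"
  shows "fcoord (act (Fr r) u b f) = (0, \<lambda>j. v j * subst (\<lambda>i. fst (fcoord (b i))) f)"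
    and "act (Fr r) u b f \<in> carrier (Fr r)"
proof -
  have "b i \<in> carrier (Fr r)" if "i \<in> mvars f" for i using that assms(1,4) by (auto simp: Rn_def)
  note h = act_hom[OF fcoord_hom op_closed_Fr assms(2) this]
  show "fcoord (act (Fr r) u b f) = (0, \<lambda>j. v j * subst (\<lambda>i. fst (fcoord (b i))) f)"
    using h(1) act_WW[OF assms(1)] assms(3) by simp
  show "act (Fr r) u b f \<in> carrier (Fr r)" by (rule h(2))
qed

lemma fcoord_modact:
  assumes "f \<in> Rn n" "u \<in> carrier (Fr n)" "fcoord u = (0, v)"
  shows "fcoord (modact n u f) = (0, \<lambda>j. v j * f)" and "modact n u f \<in> carrier (Fr n)"
proof -
  have "(\<lambda>i. fst (fcoord (agen i))) = (xvar :: nat \<Rightarrow> 'a mpoly)" by (auto simp: fcoord_agen wgen_def)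
  then show "fcoord (modact n u f) = (0, \<lambda>j. v j * f)" "modact n u f \<in> carrier (Fr n)"
    unfolding modact_def using fcoord_act[OF assms agen_in_Fr] by (simp_all add: subst_id)
qed

text \<open>Exactness of the Koszul complex: the homotopy in the degree below \<^const>\<open>hmon\<close>.\<close>
definition kvec :: "'k::field mpoly \<Rightarrow> nat \<Rightarrow> 'k mpoly" where
  "kvec f j = (\<Sum>m\<in>Poly_Mapping.keys f. if m \<noteq> 0 \<and> j = Min (Poly_Mapping.keys m) then mon (m - ex j) (coeff f m) else 0)"

lemma kvec_add: "kvec (f + g) j = kvec f j + kvec g j"
  unfolding kvec_def by (rule setsum_keys_plus_distrib) (auto simp: single_add)
lemma kvec_mon: "kvec (mon m c) j = (if m \<noteq> 0 \<and> j = Min (Poly_Mapping.keys m) then mon (m - ex j) c else 0)"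
  by (cases "c = 0") (auto simp: kvec_def)
lemma kvec_0 [simp]: "kvec 0 j = 0" by (simp add: kvec_def)
lemma kvec_sum: "kvec (sum f S) j = (\<Sum>i\<in>S. kvec (f i) j)"
  by (induction S rule: infinite_finite_induct) (auto simp: kvec_add)

definition dervec :: "nat \<Rightarrow> (nat \<Rightarrow> 'k::field mpoly) set" where
  "dervec n = {v. \<exists>c\<in>derived (Fr n). fcoord c = (0, v)}"

lemma dervec_0: "(\<lambda>_. 0) \<in> dervec n"
  unfolding dervec_def using derived.d_zero[of "Fr n"] by force
lemma dervec_add: "v \<in> dervec n \<Longrightarrow> w \<in> dervec n \<Longrightarrow> (\<lambda>j. v j + w j) \<in> dervec n"
proof -
  assume "v \<in> dervec n" "w \<in> dervec n"
  then obtain c d where "c \<in> derived (Fr n)" "fcoord c = (0, v)" "d \<in> derived (Fr n)" "fcoord d = (0, w)"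
    by (auto simp: dervec_def)
  then show ?thesis unfolding dervec_def
    by (auto intro!: bexI[of _ "add (Fr n) c d"] derived.d_add simp: Fr.derived_carrier)
qed
lemma dervec_sum: "(\<And>i. i \<in> S \<Longrightarrow> F i \<in> dervec n) \<Longrightarrow> (\<lambda>j. \<Sum>i\<in>S. F i j) \<in> dervec n"
  by (induction S rule: infinite_finite_induct) (auto intro: dervec_0 dervec_add)

text \<open>Take a monomial \<open>m\<close> and let \<open>x_l\<close> be the least variable of
  \<open>m x_i\<close>. If l = i, then \<open>kvec\<close> puts the monomial back and the difference
  is zero. Otherwise \<open>m = m' x_l\<close>, and the difference is
  \<open>m' (x_l e_i - x_i e_l)\<close>, the Fox vector of \<open>(a_i a_l)\<close> acted on by
  \<open>m'\<close>.\<close>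

lemma dervec_homotopy:
  assumes "f \<in> Rn n" "i < n"
  shows "(\<lambda>j. (if j = i then f else 0) - kvec (f * xvar i) j) \<in> dervec n"
  using assms(1)
proof (induction f rule: Rn_induct)
  case (mon m c)
  let ?l = "Min (insert i (Poly_Mapping.keys m))"
  have K: "Poly_Mapping.keys (m + ex i) = insert i (Poly_Mapping.keys m)" by (auto simp: keys_add_nat)
  then have nz: "m + ex i \<noteq> 0" by (metis insert_not_empty keys_zero)
  have kv: "kvec (mon m c * xvar i) j = (if j = ?l then mon (m + ex i - ex j) c else 0)" for j
    unfolding mon_mult_xvar[symmetric] kvec_mon K using nz by simp
  have lin: "?l \<in> insert i (Poly_Mapping.keys m)" by (rule Min_in) auto
  show ?case
  proof (cases "?l = i")
    case True
    then have "(\<lambda>j. (if j = i then mon m c else 0) - kvec (mon m c * xvar i) j) = (\<lambda>_. 0)"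
      unfolding kv by (auto simp: fun_eq_iff)
    then show ?thesis using dervec_0 by metis
  next
    case False
    then have l: "?l \<in> Poly_Mapping.keys m" "?l < n" using lin mon by auto
    then obtain m' where m': "m = m' + ex ?l" using exp_minus_plus by blast
    define l where "l = ?l"
    have m: "m = m' + ex l" "l < n" "l \<noteq> i" using m' l False by (simp_all add: l_def)
    have "m + ex i = (m' + ex i) + ex l" unfolding m(1) by (simp add: ac_simps)
    then have e: "m + ex i - ex l = m' + ex i" by (simp only: add_diff_cancel_right')
    have m'n: "mon m' c \<in> Rn n" using mon unfolding m(1) by (auto simp: Rn_iff keys_add_nat split: if_splits)
    let ?u = "br (Fr n) (agen i) (agen l)"
    have u: "?u \<in> derived (Fr n)" using assms(2) m by (intro derived.d_br agen_in_Fr)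
    have fu: "fcoord ?u = (0, \<lambda>j. (if j = i then xvar l else 0) - (if j = l then xvar i else 0))"
      using assms(2) m by (simp add: agen_in_Fr fcoord_agen) (auto simp: wgen_def fun_eq_iff)
    interpret lie_module "Fr n" "derived (Fr n)" agen n
      by (rule Fr.lie_module_derived[OF metabelian_Fr agen_in_Fr])
    have "act (Fr n) ?u agen (mon m' c) \<in> derived (Fr n)" by (rule act_closed[OF u m'n])
    moreover have "fcoord (act (Fr n) ?u agen (mon m' c)) =
        (0, \<lambda>j. ((if j = i then xvar l else 0) - (if j = l then xvar i else 0)) * mon m' c)"
      using fcoord_modact(1)[OF m'n Fr.derived_carrier[OF u] fu] by (simp add: modact_def)
    moreover have mm: "mon m c = xvar l * mon m' c" "mon (m + ex i - ex l) c = xvar i * mon m' c"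
      unfolding e by (simp_all add: m(1) mon_mult_xvar mult.commute)
    have "(\<lambda>j. ((if j = i then xvar l else 0) - (if j = l then xvar i else 0)) * mon m' c)
       = (\<lambda>j. (if j = i then mon m c else 0) - kvec (mon m c * xvar i) j)"
      unfolding kv l_def[symmetric] using m(3) by (auto simp: fun_eq_iff mm)
    ultimately show ?thesis unfolding dervec_def by auto
  qed
next
  case (add f g)
  have "(\<lambda>j. (if j = i then f + g else 0) - kvec ((f + g) * xvar i) j) =
    (\<lambda>j. ((if j = i then f else 0) - kvec (f * xvar i) j) + ((if j = i then g else 0) - kvec (g * xvar i) j))"
    by (auto simp: fun_eq_iff distrib_right kvec_add)
  then show ?case using dervec_add[OF add(1,2)] by simp
qed

text \<open>When the homotopy identities for the components \<open>v i\<close> are added, the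
  correction terms combine to \<open>kvec\<close> of \<Sum> v_i x_i, which is zero here.\<close>

lemma derived_of_WI:
  assumes "(0, v) \<in> WI n"
  shows "\<exists>c\<in>derived (Fr n). fcoord c = (0, v)"
proof -
  have v: "\<And>j. j < n \<Longrightarrow> v j \<in> Rn n" "\<And>j. j \<ge> n \<Longrightarrow> v j = 0" "(\<Sum>j<n. v j * xvar j) = 0"
    using assms by (auto simp: WI_def)
  have "(\<lambda>j. \<Sum>i<n. (if j = i then v i else 0) - kvec (v i * xvar i) j) \<in> dervec n"
    by (intro dervec_sum dervec_homotopy) (auto simp: v)
  moreover have "(\<Sum>i<n. (if j = i then v i else 0) - kvec (v i * xvar i) j) = v j" for j
    using v(2)[of j] by (auto simp: sum_subtractf sum.delta' kvec_sum[symmetric] v(3))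
  ultimately show ?thesis by (simp add: dervec_def)
qed

lemma Fr_of_Lin:
  assumes "p \<in> Lin n"
  shows "\<exists>c\<in>carrier (Fr n). fst (fcoord c) = p"
proof -
  obtain a where p: "p = (\<Sum>i<n. const (a i) * xvar i)" using assms by (auto simp: Lin_def)
  have "\<exists>c\<in>carrier (Fr n). fst (fcoord c) = (\<Sum>i<k. const (a i) * xvar i)" if "k \<le> n" for k
    using that
  proof (induction k)
    case 0
    show ?case by (rule bexI[of _ "cls Z"]) (auto intro: cls_in_Fr)
  next
    case (Suc k)
    then obtain c where c: "c \<in> carrier (Fr n)" "fst (fcoord c) = (\<Sum>i<k. const (a i) * xvar i)" by auto
    have "k < n" using Suc by simp
    note a = agen_in_Fr[OF this]
    show ?case using c a
      by (intro bexI[of _ "add (Fr n) c (sm (Fr n) (a k) (agen k))"]) (auto simp: fst_WW fcoord_agen wgen_def)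
  qed
  then show ?thesis using p by blast
qed

text \<open>Subtracting an element with the prescribed linear part reduces the claim to the derived
  algebra.\<close>

theorem WI_eq_fcoord_image: "x \<in> WI n \<Longrightarrow> \<exists>c\<in>carrier (Fr n). fcoord c = x"
proof -
  assume x: "x \<in> WI n"
  then have "fst x \<in> Lin n" by (auto simp: WI_def)
  then obtain c where c: "c \<in> carrier (Fr n)" "fst (fcoord c) = fst x" using Fr_of_Lin by blast
  let ?y = "add WW x (neg WW (fcoord c))"
  have "?y \<in> WI n" by (intro WI_add WI_neg x fcoord_WI c)
  moreover have "fst ?y = 0" using c by (simp add: fst_WW)
  ultimately obtain d where d: "d \<in> derived (Fr n)" "fcoord d = ?y" using derived_of_WI by (metis prod.collapse)
  have "fcoord (add (Fr n) c d) = add WW (fcoord c) ?y" using c d by (simp add: Fr.derived_carrier)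
  also have "\<dots> = x" by (cases x; cases "fcoord c") simp
  finally show ?thesis using c d by (intro bexI[of _ "add (Fr n) c d"]) (auto simp: Fr.derived_carrier)
qed

lemma derived_Fr_iff: "u \<in> derived (Fr n) \<longleftrightarrow> u \<in> carrier (Fr n) \<and> fst (fcoord u) = 0"
proof
  assume u: "u \<in> carrier (Fr n) \<and> fst (fcoord u) = 0"
  then have "(0, snd (fcoord u)) \<in> WI n" using fcoord_WI by (metis prod.collapse)
  then obtain c where c: "c \<in> derived (Fr n)" "fcoord c = (0, snd (fcoord u))" using derived_of_WI by blast
  then have "c = u" using u by (intro fcoord_inj[of c n u n]) (auto simp: Fr.derived_carrier prod_eq_iff)
  then show "u \<in> derived (Fr n)" using c by simp
qed (auto simp: Fr.derived_carrier fst_fcoord_derived)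

definition felem :: "nat \<Rightarrow> 'k::field mpoly \<times> (nat \<Rightarrow> 'k mpoly) \<Rightarrow> 'k ltm set" where
  "felem n x = (SOME c. c \<in> carrier (Fr n) \<and> fcoord c = x)"

lemma felem: "x \<in> WI n \<Longrightarrow> felem n x \<in> carrier (Fr n)" "x \<in> WI n \<Longrightarrow> fcoord (felem n x) = x"
  using someI_ex[of "\<lambda>c. c \<in> carrier (Fr n) \<and> fcoord c = x"] WI_eq_fcoord_image[of x n]
  unfolding felem_def by blast+

section \<open>The axioms in free metabelian algebras\<close>

lemma Fr_eq_zero_iff: "u \<in> carrier (Fr n) \<Longrightarrow> u = cls Z \<longleftrightarrow> fcoord u = (0, \<lambda>_. 0)"
  using fcoord_inj[of u n "cls Z" n] cls_in_Fr[of Z n] by (intro iffI) simp_all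

lemma fcoord_lsum:
  assumes "\<And>j. j < l \<Longrightarrow> F j \<in> carrier (Fr n)"
  shows "fst (fcoord (lsum (Fr n) (map F [0..<l]))) = (\<Sum>j<l. fst (fcoord (F j)))"
    "snd (fcoord (lsum (Fr n) (map F [0..<l]))) k = (\<Sum>j<l. snd (fcoord (F j)) k)"
proof -
  have c: "set (map F [0..<l]) \<subseteq> carrier (Fr n)" using assms by auto
  have e: "fcoord (lsum (Fr n) (map F [0..<l])) = lsum WW (map (\<lambda>j. fcoord (F j)) [0..<l])"
    using lsum_hom[OF fcoord_hom op_closed_Fr c] by (simp add: o_def)
  have "fst (lsum WW (map G xs)) = sum_list (map (\<lambda>j. fst (G j)) xs)"
    "snd (lsum WW (map G xs)) k = sum_list (map (\<lambda>j. snd (G j) k) xs)" for G :: "nat \<Rightarrow> 'a mpoly \<times> (nat \<Rightarrow> 'a mpoly)" and xs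
    by (induction xs) (auto simp: fst_WW snd_WW simp del: WW_simps(3))
  then show "fst (fcoord (lsum (Fr n) (map F [0..<l]))) = (\<Sum>j<l. fst (fcoord (F j)))"
    "snd (fcoord (lsum (Fr n) (map F [0..<l]))) k = (\<Sum>j<l. snd (fcoord (F j)) k)"
    unfolding e by (simp_all add: sum_list_distinct_conv_sum_set atLeast0LessThan)
qed

text \<open>With \<open>(p, v)\<close> the coordinates of \<open>u\<close>, the Fox vector of
  \<open>u y u\<close> is that of \<open>u y\<close> multiplied by \<open>p\<close>. If
  \<open>p\<close> is nonzero, the products of \<open>u\<close> with all generators must therefore
  vanish, which two generators make impossible.\<close>

lemma FitEl_Fr:
  fixes u :: "'k::field ltm set"
  assumes "r \<ge> 2" "u \<in> carrier (Fr r)"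
  shows "FitEl (Fr r) u \<longleftrightarrow> fst (fcoord u) = 0"
proof
  obtain p v where pv: "fcoord u = (p, v)" by (cases "fcoord u")
  have eq: "fcoord (br (Fr r) (br (Fr r) u y) u) = br WW (br WW (p, v) (fcoord y)) (p, v)" if "y \<in> carrier (Fr r)" for y :: "'k ltm set"
    using that assms by (simp add: pv del: WW_simps)
  show "FitEl (Fr r) u" if "fst (fcoord u) = 0"
    unfolding FitEl_def
  proof
    fix y :: "'k ltm set" assume y: "y \<in> carrier (Fr r)"
    then have "fcoord (br (Fr r) (br (Fr r) u y) u) = (0, \<lambda>_. 0)" unfolding eq[OF y]
      using that by (cases "fcoord y") (simp add: pv)
    then show "br (Fr r) (br (Fr r) u y) u = zero (Fr r)"
      using Fr_eq_zero_iff[of "br (Fr r) (br (Fr r) u y) u" r] y assms by simp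
  qed
  show "fst (fcoord u) = 0" if F: "FitEl (Fr r) u"
  proof (rule ccontr)
    assume p: "fst (fcoord u) \<noteq> 0"
    have "v j * xvar i = (if j = i then 1 else 0) * p" if i: "i < r" for i j
    proof -
      have "fcoord (br (Fr r) (br (Fr r) u (agen i)) u) = (0, \<lambda>_. 0)"
        using bspec[OF F[unfolded FitEl_def] agen_in_Fr[OF i]] by (simp del: fcoord_simps)
      then have "snd (br WW (br WW (p, v) (fcoord (agen i))) (p, v)) j = 0"
        unfolding eq[OF agen_in_Fr[OF i]] by simp
      then have "(v j * xvar i - (if j = i then 1 else 0) * p) * p = 0"
        by (simp only: fcoord_agen snd_WW fst_WW wgen_def fst_conv snd_conv mult_zero_right diff_zero)
      then show ?thesis using p by (simp add: pv)
    qed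
    \<comment> \<open>From \<open>v 1 * x_0 = 0\<close> one gets \<open>v 1 = 0\<close>, and then
      \<open>v 1 * x_1 = p\<close> contradicts that \<open>p\<close> is nonzero.\<close>
    from this[of 0 1] this[of 1 1] show False using assms(1) p by (simp add: pv)
  qed
qed

text \<open>In \<open>F_r\<close> the Fitting elements are those without linear part, so \<phi> says
  that the linear parts are linearly independent over k.\<close>

lemma phi_Fr:
  assumes "r \<ge> 2" "in_car (Fr r) n x"
  shows "phi (Fr r) n x \<longleftrightarrow> (\<forall>\<alpha>. (\<Sum>i<n. const (\<alpha> i) * fst (fcoord (x i))) = 0 \<longrightarrow> (\<forall>i<n. \<alpha> i = 0))"
proof -
  have x: "x i \<in> carrier (Fr r)" if "i < n" for i using assms(2) that by (auto simp: in_car_def)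
  have "lsum (Fr r) (map (\<lambda>i. sm (Fr r) (\<alpha> i) (x i)) [0..<n]) \<in> carrier (Fr r)" for \<alpha>
    by (intro Fr.lsum_closed) (auto simp: x)
  moreover have "fst (fcoord (lsum (Fr r) (map (\<lambda>i. sm (Fr r) (\<alpha> i) (x i)) [0..<n]))) =
      (\<Sum>i<n. const (\<alpha> i) * fst (fcoord (x i)))" for \<alpha>
    using x by (subst fcoord_lsum) (auto simp: fst_WW intro!: sum.cong)
  ultimately have "FitEl (Fr r) (lsum (Fr r) (map (\<lambda>i. sm (Fr r) (\<alpha> i) (x i)) [0..<n])) \<longleftrightarrow>
      (\<Sum>i<n. const (\<alpha> i) * fst (fcoord (x i))) = 0" for \<alpha>
    by (simp only: FitEl_Fr[OF assms(1)])
  then show ?thesis unfolding phi_def by blast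
qed

lemma WI_D:
  assumes "x \<in> WI n"
  shows "fst x \<in> Lin n" "snd x j \<in> Rn n" "j \<ge> n \<Longrightarrow> snd x j = 0" "(\<Sum>j<n. snd x j * xvar j) = fst x"
  using assms by (cases x; cases "j < n"; simp add: WI_def)+
lemmas fcoord_Lin = WI_D(1)[OF fcoord_WI] and fcoord_Rn = WI_D(2)[OF fcoord_WI]
  and fcoord_beyond = WI_D(3)[OF fcoord_WI] and fcoord_eps = WI_D(4)[OF fcoord_WI]

lemma phi_Fr_dual:
  assumes "r \<ge> 2" "in_car (Fr r) n x" "phi (Fr r) n x"
  obtains q where "\<And>j. q j \<in> Lin n" "\<And>i. i < n \<Longrightarrow> subst q (fst (fcoord (x i))) = xvar i"
proof -
  have "\<exists>q. (\<forall>j. q j \<in> Lin n) \<and> (\<forall>i<n. subst q (fst (fcoord (x i))) = xvar i)"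
  proof (rule linear_forms_dual)
    show "fst (fcoord (x i)) \<in> Lin r" if "i < n" for i using assms(2) that by (auto simp: in_car_def fcoord_Lin)
    show "\<forall>i<n. \<alpha> i = 0" if "(\<Sum>i<n. const (\<alpha> i) * fst (fcoord (x i))) = 0" for \<alpha>
      using that assms(3) unfolding phi_Fr[OF assms(1,2)] by blast
  qed
  then show ?thesis using that by blast
qed

lemma subst_dual: "f \<in> Rn n \<Longrightarrow> (\<And>i. i < n \<Longrightarrow> subst q (p i) = xvar i) \<Longrightarrow> subst q (subst p f) = f"
  unfolding subst_subst by (subst subst_cong[of f n _ xvar]) (auto simp: subst_id)

text \<open>The Fox vector of \<open>x y\<close> is annihilated by both linear parts. If one of them
  is nonzero the vector vanishes in the domain of polynomials; if both are zero it vanishes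
  anyway.\<close>

lemma Phi2_Fr: "Phi2 (Fr r)"
  unfolding Phi2_def
proof (intro ballI impI)
  fix x y assume xy: "x \<in> carrier (Fr r)" "y \<in> carrier (Fr r)"
    and h: "br (Fr r) (br (Fr r) x y) x = zero (Fr r) \<and> br (Fr r) (br (Fr r) x y) y = zero (Fr r)"
  obtain p v q w where c: "fcoord x = (p, v)" "fcoord y = (q, w)" by (cases "fcoord x", cases "fcoord y")
  have "fcoord (br (Fr r) (br (Fr r) x y) x) = (0, \<lambda>_. 0)" "fcoord (br (Fr r) (br (Fr r) x y) y) = (0, \<lambda>_. 0)"
    using h by simp_all
  then have "(v j * q - w j * p) * p = 0" "(v j * q - w j * p) * q = 0" for j
    using xy by (auto simp: c fun_eq_iff)
  then have "v j * q - w j * p = 0" for j by (metis diff_self mult_eq_0_iff)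
  then show "br (Fr r) x y = zero (Fr r)" using xy Fr_eq_zero_iff[of "br (Fr r) x y" r] by (simp add: c)
qed

text \<open>Commuting means \<open>v q = w p\<close>, a proportionality between
  \<open>(p, v)\<close> and \<open>(q, w)\<close>. Through a nonzero \<open>x\<close> such
  proportionalities are transitive; when the linear part of \<open>x\<close> is zero, some Fox
  component is not and forces the linear parts of \<open>y\<close> and \<open>z\<close> to be
  zero.\<close>

lemma Phi3_Fr: "Phi3 (Fr r)"
  unfolding Phi3_def
proof (intro ballI impI)
  fix x y z assume xyz: "x \<in> carrier (Fr r)" "y \<in> carrier (Fr r)" "z \<in> carrier (Fr r)"
    and h: "x \<noteq> zero (Fr r) \<and> br (Fr r) x y = zero (Fr r) \<and> br (Fr r) x z = zero (Fr r)"
  obtain p v q w q' w' where c: "fcoord x = (p, v)" "fcoord y = (q, w)" "fcoord z = (q', w')"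
    by (cases "fcoord x", cases "fcoord y", cases "fcoord z")
  have "fcoord (br (Fr r) x y) = (0, \<lambda>_. 0)" "fcoord (br (Fr r) x z) = (0, \<lambda>_. 0)" using h by simp_all
  then have e: "v j * q = w j * p" "v j * q' = w' j * p" for j using xyz by (auto simp: c fun_eq_iff)
  have "w j * q' = w' j * q" for j
  proof (cases "p = 0")
    case True
    have "fcoord x \<noteq> (0, \<lambda>_. 0)" using h Fr_eq_zero_iff[OF xyz(1)] by simp
    then obtain k where "v k \<noteq> 0" using True by (auto simp: c)
    then show ?thesis using e[of k] True by simp
  next
    case False
    have "p * (w j * q') = (w j * p) * q'" by (simp only: ac_simps)
    also have "\<dots> = (v j * q') * q" unfolding e(1)[symmetric] by (simp only: ac_simps)
    also have "\<dots> = p * (w' j * q)" unfolding e(2) by (simp only: ac_simps)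
    finally have "p * (w j * q') = p * (w' j * q)" .
    then show ?thesis using False by simp
  qed
  then show "br (Fr r) y z = zero (Fr r)" using xyz Fr_eq_zero_iff[of "br (Fr r) y z" r] by (simp add: c)
qed

text \<open>There are more coefficient vectors of length r + 1 over the finite field than linear
  forms in r variables. Two of them give the same combination, and their difference is a
  dependence.\<close>

lemma Phi4_Fr:
  assumes "r \<ge> 2"
  shows "Phi4 r (Fr r :: ('k::{field,finite}, 'k ltm set) liealg)"
  unfolding Phi4_def
proof (intro allI impI notI)
  fix x :: "nat \<Rightarrow> 'k ltm set" assume x: "in_car (Fr r) (Suc r) x" and phi: "phi (Fr r) (Suc r) x"
  define p where "p i = fst (fcoord (x i))" for i
  have p: "p i \<in> Lin r" if "i < Suc r" for i using x that by (auto simp: in_car_def p_def fcoord_Lin)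
  let ?A = "{..<Suc r} \<rightarrow>\<^sub>E (UNIV :: 'k set)"
  let ?F = "\<lambda>\<alpha>. restrict (\<lambda>j. coeff (\<Sum>i<Suc r. const (\<alpha> i) * p i) (ex j)) {..<r}"
  have "?F ` ?A \<subseteq> {..<r} \<rightarrow>\<^sub>E UNIV" by (simp only: image_subset_iff restrict_PiE_iff UNIV_I ball_simps) simp
  then have "card (?F ` ?A) \<le> card ({..<r} \<rightarrow>\<^sub>E (UNIV :: 'k set))" by (intro card_mono finite_PiE) auto
  also have "\<dots> = card (UNIV :: 'k set) ^ r" by (simp add: card_PiE)
  also have "\<dots> < card (UNIV :: 'k set) ^ Suc r"
  proof -
    have "card {0, 1 :: 'k} \<le> card (UNIV :: 'k set)" by (rule card_mono) auto
    then show ?thesis by simp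
  qed
  also have "\<dots> = card ?A" by (simp add: card_PiE)
  finally have "\<not> inj_on ?F ?A" by (rule pigeonhole)
  then obtain \<alpha> \<beta> where ab: "\<alpha> \<in> ?A" "\<beta> \<in> ?A" "\<alpha> \<noteq> \<beta>" "?F \<alpha> = ?F \<beta>"
    unfolding inj_on_def by blast
  let ?s = "\<Sum>i<Suc r. const (\<alpha> i - \<beta> i) * p i"
  have s: "?s = (\<Sum>i<Suc r. const (\<alpha> i) * p i) - (\<Sum>i<Suc r. const (\<beta> i) * p i)"
    unfolding sum_subtractf[symmetric] by (simp only: single_diff left_diff_distrib)
  have "coeff ?s (ex j) = 0" if "j < r" for j
    using fun_cong[OF ab(4), of j] that unfolding s by (simp add: lookup_minus)
  moreover have "?s \<in> Lin r" using p by (intro Lin_sum Lin_const_mult) auto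
  ultimately have "?s = 0" using Lin_expand[of ?s r] by simp
  then have "\<forall>i<Suc r. \<alpha> i - \<beta> i = 0" using phi unfolding phi_Fr[OF assms x] p_def by (elim allE[of _ "\<lambda>i. \<alpha> i - \<beta> i"]) blast
  then have "\<alpha> = \<beta>" using ab(1,2) by (intro PiE_ext[of _ "{..<Suc r}"]) auto
  then show False using ab(3) by simp
qed

text \<open>The action multiplies the Fox vector by \<open>f\<close> evaluated at independent linear
  forms, and this value is nonzero because the dual substitution returns \<open>f\<close>.\<close>

lemma Phi5_Fr:
  assumes "r \<ge> 2"
  shows "Phi5 r (Fr r)"
  unfolding Phi5_def
proof (intro allI ballI impI notI)
  fix n f z1 z2 x assume n: "n \<le> r" and f: "f \<in> Rn n" "f \<noteq> 0" and z: "z1 \<in> carrier (Fr r)" "z2 \<in> carrier (Fr r)"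
    and x: "in_car (Fr r) n x" and h: "act (Fr r) (br (Fr r) z1 z2) x f = zero (Fr r) \<and> br (Fr r) z1 z2 \<noteq> zero (Fr r)"
    and phi: "phi (Fr r) n x"
  obtain q where q: "\<And>i. i < n \<Longrightarrow> subst q (fst (fcoord (x i))) = xvar i" using phi_Fr_dual[OF assms x phi] by blast
  let ?p = "\<lambda>i. fst (fcoord (x i))"
  let ?u = "br (Fr r) z1 z2"
  obtain v where v: "fcoord ?u = (0, v)" using z by (metis derived.d_br fst_fcoord_derived prod.collapse)
  have u: "?u \<in> carrier (Fr r)" using z by simp
  have "fcoord ?u \<noteq> (0, \<lambda>_. 0)" using h Fr_eq_zero_iff[OF u] by simp
  then obtain j where j: "v j \<noteq> 0" by (auto simp: v)
  have "fcoord (act (Fr r) ?u x f) = (0, \<lambda>j. v j * subst ?p f)"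
    by (rule fcoord_act(1)[OF f(1) u v]) (use x in \<open>auto simp: in_car_def\<close>)
  then have "v j * subst ?p f = 0" using h by (auto simp: fun_eq_iff)
  then have "subst ?p f = 0" using j by simp
  then show False using subst_dual[OF f(1), of q ?p] q f(2) by simp
qed

text \<open>The chain rule for Fox derivatives.\<close>
lemma teval_WW:
  fixes g :: "nat \<Rightarrow> 'k::field mpoly \<times> (nat \<Rightarrow> 'k mpoly)"
  assumes "tvars t \<subseteq> {..<n}"
  shows "fst (teval WW g t) = subst (\<lambda>i. fst (g i)) (fst (dv t)) \<and>
    (\<forall>j. snd (teval WW g t) j = (\<Sum>i<n. subst (\<lambda>i. fst (g i)) (snd (dv t) i) * snd (g i) j))"
  using assms
proof (induction t)
  case (V k)
  have "(\<Sum>i<n. subst (\<lambda>i. fst (g i)) (if i = k then 1 else 0) * snd (g i) j) = (\<Sum>i<n. if i = k then snd (g i) j else 0)" for j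
    by (rule sum.cong) auto
  then show ?case using V by (simp add: wgen_def sum.delta)
next
  case (Br s t)
  let ?S = "subst (\<lambda>i. fst (g i))"
  have "(\<Sum>i<n. ?S (snd (dv (Br s t)) i) * snd (g i) j) =
     (\<Sum>i<n. ?S (snd (dv s) i) * snd (g i) j) * ?S (fst (dv t)) - (\<Sum>i<n. ?S (snd (dv t) i) * snd (g i) j) * ?S (fst (dv s))" for j
    unfolding sum_distrib_right sum_subtractf[symmetric]
    by (rule sum.cong) (auto simp: snd_WW subst_diff subst_mult algebra_simps)
  then show ?case using Br by (simp add: fst_WW snd_WW)
qed (auto simp: fst_WW snd_WW subst_add subst_uminus subst_mult sum.distrib distrib_right sum_negf sum_distrib_left mult.assoc)

lemma fcoord_teval:
  assumes "tvars t \<subseteq> {..<n}" "\<And>i. i < n \<Longrightarrow> x i \<in> carrier (Fr r)"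
  shows "fst (fcoord (teval (Fr r) x t)) = subst (\<lambda>i. fst (fcoord (x i))) (fst (dv t))"
    "snd (fcoord (teval (Fr r) x t)) j = (\<Sum>i<n. subst (\<lambda>i. fst (fcoord (x i))) (snd (dv t) i) * snd (fcoord (x i)) j)"
    "teval (Fr r) x t \<in> carrier (Fr r)"
proof -
  have x: "x i \<in> carrier (Fr r)" if "i \<in> tvars t" for i using assms that by auto
  have e: "fcoord (teval (Fr r) x t) = teval WW (\<lambda>i. fcoord (x i)) t" by (rule teval_hom[OF fcoord_hom op_closed_Fr x])
  show "teval (Fr r) x t \<in> carrier (Fr r)" by (rule teval_closed[OF op_closed_Fr x])
  show "fst (fcoord (teval (Fr r) x t)) = subst (\<lambda>i. fst (fcoord (x i))) (fst (dv t))"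
    "snd (fcoord (teval (Fr r) x t)) j = (\<Sum>i<n. subst (\<lambda>i. fst (fcoord (x i))) (snd (dv t) i) * snd (fcoord (x i)) j)"
    unfolding e using teval_WW[OF assms(1), of "\<lambda>i. fcoord (x i)"] by auto
qed

lemma coeff_mult_xvar_ex: "coeff (f * xvar i) (ex j) = (if i = j then coeff f 0 else 0)" for f :: "'k::comm_semiring_1 mpoly"
proof (induction f rule: mpoly_induct)
  case (mon m c)
  have "m + ex i = ex j \<longleftrightarrow> m = 0 \<and> i = j"
  proof
    assume e: "m + ex i = ex j"
    have l: "Poly_Mapping.lookup m k + Poly_Mapping.lookup (ex i) k = Poly_Mapping.lookup (ex j) k" for k
      using e by (metis lookup_add)
    have ij: "i = j" using l[of i] by (cases "i = j") (auto simp: lookup_single)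
    then have "m = 0" using e by (metis add_cancel_right_left)
    then show "m = 0 \<and> i = j" using ij by simp
  qed auto
  then show ?case by (auto simp: mon_mult_xvar[symmetric] lookup_single when_def)
qed (simp add: distrib_right lookup_add)

text \<open>The fundamental identity in degree one: the constant terms of the Fox derivatives are
  the coefficients of the linear part.\<close>

lemma coeff0_of_eps: "j < r \<Longrightarrow> coeff (\<Sum>i<r. v i * xvar i) (ex j) = coeff (v j) 0" for v :: "nat \<Rightarrow> 'k::comm_semiring_1 mpoly"
  by (simp add: lookup_sum coeff_mult_xvar_ex sum.delta)

text \<open>The constant terms of the Fox vectors are the coefficients of the linear parts, which
  are independent over k by \<phi>; this lifts to independence of the vectors over the
  polynomials.\<close>

lemma phi_Fr_rows:
  assumes "r \<ge> 2" "in_car (Fr r) n x" "phi (Fr r) n x" and g: "\<And>j. j < r \<Longrightarrow> (\<Sum>i<n. g i * snd (fcoord (x i)) j) = 0"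
  shows "\<forall>i<n. g i = 0"
proof (rule rows_independent_of_const_terms[OF _ g])
  fix \<alpha> assume a: "\<forall>j<r. (\<Sum>i<n. \<alpha> i * coeff (snd (fcoord (x i)) j) 0) = 0"
  let ?s = "\<Sum>i<n. const (\<alpha> i) * fst (fcoord (x i))"
  have x: "x i \<in> carrier (Fr r)" if "i < n" for i using assms(2) that by (auto simp: in_car_def)
  have c: "coeff (fst (fcoord (x i))) (ex j) = coeff (snd (fcoord (x i)) j) 0" if "i < n" "j < r" for i j
    unfolding fcoord_eps[OF x[OF that(1)], symmetric] by (rule coeff0_of_eps[OF that(2)])
  have "coeff ?s (ex j) = 0" if "j < r" for j
  proof -
    have "coeff ?s (ex j) = (\<Sum>i<n. \<alpha> i * coeff (snd (fcoord (x i)) j) 0)"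
      unfolding lookup_sum coeff_const_mult by (rule sum.cong) (auto simp: c that)
    then show ?thesis using a that by simp
  qed
  moreover have "?s \<in> Lin r" using x by (intro Lin_sum Lin_const_mult fcoord_Lin) auto
  ultimately have "?s = 0" using Lin_expand[of ?s r] by simp
  then show "\<forall>i<n. \<alpha> i = 0" using assms(3) unfolding phi_Fr[OF assms(1,2)] by blast
qed

text \<open>If \<open>l\<close> vanishes at \<open>x\<close>, the chain rule gives a relation
  between the Fox vectors of the \<open>x i\<close> whose coefficients are the substituted Fox
  derivatives of \<open>l\<close>. Independence of the rows kills these coefficients, and the dual
  substitution undoes the evaluation.\<close>

lemma Phi6_Fr:
  assumes "r \<ge> 2"
  shows "Phi6 r (Fr r :: ('k::field, 'k ltm set) liealg)"
  unfolding Phi6_def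
proof (intro allI impI notI)
  fix n l and x :: "nat \<Rightarrow> 'k ltm set"
  assume n: "n \<le> r" and l: "tvars l \<subseteq> {..<n} \<and> cls l \<noteq> zero (Fr n :: ('k, 'k ltm set) liealg)"
    and x: "in_car (Fr r) n x" and phi: "phi (Fr r) n x" and z: "teval (Fr r) x l = zero (Fr r)"
  let ?p = "\<lambda>i. fst (fcoord (x i))"
  obtain q where q: "\<And>i. i < n \<Longrightarrow> subst q (?p i) = xvar i" using phi_Fr_dual[OF assms x phi] by blast
  have xc: "x i \<in> carrier (Fr r)" if "i < n" for i using x that by (auto simp: in_car_def)
  have I: "dv l \<in> WI n" using l by (intro dv_WI) auto
  have z0: "fcoord (teval (Fr r) x l) = (0, \<lambda>_. 0)" by (simp add: z)
  have R: "f = 0" if "f \<in> Rn n" "subst ?p f = 0" for f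
    using subst_dual[OF that(1), of q ?p] q that(2) by simp
  have "subst ?p (fst (dv l)) = 0" using fcoord_teval(1)[where x = x, OF conjunct1[OF l] xc] z0 by simp
  then have f0: "fst (dv l) = 0" by (rule R[OF Lin_Rn[OF WI_D(1)[OF I]]])
  have "(\<Sum>i<n. subst ?p (snd (dv l) i) * snd (fcoord (x i)) j) = 0" for j
    using fcoord_teval(2)[where x = x and j = j, OF conjunct1[OF l] xc] z0 by simp
  then have "\<forall>i<n. subst ?p (snd (dv l) i) = 0" by (intro phi_Fr_rows[OF assms x phi])
  then have "snd (dv l) i = 0" for i
    using R[OF WI_D(2)[OF I], of i] WI_D(3)[OF I, of i] by (cases "i < n") auto
  then have "dv l = dv Z" using f0 by (simp add: prod_eq_iff fun_eq_iff)
  then show False using l by (simp add: cls_eq_iff_dv del: teval.simps)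
qed

text \<open>Coordinates are faithful and reach every pair in \<open>WI n\<close>, so a module system
  over \<open>F_n^2\<close> becomes a family of polynomial equations, one for each Fox
  component.\<close>

lemma solvable_loc_iff:
  fixes f :: "nat \<Rightarrow> nat \<Rightarrow> 'k::field mpoly"
  assumes f: "\<And>i j. i < m \<Longrightarrow> j < l \<Longrightarrow> f i j \<in> Rn n" and c: "\<And>i. i < m \<Longrightarrow> c i \<in> derived (Fr n)"
  shows "solvable_loc n m l f c \<longleftrightarrow> (\<exists>w s t. (\<forall>j<l. (0, w j) \<in> WI n) \<and> s \<in> Rn n \<and> coeff s 0 \<noteq> 0 \<and> t \<in> Rn n \<and> coeff t 0 \<noteq> 0 \<and>
     (\<forall>i<m. \<forall>k. (\<Sum>j<l. w j k * f i j) * t = snd (fcoord (c i)) k * s * t))"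
proof -
  have key: "modact n (lsum (Fr n) (map (\<lambda>j. modact n (w j) (f i j)) [0..<l])) t = modact n (modact n (c i) s) t \<longleftrightarrow>
      (\<forall>k. (\<Sum>j<l. snd (fcoord (w j)) k * f i j) * t = snd (fcoord (c i)) k * s * t)"
    if i: "i < m" and w: "\<forall>j<l. w j \<in> derived (Fr n)" and st: "s \<in> Rn n" "t \<in> Rn n" for i w s t
  proof -
    have wv: "w j \<in> carrier (Fr n)" "fcoord (w j) = (0, snd (fcoord (w j)))" if "j < l" for j
      using w that by (auto simp: derived_Fr_iff prod_eq_iff)
    have cv: "c i \<in> carrier (Fr n)" "fcoord (c i) = (0, snd (fcoord (c i)))"
      using c[OF i] by (auto simp: derived_Fr_iff prod_eq_iff)
    let ?L = "lsum (Fr n) (map (\<lambda>j. modact n (w j) (f i j)) [0..<l])"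
    have m: "modact n (w j) (f i j) \<in> carrier (Fr n)" "fcoord (modact n (w j) (f i j)) = (0, \<lambda>k. snd (fcoord (w j)) k * f i j)" if "j < l" for j
      using fcoord_modact[OF f[OF i that] wv[OF that]] by auto
    have "?L \<in> carrier (Fr n)" by (intro Fr.lsum_closed) (auto simp: m)
    moreover have "fcoord ?L = (0, \<lambda>k. \<Sum>j<l. snd (fcoord (w j)) k * f i j)"
      using m by (auto simp: prod_eq_iff fcoord_lsum fun_eq_iff)
    ultimately have 1: "modact n ?L t \<in> carrier (Fr n)" "fcoord (modact n ?L t) = (0, \<lambda>k. (\<Sum>j<l. snd (fcoord (w j)) k * f i j) * t)"
      using fcoord_modact[OF st(2)] by auto
    have "modact n (c i) s \<in> carrier (Fr n)" "fcoord (modact n (c i) s) = (0, \<lambda>k. snd (fcoord (c i)) k * s)"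
      using fcoord_modact[OF st(1) cv] by auto
    then have 2: "modact n (modact n (c i) s) t \<in> carrier (Fr n)" "fcoord (modact n (modact n (c i) s) t) = (0, \<lambda>k. snd (fcoord (c i)) k * s * t)"
      using fcoord_modact[OF st(2)] by auto
    show ?thesis using fcoord_inj[OF 1(1) 2(1)] 1(2) 2(2) by (auto simp: fun_eq_iff)
  qed
  show ?thesis
  proof
    assume "solvable_loc n m l f c"
    then obtain w s t where a: "\<forall>j<l. w j \<in> derived (Fr n)" "s \<in> Rn n" "coeff s 0 \<noteq> 0" "t \<in> Rn n" "coeff t 0 \<noteq> 0"
      "\<forall>i<m. modact n (lsum (Fr n) (map (\<lambda>j. modact n (w j) (f i j)) [0..<l])) t = modact n (modact n (c i) s) t"
      unfolding solvable_loc_def by blast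
    have "(0, snd (fcoord (w j))) \<in> WI n" if "j < l" for j
      using a(1) that fcoord_WI[of "w j" n] by (auto simp: derived_Fr_iff) (metis prod.collapse)
    then show "\<exists>w s t. (\<forall>j<l. (0, w j) \<in> WI n) \<and> s \<in> Rn n \<and> coeff s 0 \<noteq> 0 \<and> t \<in> Rn n \<and> coeff t 0 \<noteq> 0 \<and>
     (\<forall>i<m. \<forall>k. (\<Sum>j<l. w j k * f i j) * t = snd (fcoord (c i)) k * s * t)"
      using a key[OF _ a(1,2,4)] by (intro exI[of _ "\<lambda>j. snd (fcoord (w j))"] exI[of _ s] exI[of _ t]) auto
  next
    assume "\<exists>w s t. (\<forall>j<l. (0, w j) \<in> WI n) \<and> s \<in> Rn n \<and> coeff s 0 \<noteq> 0 \<and> t \<in> Rn n \<and> coeff t 0 \<noteq> 0 \<and>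
     (\<forall>i<m. \<forall>k. (\<Sum>j<l. w j k * f i j) * t = snd (fcoord (c i)) k * s * t)"
    then obtain w s t where a: "\<forall>j<l. (0, w j) \<in> WI n" "s \<in> Rn n" "coeff s 0 \<noteq> 0" "t \<in> Rn n" "coeff t 0 \<noteq> 0"
      "\<forall>i<m. \<forall>k. (\<Sum>j<l. w j k * f i j) * t = snd (fcoord (c i)) k * s * t" by blast
    let ?w = "\<lambda>j. felem n (0, w j)"
    have w: "\<forall>j<l. ?w j \<in> derived (Fr n)" "\<And>j. j < l \<Longrightarrow> fcoord (?w j) = (0, w j)"
      using a(1) by (auto simp: derived_Fr_iff felem)
    show "solvable_loc n m l f c" unfolding solvable_loc_def
      using a(2-6) w key[OF _ w(1) a(2,4)] by (intro exI[of _ ?w] exI[of _ s] exI[of _ t]) auto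
  qed
qed

lemma sum_delta_mult: "i < (n :: nat) \<Longrightarrow> (\<Sum>k<n. f k * (if i = k then s else 0)) = f i * (s :: 'a::comm_semiring_1)"
  "i < (n :: nat) \<Longrightarrow> (\<Sum>k<n. f k * (if k = i then s else 0)) = f i * (s :: 'a::comm_semiring_1)"
proof -
  assume i: "i < n"
  have "(\<Sum>k<n. f k * (if k = i then s else 0)) = (\<Sum>k<n. if k = i then f k * s else 0)" by (rule sum.cong) auto
  also have "\<dots> = f i * s" using i by (simp add: sum.delta)
  finally show "(\<Sum>k<n. f k * (if k = i then s else 0)) = f i * s" .
  then show "(\<Sum>k<n. f k * (if i = k then s else 0)) = f i * s" by (simp add: eq_commute[of i])
qed

lemma WI_1_derived: "n \<le> 1 \<Longrightarrow> (0, v) \<in> WI n \<Longrightarrow> v = (\<lambda>_. 0)" for v :: "nat \<Rightarrow> 'k::field mpoly"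
proof
  fix j assume n: "n \<le> 1" and v: "(0, v) \<in> WI n"
  show "v j = 0"
  proof (cases "j < n")
    case True
    then have "n = 1" "j = 0" using n by auto
    then show ?thesis using WI_D(4)[OF v] by (simp add: One_nat_def)
  qed (use WI_D(3)[OF v] in auto)
qed

text \<open>A system solvable in \<open>F_r\<close> is carried to \<open>F_n\<close> by the homomorphism \<open>\<theta>\<close> inverting the linear parts of
  \<open>x_1, \<dots>, x_n\<close>. The composite \<open>F_n \<rightarrow> F_r \<rightarrow> F_n\<close> is the identity modulo \<open>\<Delta>\<close>, hence invertible on the
  localised derived algebra.\<close>
lemma Phi7_core:
  fixes x :: "nat \<Rightarrow> 'k::field ltm set"
  assumes r: "r \<ge> 2" and x: "in_car (Fr r) n x" and phi: "phi (Fr r) n x"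
    and f: "\<And>i j. i < m \<Longrightarrow> j < l \<Longrightarrow> f i j \<in> Rn n"
    and z: "\<And>j. j < l \<Longrightarrow> (0, z j) \<in> WI r" and c: "\<And>i. i < m \<Longrightarrow> (0, c i) \<in> WI n"
    and eq: "\<And>i k. i < m \<Longrightarrow> (\<Sum>j<l. z j k * subst (\<lambda>a. fst (fcoord (x a))) (f i j)) =
       (\<Sum>a<n. subst (\<lambda>a. fst (fcoord (x a))) (c i a) * snd (fcoord (x a)) k)"
  shows "\<exists>w s. (\<forall>j<l. (0, w j) \<in> WI n) \<and> s \<in> Rn n \<and> coeff s 0 \<noteq> 0 \<and>
     (\<forall>i<m. \<forall>k. (\<Sum>j<l. w j k * f i j) = c i k * s)"
proof -
  define p where "p a = fst (fcoord (x a))" for a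
  define b where "b a = snd (fcoord (x a))" for a
  have xc: "x a \<in> carrier (Fr r)" if "a < n" for a using x that by (auto simp: in_car_def)
  obtain q where q: "\<And>j. q j \<in> Lin n" "\<And>a. a < n \<Longrightarrow> subst q (p a) = xvar a"
    using phi_Fr_dual[OF r x phi] unfolding p_def by blast
  have "\<exists>e. e \<in> carrier (Fr n) \<and> fst (fcoord e) = q j" for j using Fr_of_Lin[OF q(1)] by blast
  then obtain e where e: "\<And>j. e j \<in> carrier (Fr n)" "\<And>j. fst (fcoord (e j)) = q j" by metis
  define E where "E j = snd (fcoord (e j))" for j
  have E: "E j k \<in> Rn n" "(\<Sum>k<n. E j k * xvar k) = q j" for j k
    unfolding E_def using fcoord_Rn[OF e(1)] fcoord_eps[OF e(1)] e(2) by auto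
  have qR: "subst q g \<in> Rn n" if "g \<in> Rn N" for g N by (rule subst_Rn[OF that]) (auto intro: Lin_Rn q)
  \<comment> \<open>By the chain rule, the Fox vector of the image under
    \<open>a_j \<mapsto> e j\<close> of a member of \<open>F_r^2\<close> with Fox vector
    \<open>v\<close>.\<close>
  define \<theta> where "\<theta> v k = (\<Sum>j<r. subst q (v j) * E j k)" for v :: "nat \<Rightarrow> 'k mpoly" and k
  have \<theta>R: "\<theta> v k \<in> Rn n" if "\<And>j. v j \<in> Rn r" for v k
    unfolding \<theta>_def by (intro Rn_sum Rn_mult qR[OF that] E)
  have \<theta>eps: "(\<Sum>k<n. \<theta> v k * xvar k) = subst q (\<Sum>j<r. v j * xvar j)" for v
  proof -
    have "(\<Sum>k<n. \<theta> v k * xvar k) = (\<Sum>j<r. subst q (v j) * (\<Sum>k<n. E j k * xvar k))"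
      unfolding \<theta>_def sum_distrib_left sum_distrib_right by (subst sum.swap) (simp only: mult.assoc)
    also have "\<dots> = subst q (\<Sum>j<r. v j * xvar j)" unfolding E by (simp only: subst_sum subst_mult subst_xvar)
    finally show ?thesis .
  qed
  \<comment> \<open>The Fox Jacobian of the composite
    \<open>F_n \<rightarrow> F_r \<rightarrow> F_n\<close>.\<close>
  define B where "B a = \<theta> (b a)" for a
  have Beps: "(\<Sum>k<n. B a k * xvar k) = xvar a" if "a < n" for a
    unfolding B_def \<theta>eps b_def fcoord_eps[OF xc[OF that]] using q(2)[OF that] by (simp add: p_def)
  have BR: "B a k \<in> Rn n" if "a < n" for a k
    unfolding B_def b_def by (rule \<theta>R) (rule fcoord_Rn[OF xc[OF that]])
  \<comment> \<open>The composite fixes linear parts, and by the fundamental identity these are the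
    constant terms of the Jacobian.\<close>
  have "\<forall>a<n. \<forall>k<n. coeff (B a k) 0 = (if a = k then 1 else 0) \<and> B a k \<in> Rn n"
  proof (intro allI impI conjI)
    fix a k assume ak: "a < n" "k < n"
    show "coeff (B a k) 0 = (if a = k then 1 else 0)"
      using coeff0_of_eps[OF ak(2), of "B a"] unfolding Beps[OF ak(1)] coeff_xvar_ex by auto
    show "B a k \<in> Rn n" by (rule BR[OF ak(1)])
  qed
  from matrix_inverse_up_to_unit[OF this] obtain d s where s: "coeff s 0 = 1" "s \<in> Rn n"
    and d: "\<And>a k. a < n \<Longrightarrow> k < n \<Longrightarrow> d a k \<in> Rn n"
    and dB: "\<And>a k. a < n \<Longrightarrow> k < n \<Longrightarrow> (\<Sum>j<n. d a j * B j k) = (if a = k then s else 0)"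
    and Bd: "\<And>a k. a < n \<Longrightarrow> k < n \<Longrightarrow> (\<Sum>j<n. B a j * d j k) = (if a = k then s else 0)" by blast
  have deps: "(\<Sum>k<n. d a k * xvar k) = s * xvar a" if a: "a < n" for a
  proof -
    have "(\<Sum>k<n. d a k * xvar k) = (\<Sum>k<n. d a k * (\<Sum>i<n. B k i * xvar i))"
      by (rule sum.cong) (auto simp: Beps)
    also have "\<dots> = (\<Sum>i<n. (\<Sum>k<n. d a k * B k i) * xvar i)"
      unfolding sum_distrib_left sum_distrib_right by (subst sum.swap) (simp only: mult.assoc)
    also have "\<dots> = (\<Sum>i<n. xvar i * (if a = i then s else 0))"
      by (rule sum.cong) (use a in \<open>auto simp: dB\<close>)
    also have "\<dots> = s * xvar a" using a by (simp add: sum_delta_mult mult.commute)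
    finally show ?thesis .
  qed
  \<comment> \<open>Transport by \<theta>, then undo the Jacobian up to the factor \<open>s\<close>.
    The value 0 beyond \<open>n\<close> is part of membership in \<open>WI n\<close>.\<close>
  define w where "w j k = (if k < n then \<Sum>a<n. \<theta> (z j) a * d a k else 0)" for j k
  have zR: "z j k \<in> Rn r" if "j < l" for j k using WI_D(2)[OF z[OF that], of k] by simp
  have "(0, w j) \<in> WI n" if j: "j < l" for j
  proof -
    have "(\<Sum>k<n. w j k * xvar k) = (\<Sum>a<n. \<theta> (z j) a * (\<Sum>k<n. d a k * xvar k))"
      unfolding sum_distrib_left by (subst sum.swap) (simp add: w_def sum_distrib_right mult.assoc)
    also have "\<dots> = (\<Sum>a<n. s * (\<theta> (z j) a * xvar a))" by (rule sum.cong) (auto simp: deps)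
    also have "\<dots> = s * (\<Sum>a<n. \<theta> (z j) a * xvar a)" by (simp only: sum_distrib_left)
    also have "\<dots> = 0" unfolding \<theta>eps using WI_D(4)[OF z[OF j]] by simp
    finally have "(\<Sum>k<n. w j k * xvar k) = 0" .
    moreover have "w j k \<in> Rn n" for k
      using \<theta>R[of "z j"] zR[OF j] d by (auto simp: w_def intro!: Rn_sum Rn_mult)
    moreover have "w j k = 0" if "k \<ge> n" for k using that by (simp add: w_def)
    ultimately show ?thesis by (simp add: WI_def)
  qed
  moreover have "(\<Sum>j<l. w j k * f i j) = c i k * s" if i: "i < m" for i k
  proof (cases "k < n")
    case True
    \<comment> \<open>Applying \<theta> to the solved system substitutes \<open>q\<close> in the
      coefficients. Since \<open>q\<close> inverts \<open>p\<close> on \<open>R_n\<close>, the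
      original \<open>f i j\<close> and \<open>c i\<close> return, and only the Jacobian remains on
      the right.\<close>
    have 1: "(\<Sum>j<l. \<theta> (z j) a * f i j) = (\<Sum>i'<n. c i i' * B i' a)" for a
    proof -
      have ff: "subst q (subst p (f i j)) = f i j" if "j < l" for j
        by (rule subst_dual[OF f[OF i that] q(2)])
      have cc: "subst q (subst p (c i j)) = c i j" for j
        by (rule subst_dual[OF _ q(2)]) (use WI_D(2)[OF c[OF i], of j] in auto)
      have "(\<Sum>j<l. \<theta> (z j) a * f i j) = (\<Sum>j<l. \<Sum>h<r. subst q (z j h * subst p (f i j)) * E h a)"
        unfolding \<theta>_def sum_distrib_right by (intro sum.cong HOL.refl) (auto simp: subst_mult ff ac_simps)
      also have "\<dots> = (\<Sum>h<r. subst q (\<Sum>j<l. z j h * subst p (f i j)) * E h a)"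
        by (subst sum.swap) (simp only: subst_sum sum_distrib_right)
      also have "\<dots> = (\<Sum>h<r. subst q (\<Sum>i'<n. subst p (c i i') * b i' h) * E h a)"
        using eq[OF i] unfolding p_def b_def by simp
      also have "\<dots> = (\<Sum>h<r. \<Sum>i'<n. c i i' * (subst q (b i' h) * E h a))"
        by (simp only: subst_sum subst_mult cc sum_distrib_right mult.assoc)
      also have "\<dots> = (\<Sum>i'<n. c i i' * B i' a)"
        unfolding B_def \<theta>_def sum_distrib_left by (rule sum.swap)
      finally show ?thesis .
    qed
    have "(\<Sum>j<l. w j k * f i j) = (\<Sum>j<l. \<Sum>a<n. \<theta> (z j) a * f i j * d a k)"
      using True by (simp add: w_def sum_distrib_left sum_distrib_right ac_simps)
    also have "\<dots> = (\<Sum>a<n. (\<Sum>j<l. \<theta> (z j) a * f i j) * d a k)"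
      by (subst sum.swap) (simp only: sum_distrib_right)
    also have "\<dots> = (\<Sum>a<n. \<Sum>i'<n. c i i' * (B i' a * d a k))"
      unfolding 1 by (simp only: sum_distrib_right mult.assoc)
    also have "\<dots> = (\<Sum>i'<n. c i i' * (\<Sum>a<n. B i' a * d a k))"
      by (subst sum.swap) (simp only: sum_distrib_left)
    also have "\<dots> = (\<Sum>i'<n. c i i' * (if i' = k then s else 0))"
      by (rule sum.cong) (use True in \<open>auto simp: Bd\<close>)
    also have "\<dots> = c i k * s" using True by (simp add: sum_delta_mult)
    finally show ?thesis .
  qed (use WI_D(3)[OF c[OF i]] in \<open>auto simp: w_def\<close>)
  ultimately show ?thesis using s by (intro exI[of _ w] exI[of _ s]) auto
qed

text \<open>If \<open>y\<close> had a nonzero linear part, \<open>y x_i y = 0\<close> would make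
  every \<open>x i\<close> proportional to \<open>y\<close>. The Fox vectors of two of them would
  then be dependent, against \<open>phi_Fr_rows\<close>.\<close>

lemma fst_zero_of_centralizing:
  fixes x :: "nat \<Rightarrow> 'k::field ltm set"
  assumes r: "r \<ge> 2" and n: "n \<ge> 2" and x: "in_car (Fr r) n x" and phi: "phi (Fr r) n x" and y: "y \<in> carrier (Fr r)"
    and h: "\<And>i. i < n \<Longrightarrow> br (Fr r) (br (Fr r) y (x i)) y = zero (Fr r)"
  shows "fst (fcoord y) = 0"
proof (rule ccontr)
  assume q: "fst (fcoord y) \<noteq> 0"
  define p where "p a = fst (fcoord (x a))" for a
  define b where "b a = snd (fcoord (x a))" for a
  have xc: "x a \<in> carrier (Fr r)" if "a < n" for a using x that by (auto simp: in_car_def)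
  have 1: "snd (fcoord y) k * p i = b i k * fst (fcoord y)" if i: "i < n" for i k
  proof -
    have "snd (br WW (br WW (fcoord y) (fcoord (x i))) (fcoord y)) k = snd (fcoord (br (Fr r) (br (Fr r) y (x i)) y)) k"
      using y xc[OF i] by simp
    also have "\<dots> = 0" unfolding h[OF i] by simp
    finally have "(snd (fcoord y) k * p i - b i k * fst (fcoord y)) * fst (fcoord y) = 0"
      by (simp add: snd_WW fst_WW p_def b_def)
    then show ?thesis using q by simp
  qed
  \<comment> \<open>Eliminating \<open>y\<close> from the proportionalities for \<open>x 0\<close>
    and \<open>x 1\<close> leaves \<open>p 1 * b 0 = p 0 * b 1\<close>; the coefficient
    \<open>p 1\<close> is nonzero because the forms are independent.\<close>
  let ?g = "\<lambda>i. if i = 0 then p 1 else if i = 1 then - p 0 else 0"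
  have "(\<Sum>i<n. ?g i * b i k) = 0" for k
  proof -
    have "fst (fcoord y) * (p 1 * b 0 k - p 0 * b 1 k) = p 1 * (b 0 k * fst (fcoord y)) - p 0 * (b 1 k * fst (fcoord y))"
      by (simp add: algebra_simps)
    also have "\<dots> = p 1 * (snd (fcoord y) k * p 0) - p 0 * (snd (fcoord y) k * p 1)"
      using 1[of 0 k] 1[of 1 k] n by simp
    also have "\<dots> = 0" by (simp add: algebra_simps)
    finally have "p 1 * b 0 k - p 0 * b 1 k = 0" using q by simp
    moreover have "(\<Sum>i<n. ?g i * b i k) = (\<Sum>i\<in>{0, 1}. ?g i * b i k)"
      using n by (intro sum.mono_neutral_right) auto
    ultimately show ?thesis by (simp add: algebra_simps)
  qed
  then have "\<forall>i<n. ?g i = 0" using phi_Fr_rows[OF r x phi, of ?g] by (simp add: b_def)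
  then have "?g (0 :: nat) = 0" using n by (elim allE[of _ 0]) simp
  then have "p 1 = 0" by simp
  moreover have "\<forall>\<alpha>. (\<Sum>i<n. const (\<alpha> i) * p i) = 0 \<longrightarrow> (\<forall>i<n. \<alpha> i = 0)"
    using phi unfolding phi_Fr[OF r x] p_def .
  moreover have "(\<Sum>i<n. const (if i = 1 then 1 else 0) * p i) = (\<Sum>i<n. if i = 1 then p i else 0)"
    by (rule sum.cong) auto
  moreover have "(\<Sum>i<n. if i = 1 then p i else 0) = p 1" using n by (simp add: sum.delta)
  ultimately have "\<forall>i<n. (if i = (1 :: nat) then 1 else 0 :: 'k) = 0"
    by (elim allE[of _ "\<lambda>i. if i = 1 then 1 else 0 :: 'k"]) simp
  then have "(if (1 :: nat) = 1 then 1 else 0 :: 'k) = 0" using n by (elim allE[of _ 1]) simp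
  then show False by simp
qed

text \<open>The premises on the \<open>y j\<close> force them into the Fitting radical, where the
  system is one of Fox vectors over \<open>R_r\<close>. A solution there would be carried back to
  \<open>F_n\<close> up to a denominator outside \<Delta>.\<close>

lemma Phi7_Fr:
  assumes r: "r \<ge> 2"
  shows "Phi7 r (Fr r :: ('k::field, 'k ltm set) liealg)"
  unfolding Phi7_def
proof (intro allI impI, elim conjE)
  fix n m l and f :: "nat \<Rightarrow> nat \<Rightarrow> 'k mpoly" and ct :: "nat \<Rightarrow> 'k ltm" and x y :: "nat \<Rightarrow> 'k ltm set"
  assume n: "n \<le> r" and f: "\<forall>i<m. \<forall>j<l. f i j \<in> Rn n"
    and ct: "\<forall>i<m. tvars (ct i) \<subseteq> {..<n} \<and> cls (ct i) \<in> derived (Fr n)"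
    and ns: "\<not> solvable_loc n m l f (\<lambda>i. cls (ct i))"
    and x: "in_car (Fr r) n x" and y: "in_car (Fr r) l y" and phi: "phi (Fr r) n x"
    and yx: "\<forall>j<l. \<forall>i<n. br (Fr r) (br (Fr r) (y j) (x i)) (y j) = zero (Fr r)"
  let ?c = "\<lambda>i. snd (dv (ct i))"
  let ?p = "\<lambda>i. fst (fcoord (x i))"
  have cW: "(0, ?c i) \<in> WI n" if "i < m" for i
    using ct that fcoord_WI[of "cls (ct i)" n] by (auto simp: derived_Fr_iff) (metis prod.collapse)
  have ns': "\<not> (\<exists>w s. (\<forall>j<l. (0, w j) \<in> WI n) \<and> s \<in> Rn n \<and> coeff s 0 \<noteq> 0 \<and>
     (\<forall>i<m. \<forall>k. (\<Sum>j<l. w j k * f i j) = ?c i k * s))"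
  proof
    assume "\<exists>w s. (\<forall>j<l. (0, w j) \<in> WI n) \<and> s \<in> Rn n \<and> coeff s 0 \<noteq> 0 \<and>
     (\<forall>i<m. \<forall>k. (\<Sum>j<l. w j k * f i j) = ?c i k * s)"
    then obtain w s where "\<forall>j<l. (0, w j) \<in> WI n" "s \<in> Rn n" "coeff s 0 \<noteq> 0"
      "\<forall>i<m. \<forall>k. (\<Sum>j<l. w j k * f i j) = ?c i k * s" by blast
    then have "solvable_loc n m l f (\<lambda>i. cls (ct i))"
      using f ct by (subst solvable_loc_iff) (blast, blast, (rule exI[of _ w], rule exI[of _ s], rule exI[of _ 1], simp))
    then show False using ns by blast
  qed
  \<comment> \<open>With at most one generator the derived algebra is zero, so all right-hand sides
    vanish and \<open>w = 0\<close> solves the system.\<close>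
  have n2: "n \<ge> 2"
  proof (rule ccontr)
    assume "\<not> n \<ge> 2"
    then have "?c i = (\<lambda>_. 0)" if "i < m" for i using WI_1_derived[OF _ cW[OF that]] by simp
    then have "\<exists>w s. (\<forall>j<l. (0, w j) \<in> WI n) \<and> s \<in> Rn n \<and> coeff s 0 \<noteq> 0 \<and>
       (\<forall>i<m. \<forall>k. (\<Sum>j<l. w j k * f i j) = ?c i k * s)"
      by (intro exI[of _ "\<lambda>_ _. 0"] exI[of _ 1]) (simp add: WI_def)
    with ns' show False by contradiction
  qed
  have xc: "x i \<in> carrier (Fr r)" if "i < n" for i using x that by (auto simp: in_car_def)
  have yc: "y j \<in> carrier (Fr r)" if "j < l" for j using y that by (auto simp: in_car_def)
  have y0: "fcoord (y j) = (0, snd (fcoord (y j)))" if "j < l" for j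
    using fst_zero_of_centralizing[OF r n2 x phi yc[OF that]] yx that by (simp add: prod_eq_iff)
  show "\<exists>i<m. add (Fr r) (lsum (Fr r) (map (\<lambda>j. act (Fr r) (y j) x (f i j)) [0..<l])) (neg (Fr r) (teval (Fr r) x (ct i))) \<noteq> zero (Fr r)"
  proof (rule ccontr)
    assume "\<not> ?thesis"
    then have h: "add (Fr r) (lsum (Fr r) (map (\<lambda>j. act (Fr r) (y j) x (f i j)) [0..<l])) (neg (Fr r) (teval (Fr r) x (ct i))) = zero (Fr r)"
      if "i < m" for i using that by blast
    have eq: "(\<Sum>j<l. snd (fcoord (y j)) k * subst ?p (f i j)) = (\<Sum>a<n. subst ?p (?c i a) * snd (fcoord (x a)) k)"
      if i: "i < m" for i k
    proof -
      let ?L = "lsum (Fr r) (map (\<lambda>j. act (Fr r) (y j) x (f i j)) [0..<l])"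
      have a: "act (Fr r) (y j) x (f i j) \<in> carrier (Fr r)"
        "fcoord (act (Fr r) (y j) x (f i j)) = (0, \<lambda>k. snd (fcoord (y j)) k * subst ?p (f i j))" if "j < l" for j
        using fcoord_act[where b = x and n = n, OF _ yc[OF that] y0[OF that] xc, of "f i j"] f i that by simp_all
      have L: "?L \<in> carrier (Fr r)" by (intro Fr.lsum_closed) (auto simp: a)
      have t: "tvars (ct i) \<subseteq> {..<n}" using ct i by blast
      note T = fcoord_teval[where x = x and r = r, OF t xc]
      have "?L = teval (Fr r) x (ct i)" using h[OF i] Fr.add_neg_eq_zero[OF L T(3)] by blast
      then have "snd (fcoord ?L) k = snd (fcoord (teval (Fr r) x (ct i))) k" by simp
      moreover have "snd (fcoord (teval (Fr r) x (ct i))) k = (\<Sum>a<n. subst ?p (?c i a) * snd (fcoord (x a)) k)"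
        by (rule T(2))
      ultimately show ?thesis using a by (simp add: fcoord_lsum)
    qed
    have zW: "(0, snd (fcoord (y j))) \<in> WI r" if "j < l" for j
      using fcoord_WI[OF yc[OF that]] y0[OF that] by simp
    have "\<exists>w s. (\<forall>j<l. (0, w j) \<in> WI n) \<and> s \<in> Rn n \<and> coeff s 0 \<noteq> 0 \<and>
       (\<forall>i<m. \<forall>k. (\<Sum>j<l. w j k * f i j) = ?c i k * s)"
      by (rule Phi7_core[OF r x phi _ zW cW eq]) (use f in auto)
    with ns' show False by contradiction
  qed
qed

section \<open>The universal closure\<close>

text \<open>If no assignment in \<open>F_r\<close> reproduced the pattern, the negated conjunction
  describing it would be a universal sentence true in \<open>F_r\<close>, hence in \<open>A\<close>,
  where \<open>g\<close> refutes it.\<close>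

lemma local_discrimination:
  assumes "in_ucl r A" "\<And>i. g i \<in> carrier A" "finite T"
  obtains g' where "\<And>i. g' i \<in> carrier (Fr r)"
    "\<And>t. t \<in> T \<Longrightarrow> teval A g t = zero A \<longleftrightarrow> teval (Fr r) g' t = zero (Fr r)"
proof (rule ccontr)
  note goal = that
  assume nt: "\<not> thesis"
  have no: "\<not> (\<forall>t\<in>T. teval A g t = zero A \<longleftrightarrow> teval (Fr r) h t = zero (Fr r))"
    if h: "\<And>i. h i \<in> carrier (Fr r)" for h
  proof
    assume a: "\<forall>t\<in>T. teval A g t = zero A \<longleftrightarrow> teval (Fr r) h t = zero (Fr r)"
    have thesis by (rule goal[OF h]) (rule a[rule_format])
    with nt show False by contradiction
  qed
  obtain ts where ts: "set ts = T" using finite_list[OF assms(3)] by blast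
  define F where "F ts = foldr (\<lambda>t p. Conj (if teval A g t = zero A then Eq t Z else Neg (Eq t Z)) p) ts (Eq Z Z)" for ts
  have F: "qsat B h (F ts) \<longleftrightarrow> (\<forall>t\<in>set ts. teval A g t = zero A \<longleftrightarrow> teval B h t = zero B)" for ts h and B :: "('a, 'c) liealg"
    by (induction ts) (auto simp: F_def)
  have "univ_holds (Fr r) (Neg (F ts))" unfolding univ_holds_def
  proof (intro allI impI)
    fix h :: "nat \<Rightarrow> 'a ltm set" assume "\<forall>i. h i \<in> carrier (Fr r)"
    then have "\<not> (\<forall>t\<in>T. teval A g t = zero A \<longleftrightarrow> teval (Fr r) h t = zero (Fr r))" by (intro no) blast
    then show "qsat (Fr r) h (Neg (F ts))" unfolding qsat.simps F ts .
  qed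
  then have "univ_holds A (Neg (F ts))" using assms(1) by (simp add: in_ucl_def)
  then have "\<not> qsat A g (F ts)" using assms(2) by (simp add: univ_holds_def)
  then show False by (simp add: F)
qed

lemma finite_tvars: "finite (tvars t)" by (induction t) auto

lemma phi_cong: "(\<And>i. i < n \<Longrightarrow> x i = y i) \<Longrightarrow> phi A n x = phi A n y"
proof -
  assume "\<And>i. i < n \<Longrightarrow> x i = y i"
  then have "map (\<lambda>i. sm A (\<alpha> i) (x i)) [0..<n] = map (\<lambda>i. sm A (\<alpha> i) (y i)) [0..<n]" for \<alpha> by (intro map_cong) auto
  then show ?thesis unfolding phi_def by (simp only:)
qed

text \<open>Witnesses for the negated \<open>Fit\<close> formulas in \<open>\<phi>\<close> are carried by fresh variables.\<close>
lemma phi_discrimination: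
  fixes A :: "('k::{field,finite}, 'a) liealg"
  assumes A: "in_ucl r A" and g: "\<And>i. g i \<in> carrier A" and phi: "phi A n g" and T: "finite T"
  obtains g' where "\<And>i. g' i \<in> carrier (Fr r)" "phi (Fr r) n g'"
    "\<And>t. t \<in> T \<Longrightarrow> teval A g t = zero A \<longleftrightarrow> teval (Fr r) g' t = zero (Fr r)"
proof -
  note goal = that
  interpret lie A using A by unfold_locales (simp add: in_ucl_def)
  have "finite ({..<n} \<union> (\<Union>t\<in>T. tvars t))" using T finite_tvars by blast
  then obtain N where "{..<n} \<union> (\<Union>t\<in>T. tvars t) \<subseteq> {..<N}" unfolding finite_nat_set_iff_bounded by blast
  then have N: "n \<le> N" "\<And>t. t \<in> T \<Longrightarrow> tvars t \<subseteq> {..<N}" by (auto simp: subset_iff not_less[symmetric]) 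
  \<comment> \<open>Extensional functions make the set finite: only the coefficients at indices
    below \<open>n\<close> are counted.\<close>
  define S where "S = {\<alpha> \<in> {..<n} \<rightarrow>\<^sub>E (UNIV :: 'k set). \<exists>i<n. \<alpha> i \<noteq> 0}"
  have "finite S" unfolding S_def by (intro finite_subset[OF _ finite_PiE[of "{..<n}" "\<lambda>_. UNIV"]]) auto
  then obtain as where as: "set as = S" using finite_list by blast
  have "\<exists>y. y \<in> carrier A \<and> br A (br A (lsum A (map (\<lambda>i. sm A (\<alpha> i) (g i)) [0..<n])) y) (lsum A (map (\<lambda>i. sm A (\<alpha> i) (g i)) [0..<n])) \<noteq> zero A"
    if "\<alpha> \<in> S" for \<alpha>
    using phi that unfolding phi_def FitEl_def S_def by blast
  then obtain Y where Y: "\<And>\<alpha>. \<alpha> \<in> S \<Longrightarrow> Y \<alpha> \<in> carrier A" "\<And>\<alpha>. \<alpha> \<in> S \<Longrightarrow>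
      br A (br A (lsum A (map (\<lambda>i. sm A (\<alpha> i) (g i)) [0..<n])) (Y \<alpha>)) (lsum A (map (\<lambda>i. sm A (\<alpha> i) (g i)) [0..<n])) \<noteq> zero A"
    by metis
  \<comment> \<open>Indices from \<open>N\<close> on occur in no term of \<open>T\<close>. Slot
    \<open>N + k\<close> holds an element showing that the combination with coefficients
    \<open>as ! k\<close> is not Fitting.\<close>
  define g2 where "g2 i = (if i < N then g i else if i < N + length as then Y (as ! (i - N)) else zero A)" for i
  have g2: "g2 i \<in> carrier A" for i using g Y(1) as by (auto simp: g2_def)
  define Lt where "Lt \<alpha> = lsum TT (map (\<lambda>i. Sc (\<alpha> i) (V i)) [0..<n])" for \<alpha> :: "nat \<Rightarrow> 'k"
  define W where "W k = Br (Br (Lt (as ! k)) (V (N + k))) (Lt (as ! k))" for k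
  have Lt: "teval B x (Lt \<alpha>) = lsum B (map (\<lambda>i. sm B (\<alpha> i) (x i)) [0..<n])"
    if "op_closed B" "\<And>i. x i \<in> carrier B" for x \<alpha> and B :: "('k, 'c) liealg"
    unfolding Lt_def using lsum_hom[OF lie_hom_teval[of B x] op_closed_TT] that by (simp add: o_def)
  have Lg: "map (\<lambda>i. sm A (\<alpha> i) (g2 i)) [0..<n] = map (\<lambda>i. sm A (\<alpha> i) (g i)) [0..<n]" for \<alpha>
    using N(1) by (intro map_cong) (auto simp: g2_def)
  have fin: "finite (T \<union> W ` {..<length as})" using T by simp
  obtain g' where g': "\<And>i. g' i \<in> carrier (Fr r)"
    "\<And>t. t \<in> T \<union> W ` {..<length as} \<Longrightarrow> teval A g2 t = zero A \<longleftrightarrow> teval (Fr r) g' t = zero (Fr r)"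
    by (rule local_discrimination[where g = g2, OF A g2 fin]) (rule that)
  have "phi (Fr r) n g'"
    unfolding phi_def
  proof (intro allI impI)
    fix \<alpha> :: "nat \<Rightarrow> 'k" assume \<alpha>: "\<exists>i<n. \<alpha> i \<noteq> 0"
    have "restrict \<alpha> {..<n} \<in> set as" unfolding as S_def using \<alpha> by auto
    then obtain k where k: "k < length as" "as ! k = restrict \<alpha> {..<n}" by (auto simp: in_set_conv_nth)
    then have kS: "as ! k \<in> S" using as nth_mem by blast
    have "teval A g2 (W k) \<noteq> zero A"
      using Y(2)[OF kS] k(1) by (simp add: W_def Lt[OF op_closed g2] Lg) (simp add: g2_def)
    then have nz: "teval (Fr r) g' (W k) \<noteq> zero (Fr r)" using g'(2)[of "W k"] k(1) by blast
    have "map (\<lambda>i. sm (Fr r) ((as ! k) i) (g' i)) [0..<n] = map (\<lambda>i. sm (Fr r) (\<alpha> i) (g' i)) [0..<n]"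
      unfolding k by (intro map_cong) auto
    moreover have "teval (Fr r) g' (Lt (as ! k)) = lsum (Fr r) (map (\<lambda>i. sm (Fr r) ((as ! k) i) (g' i)) [0..<n])"
      by (rule Lt[OF op_closed_Fr g'(1)])
    ultimately have Lr: "teval (Fr r) g' (Lt (as ! k)) = lsum (Fr r) (map (\<lambda>i. sm (Fr r) (\<alpha> i) (g' i)) [0..<n])"
      by (simp only:)
    show "\<not> FitEl (Fr r) (lsum (Fr r) (map (\<lambda>i. sm (Fr r) (\<alpha> i) (g' i)) [0..<n]))"
      unfolding FitEl_def Lr[symmetric] using nz g'(1)[of "N + k"] unfolding W_def teval.simps by blast
  qed
  moreover have "teval A g t = zero A \<longleftrightarrow> teval (Fr r) g' t = zero (Fr r)" if t: "t \<in> T" for t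
  proof -
    have "teval A g t = teval A g2 t" using N(2)[OF t] by (intro teval_cong) (auto simp: g2_def)
    then show ?thesis using g'(2)[of t] t by simp
  qed
  ultimately show thesis by (intro goal[of g'] g'(1))
qed

lemma mono_act_cong: "(\<And>i. i \<in> Poly_Mapping.keys m \<Longrightarrow> b i = b' i) \<Longrightarrow> mono_act A u b m N = mono_act A u b' m N"
proof (induction N)
  case (Suc N)
  then show ?case by (cases "Poly_Mapping.lookup m N = 0") (auto simp: in_keys_iff)
qed simp

lemma act_cong: "f \<in> Rn n \<Longrightarrow> (\<And>i. i < n \<Longrightarrow> b i = b' i) \<Longrightarrow> act A u b f = act A u b' f"
proof -
  assume a: "f \<in> Rn n" "\<And>i. i < n \<Longrightarrow> b i = b' i"
  have "mono_act A u b m N = mono_act A u b' m N" if "m \<in> Poly_Mapping.keys f" for m N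
    using that a by (intro mono_act_cong) (auto simp: Rn_iff)
  then show ?thesis unfolding act_def by (intro arg_cong[where f = "lsum A"] map_cong) (auto simp del: mono_act.simps)
qed

lemma teval_act:
  assumes "op_closed A" "\<And>i. g i \<in> carrier A"
  shows "teval A g (act TT t V f) = act A (teval A g t) g f"
  using act_hom(1)[OF lie_hom_teval[of A g] op_closed_TT, of t f V] assms by simp

text \<open>For each axiom after the first, offending values in \<open>A\<close> are described by
  finitely many vanishing or nonvanishing terms, and an assignment in \<open>F_r\<close> with the
  same pattern contradicts the axiom there. Polynomial actions become terms by computing them in
  \<open>TT\<close>.\<close>

lemma ucl_imp_phi_alg:
  fixes A :: "('k::{field,finite}, 'a) liealg"
  assumes r: "r \<ge> 2" and A: "in_ucl r A" and met: "metabelian A"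
  shows "phi_alg r A"
proof -
  interpret lie A using A by unfold_locales (simp add: in_ucl_def)
  have 2: "Phi2 A" unfolding Phi2_def
  proof (intro ballI impI)
    fix x y assume xy: "x \<in> carrier A" "y \<in> carrier A"
      and h: "br A (br A x y) x = zero A \<and> br A (br A x y) y = zero A"
    let ?g = "\<lambda>i :: nat. if i = 0 then x else y"
    have g: "?g i \<in> carrier A" for i using xy by simp
    let ?T = "{Br (Br (V 0) (V 1)) (V 0), Br (Br (V 0) (V 1)) (V 1), Br (V 0) (V 1)}"
    have fin: "finite ?T" by simp
    obtain g' where g': "\<And>i. g' i \<in> carrier (Fr r)"
      "\<And>t. t \<in> ?T \<Longrightarrow> teval A ?g t = zero A \<longleftrightarrow> teval (Fr r) g' t = zero (Fr r)"
      by (rule local_discrimination[where g = ?g, OF A g fin]) (rule that)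
    have "br (Fr r) (g' 0) (g' 1) = zero (Fr r)"
      using bspec[OF bspec[OF Phi2_Fr[unfolded Phi2_def] g'(1)[of 0]] g'(1)[of 1]]
        g'(2)[of "Br (Br (V 0) (V 1)) (V 0)"] g'(2)[of "Br (Br (V 0) (V 1)) (V 1)"] h by simp
    then show "br A x y = zero A" using g'(2)[of "Br (V 0) (V 1)"] by simp
  qed
  have 3: "Phi3 A" unfolding Phi3_def
  proof (intro ballI impI)
    fix x y z assume xyz: "x \<in> carrier A" "y \<in> carrier A" "z \<in> carrier A"
      and h: "x \<noteq> zero A \<and> br A x y = zero A \<and> br A x z = zero A"
    let ?T = "{V 0, Br (V 0) (V 1), Br (V 0) (V 2), Br (V 1) (V 2)}"
    have fin: "finite ?T" by simp
    let ?g = "\<lambda>i :: nat. if i = 0 then x else if i = 1 then y else z"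
    have g: "?g i \<in> carrier A" for i using xyz by simp
    obtain g' where g': "\<And>i. g' i \<in> carrier (Fr r)"
      "\<And>t. t \<in> ?T \<Longrightarrow> teval A ?g t = zero A \<longleftrightarrow> teval (Fr r) g' t = zero (Fr r)"
      by (rule local_discrimination[where g = ?g, OF A g fin]) (rule that)
    have "br (Fr r) (g' 1) (g' 2) = zero (Fr r)"
      using bspec[OF bspec[OF bspec[OF Phi3_Fr[unfolded Phi3_def] g'(1)[of 0]] g'(1)[of 1]] g'(1)[of 2]]
        g'(2)[of "V 0"] g'(2)[of "Br (V 0) (V 1)"] g'(2)[of "Br (V 0) (V 2)"] h by simp
    then show "br A y z = zero A" using g'(2)[of "Br (V 1) (V 2)"] by simp
  qed
  have 4: "Phi4 r A" unfolding Phi4_def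
  proof (intro allI impI notI)
    fix x assume x: "in_car A (Suc r) x" "phi A (Suc r) x"
    let ?g = "\<lambda>i. if i < Suc r then x i else zero A"
    have g: "?g i \<in> carrier A" for i using x(1) by (simp add: in_car_def)
    have phi: "phi A (Suc r) ?g" using x(2) phi_cong[of "Suc r" ?g x A] by simp
    obtain g' where "\<And>i. g' i \<in> carrier (Fr r)" "phi (Fr r) (Suc r) g'"
      "\<And>t. t \<in> {} \<Longrightarrow> teval A ?g t = zero A \<longleftrightarrow> teval (Fr r) g' t = zero (Fr r)"
      by (rule phi_discrimination[where g = ?g, OF A g phi finite.emptyI]) (rule that)
    then show False using Phi4_Fr[OF r] unfolding Phi4_def in_car_def by blast
  qed
  have 5: "Phi5 r A" unfolding Phi5_def
  proof (intro allI ballI impI notI)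
    fix n f z1 z2 x assume n: "n \<le> r" and f: "f \<in> Rn n" "f \<noteq> 0" and z: "z1 \<in> carrier A" "z2 \<in> carrier A"
      and x: "in_car A n x" and h: "act A (br A z1 z2) x f = zero A \<and> br A z1 z2 \<noteq> zero A" and phi: "phi A n x"
    let ?g = "\<lambda>i. if i < n then x i else if i = n then z1 else z2"
    let ?u = "Br (V n) (V (Suc n))"
    let ?T = "{act TT ?u V f, ?u}"
    have fin: "finite ?T" by simp
    have g: "?g i \<in> carrier A" for i using x z by (auto simp: in_car_def)
    have phi': "phi A n ?g" using phi phi_cong[of n ?g x A] by simp
    obtain g' where g': "\<And>i. g' i \<in> carrier (Fr r)" "phi (Fr r) n g'"
      "\<And>t. t \<in> ?T \<Longrightarrow> teval A ?g t = zero A \<longleftrightarrow> teval (Fr r) g' t = zero (Fr r)"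
      by (rule phi_discrimination[where g = ?g, OF A g phi' fin]) (rule that)
    have "act A (br A z1 z2) ?g f = act A (br A z1 z2) x f" by (rule act_cong[OF f(1)]) simp
    then have "teval A ?g (act TT ?u V f) = zero A" unfolding teval_act[OF op_closed g] using h by simp
    then have "act (Fr r) (br (Fr r) (g' n) (g' (Suc n))) g' f = zero (Fr r)"
      using g'(3)[of "act TT ?u V f"] unfolding teval_act[OF op_closed_Fr g'(1)] by simp
    moreover have "br (Fr r) (g' n) (g' (Suc n)) \<noteq> zero (Fr r)" using g'(3)[of ?u] h by simp
    ultimately show False using Phi5_Fr[OF r, where ?'a = 'k] n f g'(1,2) unfolding Phi5_def in_car_def by blast
  qed
  have 6: "Phi6 r A" unfolding Phi6_def
  proof (intro allI impI notI)
    fix n l x assume n: "n \<le> r" and l: "tvars l \<subseteq> {..<n} \<and> cls l \<noteq> zero (Fr n :: ('k, 'k ltm set) liealg)"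
      and x: "in_car A n x" and phi: "phi A n x" and z: "teval A x l = zero A"
    let ?g = "\<lambda>i. if i < n then x i else zero A"
    have g: "?g i \<in> carrier A" for i using x by (auto simp: in_car_def)
    have fin: "finite {l}" by simp
    have phi': "phi A n ?g" using phi phi_cong[of n ?g x A] by simp
    obtain g' where g': "\<And>i. g' i \<in> carrier (Fr r)" "phi (Fr r) n g'"
      "\<And>t. t \<in> {l} \<Longrightarrow> teval A ?g t = zero A \<longleftrightarrow> teval (Fr r) g' t = zero (Fr r)"
      by (rule phi_discrimination[where g = ?g, OF A g phi' fin]) (rule that)
    have "teval A ?g l = teval A x l" using l by (intro teval_cong) auto
    then have "teval (Fr r) g' l = zero (Fr r)" using g'(3)[of l] z by simp
    then show False using Phi6_Fr[OF r, where ?'k = 'k] n l g'(1,2) unfolding Phi6_def in_car_def by blast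
  qed
  have 7: "Phi7 r A" unfolding Phi7_def
  proof (intro allI impI, elim conjE)
    fix n m l and f :: "nat \<Rightarrow> nat \<Rightarrow> 'k mpoly" and ct :: "nat \<Rightarrow> 'k ltm" and x y
    assume n: "n \<le> r" and f: "\<forall>i<m. \<forall>j<l. f i j \<in> Rn n"
      and ct: "\<forall>i<m. tvars (ct i) \<subseteq> {..<n} \<and> cls (ct i) \<in> derived (Fr n)"
      and ns: "\<not> solvable_loc n m l f (\<lambda>i. cls (ct i))"
      and x: "in_car A n x" and y: "in_car A l y" and phi: "phi A n x"
      and yx: "\<forall>j<l. \<forall>i<n. br A (br A (y j) (x i)) (y j) = zero A"
    show "\<exists>i<m. add A (lsum A (map (\<lambda>j. act A (y j) x (f i j)) [0..<l])) (neg A (teval A x (ct i))) \<noteq> zero A"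
    proof (rule ccontr)
      assume "\<not> ?thesis"
      then have h: "add A (lsum A (map (\<lambda>j. act A (y j) x (f i j)) [0..<l])) (neg A (teval A x (ct i))) = zero A"
        if "i < m" for i using that by blast
      let ?g = "\<lambda>i. if i < n then x i else if i < n + l then y (i - n) else zero A"
      have g: "?g i \<in> carrier A" for i using x y by (auto simp: in_car_def)
      \<comment> \<open>Variables below \<open>n\<close> stand for the \<open>x i\<close>, the next
        \<open>l\<close> for the \<open>y j\<close>.\<close>
      define E where "E i = Pl (lsum TT (map (\<lambda>j. act TT (V (n + j)) V (f i j)) [0..<l])) (Ng (ct i))" for i
      define C where "C = (\<lambda>(i, j). Br (Br (V (n + j)) (V i)) (V (n + j) :: 'k ltm))"
      let ?T = "E ` {..<m} \<union> C ` ({..<n} \<times> {..<l})"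
      have fin: "finite ?T" by simp
      have phi': "phi A n ?g" using phi phi_cong[of n ?g x A] by simp
      obtain g' where g': "\<And>i. g' i \<in> carrier (Fr r)" "phi (Fr r) n g'"
        "\<And>t. t \<in> ?T \<Longrightarrow> teval A ?g t = zero A \<longleftrightarrow> teval (Fr r) g' t = zero (Fr r)"
        by (rule phi_discrimination[where g = ?g, OF A g phi' fin]) (rule that)
      have tE: "teval B k (E i) = add B (lsum B (map (\<lambda>j. act B (k (n + j)) k (f i j)) [0..<l])) (neg B (teval B k (ct i)))"
        if "op_closed B" "\<And>i. k i \<in> carrier B" for i k and B :: "('k, 'c) liealg"
        unfolding E_def using lsum_hom[OF lie_hom_teval[of B k] op_closed_TT] that by (simp add: o_def teval_act)
      have "teval A ?g (E i) = zero A" if i: "i < m" for i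
      proof -
        have "act A (y j) ?g (f i j) = act A (y j) x (f i j)" if "j < l" for j
          by (rule act_cong[of _ n]) (use f i that in auto)
        then have "map (\<lambda>j. act A (?g (n + j)) ?g (f i j)) [0..<l] = map (\<lambda>j. act A (y j) x (f i j)) [0..<l]"
          by (intro map_cong) auto
        moreover have "teval A ?g (ct i) = teval A x (ct i)"
        proof (rule teval_cong)
          fix a assume "a \<in> tvars (ct i)"
          then have "a < n" using ct i by blast
          then show "?g a = x a" by simp
        qed
        ultimately show ?thesis using h[OF i] by (simp only: tE[OF op_closed g])
      qed
      then have "teval (Fr r) g' (E i) = zero (Fr r)" if "i < m" for i using g'(3)[of "E i"] that by blast
      note e = this[unfolded tE[OF op_closed_Fr g'(1)]]
      have "br (Fr r) (br (Fr r) (g' (n + j)) (g' i)) (g' (n + j)) = zero (Fr r)" if "j < l" "i < n" for i j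
      proof -
        have "C (i, j) \<in> ?T" using that by blast
        moreover have "teval A ?g (C (i, j)) = zero A" using yx that by (simp add: C_def)
        ultimately have "teval (Fr r) g' (C (i, j)) = zero (Fr r)" using g'(3) by blast
        then show ?thesis by (simp add: C_def)
      qed
      note c = this
      have P: "(\<exists>i<m. add (Fr r) (lsum (Fr r) (map (\<lambda>j. act (Fr r) (g' (n + j)) g' (f i j)) [0..<l])) (neg (Fr r) (teval (Fr r) g' (ct i)))
               \<noteq> zero (Fr r))"
        by (rule Phi7_Fr[OF r, unfolded Phi7_def, rule_format, OF n, of m l f ct g' "\<lambda>j. g' (n + j)"])
           (use f ct ns g'(1,2) c in \<open>auto simp: in_car_def simp del: Fr_simps\<close>)
      then show False using e by blast
    qed
  qed
  show ?thesis unfolding phi_alg_def Phi1_def using lie_alg met 2 3 4 5 6 7 by blast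
qed

section \<open>Discrimination of \<open>F_{r,s}\<close> by \<open>F_r\<close>\<close>

lemma carrier_Frs: "(c, f) \<in> carrier (Frs r s) \<longleftrightarrow> c \<in> carrier (Fr r) \<and> (\<forall>j. f j \<in> Rn r) \<and> (\<forall>j\<ge>s. f j = 0)"
proof -
  have "(\<forall>j<s. f j \<in> Rn r) \<and> (\<forall>j\<ge>s. f j = 0) \<longleftrightarrow> (\<forall>j. f j \<in> Rn r) \<and> (\<forall>j\<ge>s. f j = 0)"
    by (metis Rn_0 not_le)
  then show ?thesis by (simp add: Frs_def)
qed

lemma Frs_simps [simp]:
  "zero (Frs r s) = (cls Z, \<lambda>_. 0)" "add (Frs r s) (c, f) (c', f') = (add (Fr r) c c', \<lambda>j. f j + f' j)"
  "neg (Frs r s) (c, f) = (neg (Fr r) c, \<lambda>j. - f j)"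
  "br (Frs r s) (c, f) (c', f') = (br (Fr r) c c', \<lambda>j. f j * linpoly r c' - f' j * linpoly r c)"
  "sm (Frs r s) a (c, f) = (sm (Fr r) a c, \<lambda>j. const a * f j)"
  by (simp_all add: Frs_def)

lemma linpoly_Rn: "c \<in> carrier (Fr r) \<Longrightarrow> linpoly r c \<in> Rn r"
  using Lin_Rn[OF fcoord_Lin] by (simp add: linpoly_eq)

lemma op_closed_Frs: "op_closed (Frs r s)"
  unfolding op_closed_def by (auto simp: carrier_Frs linpoly_Rn simp del: Fr_simps intro: cls_in_Fr)

lemma Frs_add_neg:
  assumes "x \<in> carrier (Frs r s)" "y \<in> carrier (Frs r s)"
  shows "add (Frs r s) x (neg (Frs r s) y) = zero (Frs r s) \<longleftrightarrow> x = y"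
  using assms by (cases x; cases y) (auto simp: carrier_Frs Fr.add_neg_eq_zero[simplified] fun_eq_iff)

fun qterms :: "'k qfm \<Rightarrow> 'k ltm set" where
  "qterms (Eq s t) = {s, t}"
| "qterms (Neg p) = qterms p"
| "qterms (Conj p q) = qterms p \<union> qterms q"
| "qterms (Disj p q) = qterms p \<union> qterms q"

lemma finite_qterms: "finite (qterms p)" by (induction p) auto

text \<open>Truth depends only on which values of the terms of \<open>p\<close> coincide, so
  injectivity on this finite set of values is enough. Hence discrimination can take the place of an
  embedding into \<open>F_r\<close>.\<close>

lemma qsat_inj:
  assumes "lie_hom A B h" "op_closed A" "\<And>i. g i \<in> carrier A" "inj_on h (teval A g ` qterms p)"
  shows "qsat B (\<lambda>i. h (g i)) p \<longleftrightarrow> qsat A g p"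
  using assms(4)
proof (induction p)
  case (Eq s t)
  have e: "teval B (\<lambda>i. h (g i)) s = h (teval A g s)" for s by (rule teval_hom[OF assms(1-2), symmetric]) (rule assms(3))
  have "h (teval A g s) = h (teval A g t) \<longleftrightarrow> teval A g s = teval A g t"
    using Eq by (intro inj_on_eq_iff[of h "teval A g ` qterms (Eq s t)"]) simp_all
  then show ?case by (simp only: qsat.simps e)
qed (auto simp: inj_on_Un image_Un)

text \<open>The Fox vector of \<open>(a_2 a_1)\<close> acted on by \<open>F\<close>; the two
  generators have indices 1 and 0 here.\<close>

definition comvec :: "'k::field mpoly \<Rightarrow> nat \<Rightarrow> 'k mpoly" where
  "comvec F k = (if k = 1 then F * xvar 0 else if k = 0 then - (F * xvar 1) else 0)"

lemma comvec_WI: "r \<ge> 2 \<Longrightarrow> F \<in> Rn r \<Longrightarrow> (0, comvec F) \<in> WI r"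
proof -
  assume r: "r \<ge> 2" and F: "F \<in> Rn r"
  have "(\<Sum>j<r. comvec F j * xvar j) = (\<Sum>j\<in>{0, 1}. comvec F j * xvar j)"
    using r by (intro sum.mono_neutral_right) (auto simp: comvec_def)
  also have "\<dots> = 0" by (simp add: comvec_def algebra_simps)
  finally show ?thesis using r F by (auto simp: WI_def comvec_def)
qed
lemma comvec_linear: "comvec (F + G) k = comvec F k + comvec G k" "comvec (- F) k = - comvec F k"
   "comvec (F * h) k = comvec F k * h" "comvec (F - G) k = comvec F k - comvec G k"
  by (auto simp: comvec_def algebra_simps)

text \<open>\<open>R^s\<close> is sent into \<open>F_r^2\<close> by \<open>e_j \<mapsto> a_2 a_1 g_j\<close>, the \<open>g_j\<close> avoiding finitely many relations.\<close>
lemma Frs_discriminated: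
  fixes E :: "('k::field ltm set \<times> (nat \<Rightarrow> 'k mpoly)) set"
  assumes r: "r \<ge> 2" and E: "finite E" "E \<subseteq> carrier (Frs r s)"
  shows "\<exists>h. lie_hom (Frs r s) (Fr r) h \<and> inj_on h E"
proof -
  \<comment> \<open>For images under the map sought, the Fox components at index 1 differ by an
    affine expression in \<open>g\<close>, the factor \<open>xvar 0\<close> coming from
    \<open>comvec\<close>. These are the expressions that must not vanish; when all their
    coefficients are zero, the module parts agree and injectivity of the coordinates settles the
    rest.\<close>
  let ?E = "(\<lambda>(x, y). (snd (fcoord (fst x)) 1 - snd (fcoord (fst y)) 1, \<lambda>j. (snd x j - snd y j) * xvar 0)) ` (E \<times> E)"
  have fin: "finite ?E" using E(1) by auto
  have r0: "0 < r" using r by simp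
  from avoid_finite_vectors[OF fin r0, of s] obtain g where g: "\<forall>j. g j \<in> Rn r"
    "\<forall>(a, f)\<in>?E. a \<noteq> 0 \<or> (\<exists>j<s. f j \<noteq> 0) \<longrightarrow> a + (\<Sum>j<s. f j * g j) \<noteq> 0"
    by (elim exE conjE)
  define G where "G f = (\<Sum>j<s. f j * g j)" for f :: "nat \<Rightarrow> 'k mpoly"
  have GR: "G f \<in> Rn r" if "\<forall>j. f j \<in> Rn r" for f using that g(1) by (auto simp: G_def intro!: Rn_sum Rn_mult)
  have Glin: "G (\<lambda>j. f j + f' j) = G f + G f'" "G (\<lambda>j. - f j) = - G f" "G (\<lambda>j. const a * f j) = G f * const a"
    "G (\<lambda>j. f j * p - f' j * q) = G f * p - G f' * q" "G (\<lambda>_. 0) = 0" for f f' a p q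
    by (simp_all add: G_def sum.distrib sum_negf sum_subtractf sum_distrib_left sum_distrib_right algebra_simps)
  define k where "k f = felem r (0, comvec (G f))" for f
  have k: "k f \<in> carrier (Fr r)" "fcoord (k f) = (0, comvec (G f))" if "\<forall>j. f j \<in> Rn r" for f
    unfolding k_def using felem[OF comvec_WI[OF r GR[OF that]]] by auto
  define h where "h = (\<lambda>(c, f). add (Fr r) c (k f))"
  have hc: "h (c, f) \<in> carrier (Fr r)" and hf: "fst (fcoord (h (c, f))) = fst (fcoord c)"
    "\<And>i. snd (fcoord (h (c, f))) i = snd (fcoord c) i + comvec (G f) i"
    if "(c, f) \<in> carrier (Frs r s)" for c f
    using that k by (auto simp: h_def carrier_Frs fst_WW snd_WW)
  have eq: "x = y" if "x \<in> carrier (Fr r)" "y \<in> carrier (Fr r)" "fst (fcoord x) = fst (fcoord y)"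
    "\<And>i. snd (fcoord x) i = snd (fcoord y) i" for x y
    by (rule fcoord_inj[OF that(1,2)]) (use that in \<open>simp add: prod_eq_iff fun_eq_iff\<close>)
  have "lie_hom (Frs r s) (Fr r) h"
    unfolding lie_hom_def
  proof (intro conjI ballI allI)
    have z: "(cls Z, \<lambda>_. 0 :: 'k mpoly) \<in> carrier (Frs r s)" by (simp add: carrier_Frs cls_in_Fr)
    show "h (zero (Frs r s)) = zero (Fr r)"
      by (rule eq) (use z hc hf in \<open>auto simp: Glin comvec_def intro: cls_in_Fr\<close>)
    fix x :: "'k ltm set \<times> (nat \<Rightarrow> 'k mpoly)" assume x: "x \<in> carrier (Frs r s)"
    obtain c f where xc: "x = (c, f)" by (cases x)
    note x' = x[unfolded xc]
    have c: "c \<in> carrier (Fr r)" using x' by (simp add: carrier_Frs)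
    show "h x \<in> carrier (Fr r)" unfolding xc by (rule hc[OF x'])
    have nx: "neg (Frs r s) x \<in> carrier (Frs r s)" by (rule op_closedD(2)[OF op_closed_Frs x])
    show "h (neg (Frs r s) x) = neg (Fr r) (h x)"
      by (rule eq) (use nx hc[OF x'] hc hf[OF x'] hf c in \<open>auto simp: xc Glin comvec_linear fst_WW snd_WW\<close>)
    fix a :: 'k
    have sx: "sm (Frs r s) a x \<in> carrier (Frs r s)" by (rule op_closedD(3)[OF op_closed_Frs x])
    show "h (sm (Frs r s) a x) = sm (Fr r) a (h x)"
      by (rule eq) (use sx hc[OF x'] hc hf[OF x'] hf c in \<open>(auto simp: xc Glin comvec_linear fst_WW snd_WW, (simp_all add: algebra_simps)?)\<close>)
  next
    fix x y :: "'k ltm set \<times> (nat \<Rightarrow> 'k mpoly)" assume x: "x \<in> carrier (Frs r s)" and y: "y \<in> carrier (Frs r s)"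
    obtain c f c' f' where xc: "x = (c, f)" "y = (c', f')" by (cases x, cases y)
    note x' = x[unfolded xc] and y' = y[unfolded xc]
    have c: "c \<in> carrier (Fr r)" "c' \<in> carrier (Fr r)" using x' y' by (simp_all add: carrier_Frs)
    have a: "add (Frs r s) x y \<in> carrier (Frs r s)" "br (Frs r s) x y \<in> carrier (Frs r s)"
      using op_closedD[OF op_closed_Frs] x y by blast+
    show "h (add (Frs r s) x y) = add (Fr r) (h x) (h y)"
      by (rule eq) (use a hc[OF x'] hc[OF y'] hc hf[OF x'] hf[OF y'] hf c in \<open>(auto simp: xc Glin comvec_linear fst_WW snd_WW, (simp_all add: algebra_simps)?)\<close>)
    show "h (br (Frs r s) x y) = br (Fr r) (h x) (h y)"
      by (rule eq) (use a hc[OF x'] hc[OF y'] hc hf[OF x'] hf[OF y'] hf c in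
        \<open>(auto simp: xc Glin comvec_linear fst_WW snd_WW linpoly_eq, (simp_all add: algebra_simps)?)\<close>)
  qed
  moreover have "inj_on h E"
  proof (rule inj_onI)
    fix x y assume xy: "x \<in> E" "y \<in> E" "h x = h y"
    obtain c f c' f' where xc: "x = (c, f)" "y = (c', f')" by (cases x, cases y)
    have x': "(c, f) \<in> carrier (Frs r s)" "(c', f') \<in> carrier (Frs r s)" using xy E(2) unfolding xc by blast+
    have c: "c \<in> carrier (Fr r)" "c' \<in> carrier (Fr r)" "\<forall>j\<ge>s. f j = 0" "\<forall>j\<ge>s. f' j = 0"
      using x' by (simp_all add: carrier_Frs)
    have e: "snd (fcoord c) i + comvec (G f) i = snd (fcoord c') i + comvec (G f') i" "fst (fcoord c) = fst (fcoord c')" for i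
      using hf[OF x'(1)] hf[OF x'(2)] xy(3) by (simp_all add: xc)
    let ?a = "snd (fcoord c) 1 - snd (fcoord c') 1" and ?f = "\<lambda>j. (f j - f' j) * xvar 0"
    have "(\<Sum>j<s. ?f j * g j) = (G f - G f') * xvar 0"
      unfolding G_def sum_subtractf[symmetric] sum_distrib_right by (rule sum.cong) (auto simp: algebra_simps)
    then have "?a + (\<Sum>j<s. ?f j * g j) = ?a + (G f - G f') * xvar 0" by (simp only:)
    also have "\<dots> = 0" using e(1)[of 1] by (simp add: comvec_def algebra_simps)
    finally have "?a + (\<Sum>j<s. ?f j * g j) = 0" .
    moreover have "(?a, ?f) \<in> ?E" using xy(1,2) unfolding xc by force
    ultimately have "\<forall>j<s. ?f j = 0" using bspec[OF g(2), of "(?a, ?f)"] by auto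
    then have "f j = f' j" for j using c(3,4) by (cases "j < s") auto
    then have f: "f = f'" by auto
    then have "c = c'" using e c by (intro eq) auto
    then show "x = y" using f xc by simp
  qed
  ultimately show ?thesis by blast
qed

text \<open>Given an assignment in \<open>A\<close>, a homomorphism to \<open>F_r\<close> that
  separates the finitely many term values of \<open>p\<close> exists, and it reflects the truth of
  \<open>p\<close>. It may depend on the assignment.\<close>

lemma embeds_imp_ucl:
  fixes A :: "('k::field, 'a) liealg"
  assumes r: "r \<ge> 2" and A: "lie_alg A" and emb: "embeds A (Frs r s :: ('k, 'k ltm set \<times> (nat \<Rightarrow> 'k mpoly)) liealg)"
  shows "in_ucl r A"
proof -
  interpret lie A by unfold_locales (rule A)
  obtain h where h: "lie_hom A (Frs r s :: ('k, 'k ltm set \<times> (nat \<Rightarrow> 'k mpoly)) liealg) h" "inj_on h (carrier A)"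
    using emb unfolding embeds_def by blast
  have "univ_holds A p" if p: "univ_holds (Fr r) p" for p unfolding univ_holds_def
  proof (intro allI impI)
    fix g :: "nat \<Rightarrow> 'a" assume "\<forall>i. g i \<in> carrier A"
    then have g: "g i \<in> carrier A" for i by blast
    have tc: "teval A g t \<in> carrier A" for t by (rule teval_closed[OF op_closed g])
    let ?E = "h ` teval A g ` qterms p"
    have "finite ?E" by (simp add: finite_qterms)
    moreover have "?E \<subseteq> carrier (Frs r s)" using tc lie_homD(2)[OF h(1)] by auto
    ultimately obtain k where k: "lie_hom (Frs r s) (Fr r) k" "inj_on k ?E" using Frs_discriminated[OF r] by blast
    have inj: "inj_on (\<lambda>x. k (h x)) (teval A g ` qterms p)"
      using comp_inj_on[OF inj_on_subset[OF h(2)] k(2)] tc by (auto simp: o_def)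
    have hom: "lie_hom A (Fr r) (\<lambda>x. k (h x))" by (rule lie_hom_comp[OF h(1) k(1)])
    have gg: "\<forall>i. k (h (g i)) \<in> carrier (Fr r)" using lie_homD(2)[OF hom g] by simp
    have "qsat (Fr r) (\<lambda>i. k (h (g i))) p" by (rule p[unfolded univ_holds_def, THEN spec, THEN mp, OF gg])
    then show "qsat A g p" by (rule qsat_inj[where g = g, OF hom op_closed g inj, THEN iffD1])
  qed
  then show ?thesis using A by (simp add: in_ucl_def)
qed

section \<open>Embedding finitely generated algebras\<close>

text \<open>\<open>S\<close> plays the role of the relations between the \<open>u_j\<close> modulo
  \<open>F_n^2\<close>. Maximality of \<open>J\<close> yields for each further \<open>j\<close> a
  relation supported on \<open>J\<close> and \<open>j\<close> with nonzero coefficient at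
  \<open>j\<close>, so \<open>u_j\<close> depends on the chosen ones up to a denominator.\<close>

lemma module_relations:
  fixes S :: "(nat \<Rightarrow> 'k::field mpoly) set"
  assumes S0: "(\<lambda>_. 0) \<in> S" and SR: "\<And>g j. g \<in> S \<Longrightarrow> g j \<in> Rn n"
    and Sm: "\<And>g h. g \<in> S \<Longrightarrow> h \<in> Rn n \<Longrightarrow> (\<lambda>j. g j * h) \<in> S"
  obtains J d \<tau> where "J \<subseteq> {..<q}" "d \<in> Rn n" "d \<noteq> 0"
    "\<And>g. g \<in> S \<Longrightarrow> (\<And>j. j \<notin> J \<Longrightarrow> g j = 0) \<Longrightarrow> g = (\<lambda>_. 0)"
    "\<And>j i. \<tau> j i \<in> Rn n" "\<And>j i. j < q \<Longrightarrow> i \<notin> J \<Longrightarrow> \<tau> j i = 0"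
    "\<And>j. j < q \<Longrightarrow> (\<lambda>i. (if i = j then d else 0) - \<tau> j i) \<in> S"
proof -
  define I where "I J \<longleftrightarrow> J \<subseteq> {..<q} \<and> (\<forall>g\<in>S. (\<forall>j. j \<notin> J \<longrightarrow> g j = 0) \<longrightarrow> g = (\<lambda>_. 0))" for J
  have "I {}" by (auto simp: I_def)
  moreover have "\<forall>J. I J \<longrightarrow> card J < Suc q" using card_mono[of "{..<q}"] by (auto simp: I_def less_Suc_eq_le)
  ultimately obtain J where J: "I J" "\<And>K. I K \<Longrightarrow> card K \<le> card J"
    using ex_has_greatest_nat[of I "{}" card "Suc q"] by blast
  have Jq: "J \<subseteq> {..<q}" "finite J" using J(1) finite_subset[of J] by (auto simp: I_def)
  have one: "\<exists>d \<tau>. d \<in> Rn n \<and> d \<noteq> 0 \<and> (\<forall>i. \<tau> i \<in> Rn n) \<and> (\<forall>i. i \<notin> J \<longrightarrow> \<tau> i = 0) \<and>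
      (\<lambda>i. (if i = j then d else 0) - \<tau> i) \<in> S" if j: "j < q" for j
  proof (cases "j \<in> J")
    case True
    \<comment> \<open>For \<open>j\<close> in \<open>J\<close> the trivial relation
      \<open>u_j = u_j\<close> serves, written as the zero vector.\<close>
    have "(\<lambda>i. (if i = j then 1 else 0) - (if i = j then 1 else 0 :: 'k mpoly)) \<in> S" using S0 by simp
    then show ?thesis using True by (intro exI[of _ 1] exI[of _ "\<lambda>i. if i = j then 1 else 0"]) auto
  next
    case False
    have "\<not> I (insert j J)" using J(2)[of "insert j J"] False Jq(2) by auto
    then obtain g where g: "g \<in> S" "\<And>i. i \<notin> insert j J \<Longrightarrow> g i = 0" "g \<noteq> (\<lambda>_. 0)"
      using j Jq(1) unfolding I_def by blast
    have "g j \<noteq> 0"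
    proof
      assume "g j = 0"
      then have "\<forall>i. i \<notin> J \<longrightarrow> g i = 0" using g(2) by (metis insertE)
      then show False using J(1) g(1,3) unfolding I_def by blast
    qed
    moreover have "(\<lambda>i. (if i = j then g j else 0) - (if i \<in> J then - g i else 0)) = g"
      using g(2) False by (auto simp: fun_eq_iff)
    ultimately show ?thesis using g(1) SR[OF g(1)]
      by (intro exI[of _ "g j"] exI[of _ "\<lambda>i. if i \<in> J then - g i else 0"]) auto
  qed
  \<comment> \<open>The individual denominators are multiplied together and the relations rescaled
    accordingly.\<close>
  have "\<exists>d. d \<in> Rn n \<and> d \<noteq> 0 \<and> (\<forall>j<k. \<exists>\<tau>. (\<forall>i. \<tau> i \<in> Rn n) \<and> (\<forall>i. i \<notin> J \<longrightarrow> \<tau> i = 0) \<and>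
      (\<lambda>i. (if i = j then d else 0) - \<tau> i) \<in> S)" if "k \<le> q" for k
    using that
  proof (induction k)
    case 0 show ?case by (rule exI[of _ 1]) auto
  next
    case (Suc k)
    then obtain d where d: "d \<in> Rn n" "d \<noteq> 0" "\<And>j. j < k \<Longrightarrow> \<exists>\<tau>. (\<forall>i. \<tau> i \<in> Rn n) \<and> (\<forall>i. i \<notin> J \<longrightarrow> \<tau> i = 0) \<and>
      (\<lambda>i. (if i = j then d else 0) - \<tau> i) \<in> S" by auto
    have "k < q" using Suc by simp
    from one[OF this] obtain e \<sigma> where e: "e \<in> Rn n" "e \<noteq> 0" "\<forall>i. \<sigma> i \<in> Rn n" "\<forall>i. i \<notin> J \<longrightarrow> \<sigma> i = 0"
      "(\<lambda>i. (if i = k then e else 0) - \<sigma> i) \<in> S" by blast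
    have scale: "\<exists>\<tau>. (\<forall>i. \<tau> i \<in> Rn n) \<and> (\<forall>i. i \<notin> J \<longrightarrow> \<tau> i = 0) \<and> (\<lambda>i. (if i = j then a * h else 0) - \<tau> i) \<in> S"
      if "\<forall>i. \<tau> i \<in> Rn n" "\<forall>i. i \<notin> J \<longrightarrow> \<tau> i = 0" "(\<lambda>i. (if i = j then a else 0) - \<tau> i) \<in> S" "h \<in> Rn n" for \<tau> a h j
    proof (intro exI[of _ "\<lambda>i. \<tau> i * h"] conjI)
      have "(\<lambda>i. ((if i = j then a else 0) - \<tau> i) * h) = (\<lambda>i. (if i = j then a * h else 0) - \<tau> i * h)"
        by (auto simp: fun_eq_iff algebra_simps)
      then show "(\<lambda>i. (if i = j then a * h else 0) - \<tau> i * h) \<in> S" using Sm[OF that(3,4)] by simp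
    qed (use that in auto)
    have "\<exists>\<tau>. (\<forall>i. \<tau> i \<in> Rn n) \<and> (\<forall>i. i \<notin> J \<longrightarrow> \<tau> i = 0) \<and> (\<lambda>i. (if i = j then d * e else 0) - \<tau> i) \<in> S"
      if "j < Suc k" for j
    proof (cases "j = k")
      case True
      show ?thesis using scale[OF e(3,4,5) d(1)] unfolding True mult.commute[of d e] .
    next
      case False
      then have "j < k" using that by simp
      from d(3)[OF this] obtain \<tau> where "\<forall>i. \<tau> i \<in> Rn n" "\<forall>i. i \<notin> J \<longrightarrow> \<tau> i = 0"
        "(\<lambda>i. (if i = j then d else 0) - \<tau> i) \<in> S" by blast
      from scale[OF this e(1)] show ?thesis .
    qed
    then show ?case using d e by (intro exI[of _ "d * e"]) auto
  qed
  then obtain d where d: "d \<in> Rn n" "d \<noteq> 0" "\<forall>j<q. \<exists>\<tau>. (\<forall>i. \<tau> i \<in> Rn n) \<and> (\<forall>i. i \<notin> J \<longrightarrow> \<tau> i = 0) \<and>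
      (\<lambda>i. (if i = j then d else 0) - \<tau> i) \<in> S" by blast
  define t where "t j = (SOME \<tau>. (\<forall>i. \<tau> i \<in> Rn n) \<and> (\<forall>i. i \<notin> J \<longrightarrow> \<tau> i = 0) \<and>
      (\<lambda>i. (if i = j then d else 0) - \<tau> i) \<in> S)" for j
  have t: "(\<forall>i. t j i \<in> Rn n) \<and> (\<forall>i. i \<notin> J \<longrightarrow> t j i = 0) \<and>
      (\<lambda>i. (if i = j then d else 0) - t j i) \<in> S" if "j < q" for j
    unfolding t_def by (rule someI_ex[OF d(3)[THEN spec, THEN mp, OF that]])
  show thesis
    by (rule that[of J d "\<lambda>j. if j < q then t j else (\<lambda>_. 0)"]) (use Jq d J(1) t in \<open>auto simp: I_def\<close>)
qed

text \<open>\<open>A\<close> is a quotient of \<open>P\<close> by the kernel of \<rho>. The map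
  chooses any preimage under \<pi>, and equality of the kernels makes the outcome independent of the
  choice.\<close>

lemma embeds_of_same_kernel:
  assumes \<pi>: "lie_hom P A \<pi>" and surj: "\<pi> ` carrier P = carrier A" and \<rho>: "lie_hom P B \<rho>" and P: "op_closed P"
    and ker: "\<And>x y. x \<in> carrier P \<Longrightarrow> y \<in> carrier P \<Longrightarrow> \<pi> x = \<pi> y \<longleftrightarrow> \<rho> x = \<rho> y"
  shows "embeds A B"
proof -
  define l where "l a = (SOME x. x \<in> carrier P \<and> \<pi> x = a)" for a
  have l: "l a \<in> carrier P" "\<pi> (l a) = a" if "a \<in> carrier A" for a
  proof -
    have "a \<in> \<pi> ` carrier P" using that surj by simp
    then have "\<exists>x. x \<in> carrier P \<and> \<pi> x = a" by auto
    from someI_ex[OF this] show "l a \<in> carrier P" "\<pi> (l a) = a" unfolding l_def by simp_all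
  qed
  have eq: "\<rho> (l (\<pi> x)) = \<rho> x" if "x \<in> carrier P" for x
  proof -
    have px: "\<pi> x \<in> carrier A" using imageI[OF that, of \<pi>] surj by simp
    show ?thesis by (rule ker[OF l(1)[OF px] that, THEN iffD1, OF l(2)[OF px]])
  qed
  note Pc = op_closedD[OF P] and h\<pi> = lie_homD[OF \<pi>] and h\<rho> = lie_homD[OF \<rho>]
  have "lie_hom A B (\<lambda>a. \<rho> (l a))"
    unfolding lie_hom_def
  proof (intro conjI ballI allI)
    show "\<rho> (l (zero A)) = zero B" using eq[OF Pc(1)] h\<pi>(1) h\<rho>(1) by simp
    fix x assume x: "x \<in> carrier A"
    note lx = l[OF x]
    show "\<rho> (l x) \<in> carrier B" by (rule h\<rho>(2)[OF lx(1)])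
    show "\<rho> (l (neg A x)) = neg B (\<rho> (l x))"
      using eq[OF Pc(2)[OF lx(1)]] h\<pi>(3)[OF lx(1)] h\<rho>(3)[OF lx(1)] lx(2) by simp
    fix a show "\<rho> (l (sm A a x)) = sm B a (\<rho> (l x))"
      using eq[OF Pc(3)[OF lx(1)]] h\<pi>(4)[OF lx(1)] h\<rho>(4)[OF lx(1)] lx(2) by simp
  next
    fix x y assume x: "x \<in> carrier A" and y: "y \<in> carrier A"
    note lx = l[OF x] and ly = l[OF y]
    show "\<rho> (l (add A x y)) = add B (\<rho> (l x)) (\<rho> (l y))"
      using eq[OF Pc(4)[OF lx(1) ly(1)]] h\<pi>(5)[OF lx(1) ly(1)] h\<rho>(5)[OF lx(1) ly(1)] lx(2) ly(2) by simp
    show "\<rho> (l (br A x y)) = br B (\<rho> (l x)) (\<rho> (l y))"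
      using eq[OF Pc(5)[OF lx(1) ly(1)]] h\<pi>(6)[OF lx(1) ly(1)] h\<rho>(6)[OF lx(1) ly(1)] lx(2) ly(2) by simp
  qed
  moreover have "inj_on (\<lambda>a. \<rho> (l a)) (carrier A)"
  proof (rule inj_onI)
    fix x y assume xy: "x \<in> carrier A" "y \<in> carrier A" "\<rho> (l x) = \<rho> (l y)"
    then have "\<pi> (l x) = \<pi> (l y)" using ker[OF l(1)[OF xy(1)] l(1)[OF xy(2)]] by simp
    then show "x = y" using l(2) xy by simp
  qed
  ultimately show ?thesis unfolding embeds_def by blast
qed

text \<open>The centraliser of the derived algebra. Under \<Phi>3 it consists of the Fitting
  elements, and unlike the quadratic condition \<open>FitEl\<close> it is visibly a
  subspace.\<close>

definition Cent :: "('k, 'a) liealg \<Rightarrow> 'a set" where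
  "Cent A = {x \<in> carrier A. \<forall>y\<in>carrier A. \<forall>z\<in>carrier A. br A (br A y z) x = zero A}"

lemma (in lie) Cent_closed:
  "zero A \<in> Cent A" "x \<in> Cent A \<Longrightarrow> y \<in> Cent A \<Longrightarrow> add A x y \<in> Cent A" "x \<in> Cent A \<Longrightarrow> sm A a x \<in> Cent A"
  "x \<in> Cent A \<Longrightarrow> neg A x \<in> Cent A" "x \<in> Cent A \<Longrightarrow> x \<in> carrier A"
  by (auto simp: Cent_def br_add_right br_sm_right neg_eq_sm)

lemma (in lie) Cent_br: "metabelian A \<Longrightarrow> x \<in> carrier A \<Longrightarrow> y \<in> carrier A \<Longrightarrow> br A x y \<in> Cent A"
  by (auto simp: Cent_def metabelian_def)

lemma (in lie) Cent_br_zero: "x \<in> Cent A \<Longrightarrow> y \<in> carrier A \<Longrightarrow> z \<in> carrier A \<Longrightarrow> br A x (br A y z) = zero A"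
  using br_eq_zero_sym[of "br A y z" x] by (auto simp: Cent_def)

text \<open>If some \<open>x w\<close> is nonzero, it commutes with \<open>x\<close> by the Fitting
  condition and with every \<open>y z\<close> by the metabelian law, so \<Phi>3 makes
  \<open>x\<close> and \<open>y z\<close> commute. Otherwise \<open>x\<close> is central.\<close>

lemma (in lie) FitEl_iff_Cent:
  assumes met: "metabelian A" and p3: "Phi3 A" and x: "x \<in> carrier A"
  shows "FitEl A x \<longleftrightarrow> x \<in> Cent A"
proof
  assume F: "FitEl A x"
  have "br A (br A y z) x = zero A" if yz: "y \<in> carrier A" "z \<in> carrier A" for y z
  proof (cases "\<exists>w\<in>carrier A. br A x w \<noteq> zero A")
    case True
    then obtain w where w: "w \<in> carrier A" "br A x w \<noteq> zero A" by blast
    have "br A (br A x w) x = zero A" using F w(1) by (auto simp: FitEl_def)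
    moreover have "br A (br A x w) (br A y z) = zero A" using met x w yz by (simp add: metabelian_def)
    ultimately have "br A (br A y z) x = zero A"
      using p3[unfolded Phi3_def, rule_format, of "br A x w" "br A y z" x] x w yz by simp
    then show ?thesis .
  next
    case False
    then show ?thesis using x yz by (intro br_eq_zero_sym[of x "br A y z"]) auto
  qed
  then show "x \<in> Cent A" using x by (simp add: Cent_def)
qed (auto simp: Cent_def FitEl_def)

text \<open>Two elements that centralise one nonzero commutator commute by \<Phi>3; without a
  nonzero commutator the algebra is abelian.\<close>

lemma (in lie) Cent_abelian:
  assumes p3: "Phi3 A" and x: "x \<in> Cent A" "y \<in> Cent A"
  shows "br A x y = zero A"
proof (cases "\<exists>a\<in>carrier A. \<exists>b\<in>carrier A. br A a b \<noteq> zero A")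
  case True
  then obtain a b where ab: "a \<in> carrier A" "b \<in> carrier A" "br A a b \<noteq> zero A" by blast
  then show ?thesis using p3[unfolded Phi3_def, rule_format, of "br A a b" x y] x by (auto simp: Cent_def)
next
  case False
  then show ?thesis using Cent_closed(5)[OF x(1)] Cent_closed(5)[OF x(2)] by simp
qed

text \<open>By \<open>phi\<close> and \<open>span\<close> the \<open>b i\<close> with i < n form a
  basis modulo the Fitting radical; the \<open>u j\<close> are to be the Fitting components of the
  generators.\<close>

locale ucl_basis = lie A for A :: "('k::field, 'a) liealg" +
  fixes r n q :: nat and b u :: "nat \<Rightarrow> 'a"
  assumes met: "metabelian A" and p3: "Phi3 A" and p5: "Phi5 r A" and p6: "Phi6 r A" and p7: "Phi7 r A"
    and nr: "n \<le> r" and b: "\<And>i. b i \<in> carrier A" and phi: "phi A n b" and u: "\<And>j. u j \<in> Cent A"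
    and span: "\<And>y. y \<in> carrier A \<Longrightarrow> \<exists>\<alpha> w. w \<in> Cent A \<and> y = add A (lsum A (map (\<lambda>i. sm A (\<alpha> i) (b i)) [0..<n])) w"
begin

sublocale M: lie_module A "Cent A" b n
proof
  show "br A (br A v (b i)) (b j) = br A (br A v (b j)) (b i)" if "v \<in> Cent A" for v i j
    using that b by (intro br_br_comm_of_centralizing) (auto simp: Cent_def)
qed (use b Cent_closed Cent_br[OF met] in auto)

lemma ex_noncomm: "0 < n \<Longrightarrow> \<exists>y\<in>carrier A. \<exists>z\<in>carrier A. br A y z \<noteq> zero A"
proof (rule ccontr)
  assume n: "0 < n" and c: "\<not> ?thesis"
  have "lsum A (map (\<lambda>i. sm A (if i = 0 then 1 else 0) (b i)) [0..<n]) \<in> carrier A"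
    by (intro lsum_closed) (auto simp: b)
  then have "FitEl A (lsum A (map (\<lambda>i. sm A (if i = 0 then 1 else 0) (b i)) [0..<n]))"
    using c by (auto simp: FitEl_def)
  moreover have "\<exists>i<n. (if i = (0 :: nat) then 1 else 0 :: 'k) \<noteq> 0" using n by (intro exI[of _ 0]) simp
  ultimately show False using phi[unfolded phi_def, rule_format, of "\<lambda>i. if i = 0 then 1 else 0"] by blast
qed

text \<open>\<Phi>5 speaks only of commutators, so it is applied to a nonzero \<open>w b_i\<close>,
  which \<open>f\<close> annihilates as well. If all \<open>w b_i\<close> vanish and n > 0, then
  \<open>w\<close> is central by \<open>span\<close>, and \<Phi>3 would make \<open>A\<close>
  abelian, against \<phi>. For n = 0 the polynomial is a nonzero scalar.\<close>

lemma torsion_free: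
  assumes w: "w \<in> Cent A" and f: "f \<in> Rn n" "f \<noteq> 0" and z: "act A w b f = zero A"
  shows "w = zero A"
proof (rule ccontr)
  assume nz: "w \<noteq> zero A"
  have wc: "w \<in> carrier A" by (rule Cent_closed(5)[OF w])
  show False
  proof (cases "\<exists>i<n. br A w (b i) \<noteq> zero A")
    case True
    then obtain i where i: "i < n" "br A w (b i) \<noteq> zero A" by blast
    have "act A (br A w (b i)) b f = zero A" unfolding M.act_br[OF f(1) w i(1)] z using b by simp
    moreover have "in_car A n b" using b by (simp add: in_car_def)
    ultimately have "\<not> phi A n b"
      using p5[unfolded Phi5_def, THEN spec, THEN mp, OF nr, THEN bspec, OF f(1), THEN mp, OF f(2), THEN bspec, OF wc,
          THEN bspec, OF b[of i], THEN spec, of b] i(2) by blast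
    then show False using phi by blast
  next
    case False
    show False
    proof (cases "n = 0")
      case True
      have "f = const (coeff f 0)" using f(1) unfolding True
        by (induction f rule: mpoly_var_induct) (auto simp: lookup_add single_add)
      then have e: "act A w b f = sm A (coeff f 0) w" and c0: "coeff f 0 \<noteq> 0"
        using M.act_const[OF w, of "coeff f 0"] f(2) by auto
      have "sm A (coeff f 0) w = zero A" unfolding e[symmetric] by (rule z)
      then show False unfolding sm_eq_zero_iff[OF wc] using c0 nz by blast
    next
      case n0: False
      have 0: "br A w y = zero A" if y: "y \<in> carrier A" for y
      proof -
        obtain \<alpha> v where v: "v \<in> Cent A" "y = add A (lsum A (map (\<lambda>i. sm A (\<alpha> i) (b i)) [0..<n])) v"
          using span[OF y] by blast
        have bz: "br A (b i) w = zero A" if "i < n" for i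
          using False that b wc br_eq_zero_sym[of w "b i"] by blast
        have "br A (lsum A (map (\<lambda>i. sm A (\<alpha> i) (b i)) [0..<n])) w = lsum A (map (\<lambda>i. br A (sm A (\<alpha> i) (b i)) w) [0..<n])"
          using b wc by (subst lsum_map_br) auto
        also have "\<dots> = zero A" using b wc bz by (intro lsum_map_zero) (auto simp: br_sm_left)
        finally have "br A (lsum A (map (\<lambda>i. sm A (\<alpha> i) (b i)) [0..<n])) w = zero A" .
        moreover have lc: "lsum A (map (\<lambda>i. sm A (\<alpha> i) (b i)) [0..<n]) \<in> carrier A" by (intro lsum_closed) (auto simp: b)
        ultimately have "br A w (lsum A (map (\<lambda>i. sm A (\<alpha> i) (b i)) [0..<n])) = zero A"
          using br_eq_zero_sym wc by blast
        then show ?thesis using v(2) lc Cent_closed(5)[OF v(1)] wc Cent_abelian[OF p3 w v(1)] by (simp add: br_add_right)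
      qed
      obtain y z where yz: "y \<in> carrier A" "z \<in> carrier A" "br A y z \<noteq> zero A" using ex_noncomm n0 by blast
      then show False using p3[unfolded Phi3_def, rule_format, of w y z] wc nz 0 by blast
    qed
  qed
qed

definition HH :: "'k ltm set \<Rightarrow> 'a" where "HH c = teval A b (rep c)"

lemma HH_cls: "HH (cls t) = teval A b t"
  unfolding HH_def by (rule meq_sound[OF meq.sym[OF meq_rep_cls] lie_alg met b])

lemma HH_hom: "lie_hom (Fr n) A HH"
  unfolding lie_hom_def
  by (auto elim!: carrier_FrE simp: HH_cls teval_closed[OF op_closed b] simp del: Fr_simps(1)) (simp_all add: HH_cls)

lemma HH_closed: "c \<in> carrier (Fr m) \<Longrightarrow> HH c \<in> carrier A"
  unfolding HH_def by (rule teval_closed[OF op_closed b])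

lemma HH_inj: "c \<in> carrier (Fr n) \<Longrightarrow> HH c = zero A \<Longrightarrow> c = cls Z"
proof (elim carrier_FrE)
  fix t assume t: "HH c = zero A" "c = cls t" "tvars t \<subseteq> {..<n}"
  have "in_car A n b" using b by (simp add: in_car_def)
  then show "c = cls Z"
    using p6[unfolded Phi6_def, rule_format, OF nr, of t b] t phi by (auto simp: HH_cls)
qed

lemma HH_derived: "c \<in> derived (Fr n) \<Longrightarrow> HH c \<in> Cent A"
proof (induction rule: derived.induct)
  case d_zero
  then show ?case using lie_homD(1)[OF HH_hom] Cent_closed(1) by simp
next
  case (d_br x y)
  then show ?case using lie_homD[OF HH_hom] Cent_br[OF met] HH_closed by simp
next
  case (d_add x y)
  then show ?case using lie_homD(5)[OF HH_hom] Cent_closed(2) by (simp add: Fr.derived_carrier)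
next
  case (d_sm x a)
  then show ?case using lie_homD(4)[OF HH_hom] Cent_closed(3) by (simp add: Fr.derived_carrier)
qed

lemma HH_modact: "c \<in> carrier (Fr n) \<Longrightarrow> f \<in> Rn n \<Longrightarrow> HH (modact n c f) = act A (HH c) b f"
proof -
  assume c: "c \<in> carrier (Fr n)" and f: "f \<in> Rn n"
  have "agen i \<in> carrier (Fr n)" if "i \<in> mvars f" for i using f that by (auto simp: Rn_def intro: agen_in_Fr)
  from act_hom(1)[OF HH_hom op_closed_Fr c this]
  have "HH (modact n c f) = act A (HH c) (\<lambda>i. HH (agen i)) f" unfolding modact_def .
  then show ?thesis by (simp add: agen_def HH_cls)
qed

text \<open>Brackets act trivially because \<open>Cent A\<close> centralises the derived algebra, so
  only the linear part of a term is felt.\<close>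

lemma br_teval: "tvars t \<subseteq> {..<n} \<Longrightarrow> w \<in> Cent A \<Longrightarrow> br A w (teval A b t) = act A w b (fst (dv t))"
proof (induction t)
  case (V i)
  then show ?case using M.act_mult_xvar[of 1 w i] by (simp add: wgen_def M.act_1)
next
  case Z
  then show ?case by (simp add: M.act_0)
next
  case (Pl s t)
  have "fst (dv s) \<in> Rn n" "fst (dv t) \<in> Rn n" using Pl dv_WI WI_D(1) Lin_Rn by (metis Un_subset_iff tvars.simps(3))+
  then show ?case using Pl by (simp add: br_add_right fst_WW M.act_add_right teval_closed[OF op_closed b])
next
  case (Ng s)
  have "fst (dv s) \<in> Rn n" using Ng dv_WI WI_D(1) Lin_Rn by (metis tvars.simps(4))
  then show ?case using Ng by (simp add: fst_WW M.act_uminus neg_eq_sm br_sm_right teval_closed[OF op_closed b] M.act_closed)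
next
  case (Br s t)
  then show ?case by (simp add: fst_WW M.act_0 Cent_br_zero teval_closed[OF op_closed b])
next
  case (Sc a s)
  have "fst (dv s) \<in> Rn n" using Sc dv_WI WI_D(1) Lin_Rn by (metis tvars.simps(6))
  then show ?case using Sc M.act_const_mult[of "fst (dv s)" w a]
    by (simp add: fst_WW br_sm_right teval_closed[OF op_closed b] mult.commute)
qed

lemma br_HH: "c \<in> carrier (Fr n) \<Longrightarrow> w \<in> Cent A \<Longrightarrow> br A w (HH c) = act A w b (linpoly n c)"
  by (auto simp: linpoly_eq HH_cls br_teval elim!: carrier_FrE)

definition UU :: "(nat \<Rightarrow> 'k mpoly) \<Rightarrow> 'a" where "UU f = lsum A (map (\<lambda>j. act A (u j) b (f j)) [0..<q])"

lemma act_u: "f \<in> Rn n \<Longrightarrow> act A (u j) b f \<in> Cent A" by (rule M.act_closed[OF u])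
lemma lsum_Cent: "set xs \<subseteq> Cent A \<Longrightarrow> lsum A xs \<in> Cent A"
  by (induction xs) (auto intro: Cent_closed)
lemma UU_Cent: "(\<And>j. f j \<in> Rn n) \<Longrightarrow> UU f \<in> Cent A"
  unfolding UU_def by (intro lsum_Cent) (auto intro: act_u)
lemma UU_add: "(\<And>j. f j \<in> Rn n) \<Longrightarrow> (\<And>j. g j \<in> Rn n) \<Longrightarrow> UU (\<lambda>j. f j + g j) = add A (UU f) (UU g)"
  unfolding UU_def by (simp add: M.act_add_right[OF u] lsum_map_add act_u Cent_closed)
lemma UU_zero: "UU (\<lambda>_. 0) = zero A"
  unfolding UU_def by (simp add: M.act_0[OF u] lsum_map_zero)
lemma UU_const: "(\<And>j. f j \<in> Rn n) \<Longrightarrow> UU (\<lambda>j. const a * f j) = sm A a (UU f)"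
  unfolding UU_def by (simp add: mult.commute[of "const a"] M.act_const_mult[OF _ u] lsum_map_sm act_u Cent_closed)
lemma UU_uminus: "(\<And>j. f j \<in> Rn n) \<Longrightarrow> UU (\<lambda>j. - f j) = neg A (UU f)"
  using UU_const[of f "- 1"] UU_Cent[of f] Cent_closed(5) by (simp add: single_uminus neg_eq_sm)

lemma act_lsum: "(\<And>x. x \<in> set xs \<Longrightarrow> F x \<in> Cent A) \<Longrightarrow> g \<in> Rn n \<Longrightarrow>
    act A (lsum A (map F xs)) b g = lsum A (map (\<lambda>x. act A (F x) b g) xs)"
proof (induction xs)
  case Nil
  have "act A (sm A 0 (zero A)) b g = sm A 0 (act A (zero A) b g)"
    using M.act_mult[of g "const 0" "zero A"] M.act_const[of "zero A" 0] M.act_const_mult[of g "zero A" 0] Nil Cent_closed(1)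
    by (simp add: mult.commute)
  then show ?case using Cent_closed(5)[OF M.act_closed[OF Cent_closed(1) Nil(2)]] by simp
next
  case (Cons x xs)
  have "lsum A (map F xs) \<in> Cent A" using Cons by (intro lsum_Cent) auto
  then show ?case using Cons by (simp add: M.act_add_left)
qed

lemma UU_mult: "(\<And>j. f j \<in> Rn n) \<Longrightarrow> g \<in> Rn n \<Longrightarrow> act A (UU f) b g = UU (\<lambda>j. f j * g)"
  unfolding UU_def by (subst act_lsum) (auto simp: act_u M.act_mult[OF _ _ u])

definition pp :: "'k ltm set \<times> (nat \<Rightarrow> 'k mpoly) \<Rightarrow> 'a" where "pp = (\<lambda>(c, f). add A (HH c) (UU f))"

text \<open>The bracket of the direct module extension is what \<open>A\<close> shows:
  \<open>Cent A\<close> is abelian, and the copy of \<open>F_n\<close> acts on it through linear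
  parts.\<close>

lemma pp_hom: "lie_hom (Frs n q) A pp"
  unfolding lie_hom_def
proof (intro conjI ballI allI)
  note H = lie_homD[OF HH_hom]
  show "pp (zero (Frs n q)) = zero A" using H(1) UU_zero by (simp add: pp_def)
  fix x :: "'k ltm set \<times> (nat \<Rightarrow> 'k mpoly)" assume x: "x \<in> carrier (Frs n q)"
  obtain c f where xc: "x = (c, f)" by (cases x)
  have c: "c \<in> carrier (Fr n)" "\<And>j. f j \<in> Rn n" using x by (auto simp: xc carrier_Frs)
  have cl: "HH c \<in> carrier A" "UU f \<in> carrier A" using c HH_closed Cent_closed(5)[OF UU_Cent] by auto
  show "pp x \<in> carrier A" using cl by (simp add: xc pp_def)
  show "pp (neg (Frs n q) x) = neg A (pp x)"
    using cl c by (simp add: xc pp_def H UU_uminus neg_eq_sm[of "add A _ _"] neg_eq_sm[of "HH c"] neg_eq_sm[of "UU f"] sm_add_right)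
  fix a
  show "pp (sm (Frs n q) a x) = sm A a (pp x)"
    using cl c by (simp add: xc pp_def H UU_const sm_add_right)
next
  note H = lie_homD[OF HH_hom]
  fix x y :: "'k ltm set \<times> (nat \<Rightarrow> 'k mpoly)" assume x: "x \<in> carrier (Frs n q)" and y: "y \<in> carrier (Frs n q)"
  obtain c f d g where xc: "x = (c, f)" "y = (d, g)" by (cases x, cases y)
  have c: "c \<in> carrier (Fr n)" "\<And>j. f j \<in> Rn n" "d \<in> carrier (Fr n)" "\<And>j. g j \<in> Rn n" using x y by (auto simp: xc carrier_Frs)
  have U: "UU f \<in> Cent A" "UU g \<in> Cent A" using c UU_Cent by auto
  have cl: "HH c \<in> carrier A" "UU f \<in> carrier A" "HH d \<in> carrier A" "UU g \<in> carrier A"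
    using c HH_closed Cent_closed(5) U by auto
  show "pp (add (Frs n q) x y) = add A (pp x) (pp y)"
    using cl c by (simp add: xc pp_def H UU_add add_assoc add_left_comm)
  have l: "linpoly n c \<in> Rn n" "linpoly n d \<in> Rn n" using c linpoly_Rn by auto
  have "br A (add A (HH c) (UU f)) (add A (HH d) (UU g)) =
     add A (add A (br A (HH c) (HH d)) (br A (HH c) (UU g))) (add A (br A (UU f) (HH d)) (br A (UU f) (UU g)))"
    using cl by (simp add: br_add_left br_add_right add_assoc add_left_comm)
  also have "br A (UU f) (UU g) = zero A" by (rule Cent_abelian[OF p3 U])
  also have "br A (UU f) (HH d) = UU (\<lambda>j. f j * linpoly n d)"
    unfolding br_HH[OF c(3) U(1)] by (rule UU_mult[OF c(2) l(2)])
  also have "br A (HH c) (UU g) = UU (\<lambda>j. - (g j * linpoly n c))"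
    unfolding br_anti[OF cl(4) cl(1)] br_HH[OF c(1) U(2)] UU_mult[OF c(4) l(1)] using c l by (simp add: UU_uminus)
  finally have e: "br A (pp x) (pp y) = add A (add A (br A (HH c) (HH d)) (UU (\<lambda>j. - (g j * linpoly n c))))
      (add A (UU (\<lambda>j. f j * linpoly n d)) (zero A))" by (simp add: xc pp_def)
  have "UU (\<lambda>j. f j * linpoly n d - g j * linpoly n c) = add A (UU (\<lambda>j. - (g j * linpoly n c))) (UU (\<lambda>j. f j * linpoly n d))"
    using UU_add[of "\<lambda>j. - (g j * linpoly n c)" "\<lambda>j. f j * linpoly n d"] c l by simp
  moreover have "UU (\<lambda>j. - (g j * linpoly n c)) \<in> carrier A" "UU (\<lambda>j. f j * linpoly n d) \<in> carrier A"
    using c l by (auto intro!: Cent_closed(5) UU_Cent)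
  ultimately show "pp (br (Frs n q) x y) = br A (pp x) (pp y)"
    unfolding e using cl c by (simp add: xc pp_def H add_assoc)
qed

lemma pp_surj:
  assumes g: "\<And>i. i < q \<Longrightarrow> \<exists>\<alpha>. g i = add A (lsum A (map (\<lambda>k. sm A (\<alpha> k) (b k)) [0..<n])) (u i)"
    and gen: "carrier A = {teval A g t | t. tvars t \<subseteq> {..<q}}"
  shows "pp ` carrier (Frs n q) = carrier A"
proof
  show "pp ` carrier (Frs n q) \<subseteq> carrier A" using lie_homD(2)[OF pp_hom] by blast
  have "\<exists>x. x \<in> carrier (Frs n q) \<and> pp x = g i" if i: "i < q" for i
  proof -
    obtain \<alpha> where \<alpha>: "g i = add A (lsum A (map (\<lambda>k. sm A (\<alpha> k) (b k)) [0..<n])) (u i)" using g[OF i] by blast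
    let ?c = "lsum (Fr n) (map (\<lambda>k. sm (Fr n) (\<alpha> k) (agen k)) [0..<n])"
    let ?f = "\<lambda>j. if j = i then 1 else 0 :: 'k mpoly"
    have sub: "set (map (\<lambda>k. sm (Fr n) (\<alpha> k) (agen k)) [0..<n]) \<subseteq> carrier (Fr n)" by (auto simp: agen_in_Fr)
    have "HH ?c = lsum A (map (\<lambda>k. HH (sm (Fr n) (\<alpha> k) (agen k))) [0..<n])"
      using lsum_hom[OF HH_hom op_closed_Fr sub] by (simp add: o_def)
    also have "map (\<lambda>k. HH (sm (Fr n) (\<alpha> k) (agen k))) [0..<n] = map (\<lambda>k. sm A (\<alpha> k) (b k)) [0..<n]"
      by (intro map_cong) (simp_all add: agen_def HH_cls)
    finally have "HH ?c = lsum A (map (\<lambda>k. sm A (\<alpha> k) (b k)) [0..<n])" .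
    moreover have "UU ?f = u i"
    proof -
      have "UU ?f = act A (u i) b (?f i)" unfolding UU_def
        by (rule lsum_single) (use i in \<open>auto simp: M.act_0[OF u] intro!: Cent_closed(5) act_u\<close>)
      then show ?thesis by (simp add: M.act_1[OF u])
    qed
    moreover have "(?c, ?f) \<in> carrier (Frs n q)" using i Fr.lsum_closed[OF sub] by (auto simp: carrier_Frs)
    ultimately show ?thesis using \<alpha> by (intro exI[of _ "(?c, ?f)"]) (simp add: pp_def)
  qed
  then obtain x where x: "\<And>i. i < q \<Longrightarrow> x i \<in> carrier (Frs n q)" "\<And>i. i < q \<Longrightarrow> pp (x i) = g i" by metis
  show "carrier A \<subseteq> pp ` carrier (Frs n q)"
  proof
    fix a assume "a \<in> carrier A"
    then obtain t where t: "a = teval A g t" "tvars t \<subseteq> {..<q}" using gen by auto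
    have xi: "x i \<in> carrier (Frs n q)" if "i \<in> tvars t" for i using that t(2) x(1) by auto
    have "pp (teval (Frs n q) x t) = teval A (\<lambda>i. pp (x i)) t" by (rule teval_hom[OF pp_hom op_closed_Frs xi])
    also have "\<dots> = a" unfolding t(1) by (rule teval_cong) (use t(2) x(2) in auto)
    finally show "a \<in> pp ` carrier (Frs n q)" using teval_closed[OF op_closed_Frs, of t x] xi by force
  qed
qed

end

section \<open>Comparison of two quotients of \<open>F_{n,q}\<close>\<close>

lemma WI_mono: "n \<le> m \<Longrightarrow> x \<in> WI n \<Longrightarrow> x \<in> WI m"
proof -
  assume nm: "n \<le> m" and x: "x \<in> WI n"
  have "(\<Sum>j<m. snd x j * xvar j) = (\<Sum>j<n. snd x j * xvar j)"
    using nm WI_D(3)[OF x] by (intro sum.mono_neutral_right) auto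
  then show ?thesis using WI_D[OF x] Rn_mono[OF nm] Lin_mono[OF nm] nm by (cases x) (auto simp: WI_def)
qed

lemma modact_derived:
  assumes "c \<in> derived (Fr n)" "f \<in> Rn n"
  shows "modact n c f \<in> derived (Fr n)" "fcoord (modact n c f) = (0, \<lambda>k. snd (fcoord c) k * f)"
proof -
  have c: "c \<in> carrier (Fr n)" "fcoord c = (0, snd (fcoord c))" using assms(1) by (auto simp: derived_Fr_iff prod_eq_iff)
  show "fcoord (modact n c f) = (0, \<lambda>k. snd (fcoord c) k * f)" by (rule fcoord_modact(1)[OF assms(2) c])
  then show "modact n c f \<in> derived (Fr n)" using fcoord_modact(2)[OF assms(2) c] by (simp add: derived_Fr_iff)
qed

text \<open>\<open>pp\<close> maps \<open>F_{n,q}\<close> onto \<open>A\<close>, and a second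
  homomorphism \<open>R\<close> into \<open>F_{r,q}\<close> is built with the same kernel. The rank
  of the free module is the number of generators.\<close>

lemma (in ucl_basis) embeds_Frs:
  assumes gen: "\<And>i. i < q \<Longrightarrow> \<exists>\<alpha>. g i = add A (lsum A (map (\<lambda>k. sm A (\<alpha> k) (b k)) [0..<n])) (u i)"
    "carrier A = {teval A g t | t. tvars t \<subseteq> {..<q}}"
  shows "embeds A (Frs r q :: ('k, 'k ltm set \<times> (nat \<Rightarrow> 'k mpoly)) liealg)"
proof -
  \<comment> \<open>The relations between the \<open>u j\<close> modulo the copy of
    \<open>F_n^2\<close> in \<open>A\<close>.\<close>
  define S where "S = {f. (\<forall>j. f j \<in> Rn n) \<and> (\<exists>c\<in>derived (Fr n). UU f = HH c)}"
  have S0: "(\<lambda>_. 0) \<in> S"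
    using derived.d_zero[of "Fr n :: ('k, 'k ltm set) liealg"] UU_zero lie_homD(1)[OF HH_hom] by (force simp: S_def)
  have SR: "f j \<in> Rn n" if "f \<in> S" for f j using that by (simp add: S_def)
  have Sm: "(\<lambda>j. f j * h) \<in> S" if f: "f \<in> S" and h: "h \<in> Rn n" for f h
  proof -
    obtain c where c: "c \<in> derived (Fr n)" "UU f = HH c" and fR: "\<And>j. f j \<in> Rn n" using f by (auto simp: S_def)
    have "UU (\<lambda>j. f j * h) = HH (modact n c h)"
      using UU_mult[where f = f, OF fR h] HH_modact[OF Fr.derived_carrier[OF c(1)] h] c(2) by simp
    then show ?thesis using modact_derived(1)[OF c(1) h] fR h by (auto simp: S_def)
  qed
  have "\<exists>J d \<tau>. J \<subseteq> {..<q} \<and> d \<in> Rn n \<and> d \<noteq> 0 \<and> (\<forall>f\<in>S. (\<forall>j. j \<notin> J \<longrightarrow> f j = 0) \<longrightarrow> f = (\<lambda>_. 0)) \<and>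
    (\<forall>j i. \<tau> j i \<in> Rn n) \<and> (\<forall>j<q. \<forall>i. i \<notin> J \<longrightarrow> \<tau> j i = 0) \<and> (\<forall>j<q. (\<lambda>i. (if i = j then d else 0) - \<tau> j i) \<in> S)" (is ?E)
  proof (rule module_relations[of S n q])
    show "(\<lambda>_. 0) \<in> S" by (rule S0)
    show "f j \<in> Rn n" if "f \<in> S" for f j by (rule SR[OF that])
    show "(\<lambda>j. f j * h) \<in> S" if "f \<in> S" "h \<in> Rn n" for f h by (rule Sm[OF that])
    fix J d \<tau> assume a: "J \<subseteq> {..<q}" "d \<in> Rn n" "d \<noteq> 0" "\<And>f. f \<in> S \<Longrightarrow> (\<And>j. j \<notin> J \<Longrightarrow> f j = 0) \<Longrightarrow> f = (\<lambda>_. 0)"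
      "\<And>j i. \<tau> j i \<in> Rn n" "\<And>j i. j < q \<Longrightarrow> i \<notin> J \<Longrightarrow> \<tau> j i = 0"
      "\<And>j. j < q \<Longrightarrow> (\<lambda>i. (if i = j then d else 0) - \<tau> j i) \<in> S"
    show ?E
      by (rule exI[of _ J], rule exI[of _ d], rule exI[of _ \<tau>], intro conjI ballI allI impI) (simp_all add: a)
  qed
  then obtain J d \<tau> where J: "J \<subseteq> {..<q}" and d: "d \<in> Rn n" "d \<noteq> 0"
    and ind': "\<forall>f\<in>S. (\<forall>j. j \<notin> J \<longrightarrow> f j = 0) \<longrightarrow> f = (\<lambda>_. 0)"
    and \<tau>': "\<forall>j i. \<tau> j i \<in> Rn n" "\<forall>j<q. \<forall>i. i \<notin> J \<longrightarrow> \<tau> j i = 0"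
    and rowS': "\<forall>j<q. (\<lambda>i. (if i = j then d else 0) - \<tau> j i) \<in> S" by (elim exE conjE)
  have ind: "f = (\<lambda>_. 0)" if "f \<in> S" "\<And>j. j \<notin> J \<Longrightarrow> f j = 0" for f using ind' that by simp
  have \<tau>: "\<tau> j i \<in> Rn n" "j < q \<Longrightarrow> i \<notin> J \<Longrightarrow> \<tau> j i = 0" for j i using \<tau>' by simp_all
  have rowS: "(\<lambda>i. (if i = j then d else 0) - \<tau> j i) \<in> S" if "j < q" for j using rowS' that by simp
  \<comment> \<open>Coefficients of \<open>d u_j - \<Sum> \<tau>_{ji} u_i\<close>, the combination
    that falls into the copy of \<open>F_n^2\<close>.\<close>
  define row where "row j = (\<lambda>i. (if i = j then d else 0) - \<tau> j i)" for j
  have rowR: "row j i \<in> Rn n" for i j using d \<tau> by (simp add: row_def)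
  have "\<exists>t. j < q \<longrightarrow> tvars t \<subseteq> {..<n} \<and> cls t \<in> derived (Fr n) \<and> UU (row j) = HH (cls t)" for j
  proof (cases "j < q")
    case True
    then obtain c where c: "c \<in> derived (Fr n)" "UU (row j) = HH c" using rowS[OF True] by (auto simp: S_def row_def)
    then obtain t where "c = cls t" "tvars t \<subseteq> {..<n}" using Fr.derived_carrier[OF c(1)] by (auto simp: carrier_Fr)
    then show ?thesis using c by blast
  qed auto
  then obtain ct where ct: "\<And>j. j < q \<Longrightarrow> tvars (ct j) \<subseteq> {..<n}" "\<And>j. j < q \<Longrightarrow> cls (ct j) \<in> derived (Fr n)"
    "\<And>j. j < q \<Longrightarrow> UU (row j) = HH (cls (ct j))" using choice[of "\<lambda>j t. j < q \<longrightarrow> tvars t \<subseteq> {..<n} \<and> cls t \<in> derived (Fr n) \<and> UU (row j) = HH (cls t)"]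
    by blast
  define cv where "cv j = snd (dv (ct j))" for j
  have uc: "u j \<in> carrier A" for j by (rule Cent_closed(5)[OF u])
  \<comment> \<open>The \<open>u j\<close> themselves satisfy the system in \<open>A\<close>, and
    \<open>u_j b_i u_j = 0\<close> holds because Fitting elements commute; so \<Phi>7 excludes an
    unsolvable system.\<close>
  have solv: "solvable_loc n q q row (\<lambda>i. cls (ct i))"
  proof (rule ccontr)
    assume ns: "\<not> ?thesis"
    have car: "in_car A n b" "in_car A q u" using b uc by (auto simp: in_car_def)
    have z: "br A (br A (u j) (b i)) (u j) = zero A" for i j
      by (rule Cent_abelian[OF p3 Cent_br[OF met uc b] u])
    have "\<exists>i<q. add A (lsum A (map (\<lambda>j. act A (u j) b (row i j)) [0..<q])) (neg A (teval A b (ct i))) \<noteq> zero A"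
      by (rule p7[unfolded Phi7_def, rule_format, OF nr, of q q row ct b u]) (use ct rowR ns car phi z in auto)
    then obtain i where i: "i < q" "add A (UU (row i)) (neg A (HH (cls (ct i)))) \<noteq> zero A" by (auto simp: UU_def HH_cls)
    have "UU (row i) \<in> carrier A" using Cent_closed(5)[OF UU_Cent] rowR by blast
    then show False using i ct(3)[OF i(1)] by simp
  qed
  obtain w0 s0 t0 where w0: "\<forall>j<q. (0, w0 j) \<in> WI n" and s0: "s0 \<in> Rn n" "coeff s0 0 \<noteq> 0" and t0: "coeff t0 0 \<noteq> 0"
    and e0: "\<forall>i<q. \<forall>k. (\<Sum>j<q. w0 j k * row i j) * t0 = snd (fcoord (cls (ct i))) k * s0 * t0"
    using solv by (subst (asm) solvable_loc_iff) (use rowR ct in auto)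
  \<comment> \<open>Normalises the denominator to constant term 1, which places s - 1 in
    \<Delta>.\<close>
  define \<kappa> where "\<kappa> = inverse (coeff s0 0)"
  define s where "s = const \<kappa> * s0"
  define w where "w j k = const \<kappa> * w0 j k" for j k
  have s: "s \<in> Rn n" "coeff s 0 = 1" using s0 by (auto simp: s_def \<kappa>_def coeff_const_mult)
  then have snz: "s \<noteq> 0" by auto
  have wW: "(0, w j) \<in> WI n" if "j < q" for j
    using WI_sm[of "(0, w0 j)" n \<kappa>] w0 that by (simp add: w_def[abs_def])
  have t0nz: "t0 \<noteq> 0" using t0 by auto
  have e: "d * w i k = cv i k * s + (\<Sum>j<q. \<tau> i j * w j k)" if i: "i < q" for i k
  proof -
    have "(\<Sum>j<q. w0 j k * row i j) = cv i k * s0" using e0 i t0nz by (simp add: cv_def)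
    then have "const \<kappa> * (\<Sum>j<q. w0 j k * row i j) = cv i k * s" by (simp add: s_def ac_simps)
    then have "cv i k * s = (\<Sum>j<q. w j k * row i j)" by (simp add: sum_distrib_left w_def mult.assoc)
    also have "\<dots> = (\<Sum>j<q. (if j = i then d * w j k else 0) - \<tau> i j * w j k)"
      by (rule sum.cong) (auto simp: row_def algebra_simps)
    also have "\<dots> = d * w i k - (\<Sum>j<q. \<tau> i j * w j k)" using i by (simp add: sum_subtractf sum.delta)
    finally show ?thesis by simp
  qed
  have "s - 1 \<in> Rn n" "coeff (s - 1) 0 = 0" using s by (simp_all add: lookup_minus lookup_one)
  then obtain D' where D': "\<forall>k. D' k \<in> Rn n" "s - 1 = (\<Sum>k<n. D' k * xvar k)" using const_term_zero_decomp by blast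
  define D where "D k = (if k < n then D' k else 0)" for k
  have D: "D k \<in> Rn n" "k \<ge> n \<Longrightarrow> D k = 0" "(\<Sum>k<n. D k * xvar k) = s - 1" for k
    using D' by (simp_all add: D_def)
  define L where "L h f i = (\<Sum>j<q. f j * h j i)" for h :: "nat \<Rightarrow> nat \<Rightarrow> 'k mpoly" and f and i :: nat
  have Llin: "L h (\<lambda>j. f j + f' j) i = L h f i + L h f' i" "L h (\<lambda>j. - f j) i = - L h f i"
    "L h (\<lambda>j. const a * f j) i = const a * L h f i" "L h (\<lambda>j. f j * a1 - f' j * a2) i = L h f i * a1 - L h f' i * a2"
    "L h (\<lambda>_. 0) i = 0" for h f f' i a a1 a2
    by (simp_all add: L_def sum.distrib sum_negf sum_subtractf sum_distrib_left sum_distrib_right algebra_simps)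
  \<comment> \<open>the endomorphism of \<open>F_n\<close> giving \<open>a_i\<close> the Fox vector \<open>s e_i - x_i D\<close> acts on \<open>F_n^2\<close> as \<open>s\<close>; it exists since \<open>s - 1 = \<Sum> x_k D_k\<close>\<close>
  define X where "X c f = (fst (fcoord c), \<lambda>k. s * snd (fcoord c) k - fst (fcoord c) * D k + L w f k)" for c f
  have X: "X c f \<in> WI r" if c: "c \<in> carrier (Fr n)" and f: "\<And>j. f j \<in> Rn n" for c f
  proof (rule WI_mono[OF nr])
    have wR: "w j k \<in> Rn n" if "j < q" for j k using WI_D(2)[OF wW[OF that], of k] by simp
    have w0: "w j k = 0" if "j < q" "k \<ge> n" for j k using WI_D(3)[OF wW[OF that(1)], of k] that by simp
    have we: "(\<Sum>k<n. w j k * xvar k) = 0" if "j < q" for j using WI_D(4)[OF wW[OF that]] by simp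
    have "(\<Sum>k<n. L w f k * xvar k) = (\<Sum>j<q. f j * (\<Sum>k<n. w j k * xvar k))"
      unfolding L_def sum_distrib_left sum_distrib_right by (subst sum.swap) (simp only: mult.assoc)
    also have "\<dots> = 0" by (simp add: we)
    finally have 1: "(\<Sum>k<n. L w f k * xvar k) = 0" .
    have 2: "(\<Sum>k<n. s * snd (fcoord c) k * xvar k) = s * fst (fcoord c)"
      unfolding fcoord_eps[OF c, symmetric] sum_distrib_left mult.assoc ..
    have 3: "(\<Sum>k<n. fst (fcoord c) * D k * xvar k) = fst (fcoord c) * (s - 1)"
      unfolding D(3)[symmetric] sum_distrib_left mult.assoc ..
    have "(\<Sum>k<n. (s * snd (fcoord c) k - fst (fcoord c) * D k + L w f k) * xvar k) = fst (fcoord c)"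
      unfolding distrib_right left_diff_distrib sum.distrib sum_subtractf 1 2 3 by (simp add: algebra_simps)
    moreover have "L w f k \<in> Rn n" for k unfolding L_def by (intro Rn_sum Rn_mult f wR) auto
    moreover have "L w f k = 0" if "k \<ge> n" for k unfolding L_def using w0 that by simp
    ultimately show "X c f \<in> WI n"
      using fcoord_Lin[OF c] fcoord_Rn[OF c] fcoord_beyond[OF c] s(1) D Lin_Rn[OF fcoord_Lin[OF c]]
      by (simp add: WI_def X_def)
  qed
  \<comment> \<open>The second component lists the coordinates, with respect to the independent
    \<open>u_i\<close>, of \<open>d\<close> times the module part modulo
    \<open>F_n^2\<close>.\<close>
  define R where "R = (\<lambda>(c, f). (felem r (X c f), L \<tau> f))"
  have R1: "felem r (X c f) \<in> carrier (Fr r)" "fst (fcoord (felem r (X c f))) = fst (fcoord c)"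
    "\<And>k. snd (fcoord (felem r (X c f))) k = s * snd (fcoord c) k - fst (fcoord c) * D k + L w f k"
    if "(c, f) \<in> carrier (Frs n q)" for c f
    using felem[OF X[of c f]] that by (auto simp: carrier_Frs X_def)
  have LR: "L \<tau> f i \<in> Rn r" "i \<ge> q \<Longrightarrow> L \<tau> f i = 0" "i \<notin> J \<Longrightarrow> L \<tau> f i = 0" "L \<tau> f i \<in> Rn n"
    if "(c, f) \<in> carrier (Frs n q)" for c f i
  proof -
    show "L \<tau> f i \<in> Rn n" using that \<tau>(1) by (auto simp: L_def carrier_Frs intro!: Rn_sum Rn_mult)
    then show "L \<tau> f i \<in> Rn r" using Rn_mono[OF nr] by blast
    show Z: "L \<tau> f i = 0" if "i \<notin> J" using \<tau>(2) that by (simp add: L_def)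
    show "L \<tau> f i = 0" if "i \<ge> q" by (rule Z) (use J that in auto)
  qed
  have eq: "x = y" if "x \<in> carrier (Fr r)" "y \<in> carrier (Fr r)" "fst (fcoord x) = fst (fcoord y)"
    "\<And>i. snd (fcoord x) i = snd (fcoord y) i" for x y :: "'k ltm set"
    by (rule fcoord_inj[OF that(1,2)]) (use that in \<open>simp add: prod_eq_iff fun_eq_iff\<close>)
  have R_hom: "lie_hom (Frs n q) (Frs r q) R"
    unfolding lie_hom_def
  proof (intro conjI ballI allI)
    have z: "(cls Z, \<lambda>_. 0 :: 'k mpoly) \<in> carrier (Frs n q)" by (simp add: carrier_Frs cls_in_Fr)
    have "felem r (X (cls Z) (\<lambda>_. 0)) = cls Z"
      by (rule eq) (use R1[OF z] in \<open>simp_all add: Llin cls_in_Fr\<close>)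
    then show "R (zero (Frs n q)) = zero (Frs r q)" by (simp add: R_def Llin(5)[abs_def])
    fix x :: "'k ltm set \<times> (nat \<Rightarrow> 'k mpoly)" assume x: "x \<in> carrier (Frs n q)"
    obtain c f where xc: "x = (c, f)" by (cases x)
    note x' = x[unfolded xc]
    have c: "c \<in> carrier (Fr n)" using x' by (simp add: carrier_Frs)
    show "R x \<in> carrier (Frs r q)" using R1[OF x'] LR[OF x'] by (simp add: R_def xc carrier_Frs)
    have nx: "(neg (Fr n) c, \<lambda>j. - f j) \<in> carrier (Frs n q)" using op_closedD(2)[OF op_closed_Frs x] by (simp add: xc)
    have "felem r (X (neg (Fr n) c) (\<lambda>j. - f j)) = neg (Fr r) (felem r (X c f))"
      by (rule eq) (use R1[OF nx] R1[OF x'] c in \<open>simp_all add: Llin fst_WW snd_WW\<close>)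
    then show "R (neg (Frs n q) x) = neg (Frs r q) (R x)" by (simp add: R_def xc Llin fun_eq_iff)
    fix a :: 'k
    have sx: "(sm (Fr n) a c, \<lambda>j. const a * f j) \<in> carrier (Frs n q)" using op_closedD(3)[OF op_closed_Frs x] by (simp add: xc)
    have "felem r (X (sm (Fr n) a c) (\<lambda>j. const a * f j)) = sm (Fr r) a (felem r (X c f))"
      by (rule eq) (use R1[OF sx] R1[OF x'] c in \<open>simp_all add: Llin fst_WW snd_WW\<close>, simp add: algebra_simps)
    then show "R (sm (Frs n q) a x) = sm (Frs r q) a (R x)" by (simp add: R_def xc Llin fun_eq_iff)
  next
    fix x y :: "'k ltm set \<times> (nat \<Rightarrow> 'k mpoly)" assume x: "x \<in> carrier (Frs n q)" and y: "y \<in> carrier (Frs n q)"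
    obtain c f c' f' where xc: "x = (c, f)" "y = (c', f')" by (cases x, cases y)
    note x' = x[unfolded xc] and y' = y[unfolded xc]
    have c: "c \<in> carrier (Fr n)" "c' \<in> carrier (Fr n)" using x' y' by (simp_all add: carrier_Frs)
    have l: "linpoly r (felem r (X c f)) = linpoly n c" "linpoly r (felem r (X c' f')) = linpoly n c'"
      using R1[OF x'] R1[OF y'] c by (simp_all add: linpoly_eq)
    have ax: "(add (Fr n) c c', \<lambda>j. f j + f' j) \<in> carrier (Frs n q)"
      using op_closedD(4)[OF op_closed_Frs x y] by (simp add: xc)
    have "felem r (X (add (Fr n) c c') (\<lambda>j. f j + f' j)) = add (Fr r) (felem r (X c f)) (felem r (X c' f'))"
      by (rule eq) (use R1[OF ax] R1[OF x'] R1[OF y'] c in \<open>simp_all add: Llin fst_WW snd_WW\<close>, simp add: algebra_simps)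
    then show "R (add (Frs n q) x y) = add (Frs r q) (R x) (R y)" by (simp add: R_def xc Llin fun_eq_iff)
    have bx: "(br (Fr n) c c', \<lambda>j. f j * linpoly n c' - f' j * linpoly n c) \<in> carrier (Frs n q)"
      using op_closedD(5)[OF op_closed_Frs x y] by (simp add: xc)
    have "felem r (X (br (Fr n) c c') (\<lambda>j. f j * linpoly n c' - f' j * linpoly n c)) = br (Fr r) (felem r (X c f)) (felem r (X c' f'))"
      by (rule eq) (use R1[OF bx] R1[OF x'] R1[OF y'] c in \<open>simp_all add: Llin fst_WW snd_WW\<close>, simp add: linpoly_eq algebra_simps)
    then show "R (br (Frs n q) x y) = br (Frs r q) (R x) (R y)" by (simp add: R_def xc Llin fun_eq_iff l)
  qed
  have ker0: "pp z = zero A \<longleftrightarrow> R z = zero (Frs r q)" if z: "z \<in> carrier (Frs n q)" for z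
  proof -
    obtain c f where zc: "z = (c, f)" by (cases z)
    note z' = z[unfolded zc]
    have c: "c \<in> carrier (Fr n)" and f: "\<And>j. f j \<in> Rn n" and fq: "\<And>j. j \<ge> q \<Longrightarrow> f j = 0" using z' by (auto simp: carrier_Frs)
    define p v where "p = fst (fcoord c)" and "v = snd (fcoord c)"
    have fR: "\<And>j. f j \<in> Rn n" by (rule f)
    have Uc: "UU f \<in> Cent A" by (rule UU_Cent) (rule f)
    have cc: "HH c \<in> carrier A" "UU f \<in> carrier A" using HH_closed[OF c] Cent_closed(5)[OF Uc] by auto
    have Rz: "R z = zero (Frs r q) \<longleftrightarrow> p = 0 \<and> (\<forall>k. s * v k - p * D k + L w f k = 0) \<and> (\<forall>i. L \<tau> f i = 0)"
    proof -
      have "felem r (X c f) = cls Z \<longleftrightarrow> p = 0 \<and> (\<forall>k. s * v k - p * D k + L w f k = 0)"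
        using Fr_eq_zero_iff[OF R1(1)[OF z']] R1(2,3)[OF z'] by (simp add: prod_eq_iff fun_eq_iff p_def v_def)
      then show ?thesis by (auto simp: R_def zc fun_eq_iff)
    qed
    \<comment> \<open>If \<open>pp z = 0\<close>, the image of \<open>c\<close> lies in
      \<open>Cent A\<close>, so its linear part annihilates a nonzero commutator and must vanish by
      torsion-freeness.\<close>
    have p0: "p = 0" if "pp z = zero A"
    proof (rule ccontr)
      assume pn: "p \<noteq> 0"
      have "0 < n"
      proof (rule ccontr)
        assume "\<not> 0 < n"
        then show False using pn fcoord_Lin[OF c] by (auto simp: p_def Lin_def)
      qed
      then obtain y y' where y: "y \<in> carrier A" "y' \<in> carrier A" "br A y y' \<noteq> zero A" using ex_noncomm by blast
      have "add A (UU f) (HH c) = zero A" using that cc by (simp add: pp_def zc add_comm)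
      then have "HH c = neg A (UU f)" using eq_neg_iff cc by blast
      then have "HH c \<in> Cent A" using Cent_closed(4)[OF Uc] by simp
      then have "act A (br A y y') b (linpoly n c) = zero A"
        using Cent_abelian[OF p3 Cent_br[OF met y(1,2)]] br_HH[OF c Cent_br[OF met y(1,2)]] by simp
      then show False
        using torsion_free[OF Cent_br[OF met y(1,2)] linpoly_Rn[OF c]] pn y(3) by (simp add: linpoly_eq[OF c] p_def)
    qed
    have main: "pp z = zero A \<longleftrightarrow> (\<forall>k. d * v k + (\<Sum>j<q. f j * cv j k) = 0) \<and> (\<forall>i. L \<tau> f i = 0)" if p: "p = 0"
    proof -
      have cd: "c \<in> derived (Fr n)" using c p by (simp add: derived_Fr_iff p_def)
      have Hc: "HH c \<in> Cent A" by (rule HH_derived[OF cd])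
      \<comment> \<open>Builds \<Sum> f_j c_j inside \<open>F_n^2\<close> one summand at a time,
        following both its image in \<open>A\<close> and its Fox vector.\<close>
      have "\<exists>e\<in>derived (Fr n). HH e = UU (\<lambda>i. \<Sum>j<k. f j * row j i) \<and> fcoord e = (0, \<lambda>i. \<Sum>j<k. f j * cv j i)" if "k \<le> q" for k
        using that
      proof (induction k)
        case 0
        show ?case using derived.d_zero[of "Fr n :: ('k, 'k ltm set) liealg"] UU_zero lie_homD(1)[OF HH_hom]
          by (intro bexI[of _ "cls Z"]) simp_all
      next
        case (Suc k)
        then obtain e' where e': "e' \<in> derived (Fr n)" "HH e' = UU (\<lambda>i. \<Sum>j<k. f j * row j i)"
          "fcoord e' = (0, \<lambda>i. \<Sum>j<k. f j * cv j i)" by auto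
        have k: "k < q" using Suc by simp
        let ?m = "modact n (cls (ct k)) (f k)"
        note m = modact_derived[OF ct(2)[OF k] fR[of k]]
        have "HH ?m = UU (\<lambda>i. row k i * f k)"
          using HH_modact[OF Fr.derived_carrier[OF ct(2)[OF k]] fR[of k]] UU_mult[where f = "row k", OF rowR fR[of k]] ct(3)[OF k] by simp
        then have "HH (add (Fr n) e' ?m) = UU (\<lambda>i. (\<Sum>j<k. f j * row j i) + row k i * f k)"
          using lie_homD(5)[OF HH_hom Fr.derived_carrier[OF e'(1)] Fr.derived_carrier[OF m(1)]] e'(2) fR rowR
          by (subst UU_add) (auto intro!: Rn_sum)
        then have "HH (add (Fr n) e' ?m) = UU (\<lambda>i. \<Sum>j<Suc k. f j * row j i)" by (simp add: mult.commute)
        moreover have "fcoord (add (Fr n) e' ?m) = (0, \<lambda>i. \<Sum>j<Suc k. f j * cv j i)"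
          using fcoord_simps(3)[OF Fr.derived_carrier[OF e'(1)] Fr.derived_carrier[OF m(1)]] e'(3) m(2)
          by (simp add: cv_def mult.commute)
        ultimately show ?case using derived.d_add[OF e'(1) m(1)] by blast
      qed
      then obtain e3 where e3: "e3 \<in> derived (Fr n)" "HH e3 = UU (\<lambda>i. \<Sum>j<q. f j * row j i)"
        "fcoord e3 = (0, \<lambda>i. \<Sum>j<q. f j * cv j i)" by blast
      note m = modact_derived[OF cd d(1)]
      define e2 where "e2 = add (Fr n) (modact n c d) e3"
      have e2: "e2 \<in> derived (Fr n)" unfolding e2_def by (rule derived.d_add[OF m(1) e3(1)])
      have fe2: "fcoord e2 = (0, \<lambda>k. d * v k + (\<Sum>j<q. f j * cv j k))"
        unfolding e2_def fcoord_simps(3)[OF Fr.derived_carrier[OF m(1)] Fr.derived_carrier[OF e3(1)]] m(2) e3(3)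
        by (simp add: v_def mult.commute)
      have He2: "HH e2 = add A (HH (modact n c d)) (HH e3)"
        unfolding e2_def by (rule lie_homD(5)[OF HH_hom Fr.derived_carrier[OF m(1)] Fr.derived_carrier[OF e3(1)]])
      have TR: "L \<tau> f i \<in> Rn n" for i by (rule LR(4)[OF z'])
      \<comment> \<open>After multiplication by \<open>d\<close>, the module part splits into its
        coordinates over \<open>J\<close> and a combination of rows carried by \<open>F_n^2\<close>.
        Nothing is lost, since \<open>Cent A\<close> is torsion-free.\<close>
      have "(\<lambda>i. f i * d) = (\<lambda>i. L \<tau> f i + (\<Sum>j<q. f j * row j i))"
      proof
        fix i
        have "(\<Sum>j<q. f j * row j i) = (\<Sum>j<q. if j = i then f j * d else 0) - L \<tau> f i"
          unfolding L_def sum_subtractf[symmetric] by (rule sum.cong) (auto simp: row_def algebra_simps)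
        also have "(\<Sum>j<q. if j = i then f j * d else 0) = f i * d" using fq[of i] by (cases "i < q") (auto simp: sum.delta)
        finally show "f i * d = L \<tau> f i + (\<Sum>j<q. f j * row j i)" by simp
      qed
      then have "UU (\<lambda>i. f i * d) = add A (UU (L \<tau> f)) (HH e3)"
        unfolding e3(2) using TR fR rowR by (simp only:) (rule UU_add, auto intro!: Rn_sum)
      moreover have "act A (pp z) b d = add A (HH (modact n c d)) (UU (\<lambda>i. f i * d))"
        unfolding zc pp_def prod.case M.act_add_left[OF Hc Uc d(1)] UU_mult[where f = f, OF fR d(1)] HH_modact[OF c d(1)] ..
      moreover have cl: "HH (modact n c d) \<in> carrier A" "HH e3 \<in> carrier A" "UU (L \<tau> f) \<in> carrier A"
        using HH_closed[OF Fr.derived_carrier[OF m(1)]] HH_closed[OF Fr.derived_carrier[OF e3(1)]] Cent_closed(5)[OF UU_Cent[where f = "L \<tau> f", OF TR]] by auto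
      ultimately have KI: "act A (pp z) b d = add A (HH e2) (UU (L \<tau> f))"
        unfolding He2 using add_comm[OF cl(3,2)] by (simp add: add_assoc)
      have He2c: "HH e2 \<in> carrier A" by (rule HH_closed[OF Fr.derived_carrier[OF e2]])
      have ppC: "pp z \<in> Cent A" unfolding zc pp_def prod.case by (rule Cent_closed(2)[OF Hc Uc])
      have e2z: "e2 = cls Z \<longleftrightarrow> (\<forall>k. d * v k + (\<Sum>j<q. f j * cv j k) = 0)"
        using Fr_eq_zero_iff[OF Fr.derived_carrier[OF e2]] fe2 by (simp add: fun_eq_iff)
      show ?thesis
      proof
        assume "pp z = zero A"
        then have "act A (pp z) b d = zero A" using M.act_add_left[OF Cent_closed(1) Cent_closed(1) d(1)]
            M.act_closed[OF Cent_closed(1) d(1)] add_eq_self[of "act A (zero A) b d" "act A (zero A) b d"] Cent_closed(5) by simp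
        then have "UU (L \<tau> f) = neg A (HH e2)" unfolding KI using eq_neg_iff[OF He2c cl(3)] by blast
        also have "\<dots> = HH (neg (Fr n) e2)" by (rule lie_homD(3)[OF HH_hom Fr.derived_carrier[OF e2], symmetric])
        finally have U: "UU (L \<tau> f) = HH (neg (Fr n) e2)" .
        have "neg (Fr n) e2 \<in> derived (Fr n)" using e2 by (simp add: derived_Fr_iff fst_WW)
        \<comment> \<open>This relation is supported on \<open>J\<close>, where \<open>S\<close>
          contains only the zero vector.\<close>
        then have "L \<tau> f \<in> S" using U TR by (auto simp: S_def)
        then have T0: "L \<tau> f = (\<lambda>_. 0)" by (rule ind) (rule LR(3)[OF z'])
        then have "HH e2 = zero A" using \<open>act A (pp z) b d = zero A\<close> He2c by (simp add: KI UU_zero)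
        then have "e2 = cls Z" by (rule HH_inj[OF Fr.derived_carrier[OF e2]])
        then show "(\<forall>k. d * v k + (\<Sum>j<q. f j * cv j k) = 0) \<and> (\<forall>i. L \<tau> f i = 0)" using e2z T0 by simp
      next
        assume h: "(\<forall>k. d * v k + (\<Sum>j<q. f j * cv j k) = 0) \<and> (\<forall>i. L \<tau> f i = 0)"
        then have "e2 = cls Z" "L \<tau> f = (\<lambda>_. 0)" using e2z by auto
        then have "act A (pp z) b d = zero A" unfolding KI using lie_homD(1)[OF HH_hom] by (simp add: UU_zero)
        then show "pp z = zero A" by (rule torsion_free[OF ppC d])
      qed
    qed
    \<comment> \<open>Once the \<tau>-coordinates vanish, \<open>d\<close> times the vector tested
      by \<open>R\<close> equals \<open>s\<close> times the vector tested by \<open>pp\<close>, and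
      both factors are nonzero.\<close>
    have vec: "d * (s * v k + L w f k) = s * (d * v k + (\<Sum>j<q. f j * cv j k)) + L w (L \<tau> f) k" for k
    proof -
      have "d * L w f k = (\<Sum>i<q. f i * (d * w i k))" by (simp add: L_def sum_distrib_left ac_simps)
      also have "\<dots> = (\<Sum>i<q. s * (f i * cv i k) + (\<Sum>j<q. f i * \<tau> i j * w j k))"
        by (rule sum.cong) (auto simp: e distrib_left sum_distrib_left ac_simps)
      also have "\<dots> = s * (\<Sum>j<q. f j * cv j k) + (\<Sum>i<q. \<Sum>j<q. f i * \<tau> i j * w j k)"
        by (simp only: sum.distrib sum_distrib_left)
      also have "(\<Sum>i<q. \<Sum>j<q. f i * \<tau> i j * w j k) = L w (L \<tau> f) k"
        unfolding L_def sum_distrib_right by (rule sum.swap)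
      finally show ?thesis by (simp add: algebra_simps)
    qed
    have "(\<forall>k. s * v k + L w f k = 0) \<longleftrightarrow> (\<forall>k. d * v k + (\<Sum>j<q. f j * cv j k) = 0)" if "\<forall>i. L \<tau> f i = 0"
    proof -
      have "L \<tau> f = (\<lambda>_. 0)" using that by auto
      then have "L w (L \<tau> f) k = 0" for k by (simp add: Llin(5))
      then have "d * (s * v k + L w f k) = s * (d * v k + (\<Sum>j<q. f j * cv j k))" for k using vec[of k] by simp
      note E = this
      have "s * v k + L w f k = 0 \<longleftrightarrow> d * v k + (\<Sum>j<q. f j * cv j k) = 0" for k
      proof
        assume "s * v k + L w f k = 0"
        then have "s * (d * v k + (\<Sum>j<q. f j * cv j k)) = 0" unfolding E[symmetric] by simp
        then show "d * v k + (\<Sum>j<q. f j * cv j k) = 0" using snz by simp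
      next
        assume "d * v k + (\<Sum>j<q. f j * cv j k) = 0"
        then have "d * (s * v k + L w f k) = 0" unfolding E by simp
        then show "s * v k + L w f k = 0" using d(2) by simp
      qed
      then show ?thesis by simp
    qed
    note vec' = this
    show ?thesis
    proof (cases "p = 0")
      case True
      show ?thesis unfolding main[OF True] Rz using vec' True by auto
    next
      case False
      then show ?thesis unfolding Rz using p0 by blast
    qed
  qed
  have ker: "pp x = pp y \<longleftrightarrow> R x = R y" if x: "x \<in> carrier (Frs n q)" and y: "y \<in> carrier (Frs n q)" for x y
  proof -
    let ?z = "add (Frs n q) x (neg (Frs n q) y)"
    have ny: "neg (Frs n q) y \<in> carrier (Frs n q)" by (rule op_closedD(2)[OF op_closed_Frs y])
    have z: "?z \<in> carrier (Frs n q)" by (rule op_closedD(4)[OF op_closed_Frs x ny])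
    have "pp ?z = add A (pp x) (neg A (pp y))" using lie_homD(5)[OF pp_hom x ny] lie_homD(3)[OF pp_hom y] by simp
    then have "pp ?z = zero A \<longleftrightarrow> pp x = pp y" using add_neg_eq_zero lie_homD(2)[OF pp_hom] x y by simp
    moreover have "R ?z = add (Frs r q) (R x) (neg (Frs r q) (R y))"
      using lie_homD(5)[OF R_hom x ny] lie_homD(3)[OF R_hom y] by simp
    then have "R ?z = zero (Frs r q) \<longleftrightarrow> R x = R y"
      using Frs_add_neg[OF lie_homD(2)[OF R_hom x] lie_homD(2)[OF R_hom y]] by simp
    ultimately show ?thesis using ker0[OF z] by blast
  qed
  show ?thesis by (rule embeds_of_same_kernel[OF pp_hom pp_surj[OF gen] R_hom op_closed_Frs ker])
qed

text \<open>By maximality, adjoining \<open>y\<close> to the \<open>b i\<close> creates a nontrivial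
  combination in the Fitting radical. Its coefficient at \<open>y\<close> is nonzero because the
  \<open>b i\<close> alone satisfy \<phi>, so the combination can be solved for
  \<open>y\<close>.\<close>

lemma (in lie) phi_maximal_span:
  assumes met: "metabelian A" and p3: "Phi3 A" and b: "\<And>i. b i \<in> carrier A" and phi: "phi A n b"
    and max: "\<And>x. in_car A (Suc n) x \<Longrightarrow> \<not> phi A (Suc n) x" and y: "y \<in> carrier A"
  shows "\<exists>\<alpha> w. w \<in> Cent A \<and> y = add A (lsum A (map (\<lambda>i. sm A (\<alpha> i) (b i)) [0..<n])) w"
proof -
  let ?x = "\<lambda>i. if i < n then b i else y"
  have "in_car A (Suc n) ?x" using b y by (simp add: in_car_def)
  then obtain \<alpha> where \<alpha>: "\<exists>i<Suc n. \<alpha> i \<noteq> 0" "FitEl A (lsum A (map (\<lambda>i. sm A (\<alpha> i) (?x i)) [0..<Suc n]))"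
    using max[of ?x] unfolding phi_def by blast
  define L where "L = lsum A (map (\<lambda>i. sm A (\<alpha> i) (b i)) [0..<n])"
  have L: "L \<in> carrier A" unfolding L_def by (intro lsum_closed) (auto simp: b)
  have "map (\<lambda>i. sm A (\<alpha> i) (?x i)) [0..<Suc n] = map (\<lambda>i. sm A (\<alpha> i) (b i)) [0..<n] @ [sm A (\<alpha> n) y]" by simp
  then have "lsum A (map (\<lambda>i. sm A (\<alpha> i) (?x i)) [0..<Suc n]) = add A L (sm A (\<alpha> n) y)"
    unfolding L_def using b y by (simp only:) (subst lsum_append, auto)
  then have F: "FitEl A (add A L (sm A (\<alpha> n) y))" using \<alpha>(2) by simp
  then have C: "add A L (sm A (\<alpha> n) y) \<in> Cent A" using FitEl_iff_Cent[OF met p3] L y by simp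
  have an: "\<alpha> n \<noteq> 0"
  proof
    assume z: "\<alpha> n = 0"
    then have "\<exists>i<n. \<alpha> i \<noteq> 0" using \<alpha>(1) less_Suc_eq by auto
    moreover have "FitEl A L" using F L y z by simp
    ultimately show False using phi unfolding phi_def L_def by blast
  qed
  define \<beta> where "\<beta> = inverse (\<alpha> n)"
  have "lsum A (map (\<lambda>i. sm A (- \<beta> * \<alpha> i) (b i)) [0..<n]) = sm A (- \<beta>) L"
    unfolding L_def by (subst lsum_map_sm[symmetric]) (auto simp: b sm_sm[symmetric])
  moreover have "sm A \<beta> (add A L (sm A (\<alpha> n) y)) = add A (sm A \<beta> L) y"
    using L y an by (simp add: sm_add_right sm_sm[symmetric] \<beta>_def)
  moreover have "add A (sm A (- \<beta>) L) (add A (sm A \<beta> L) y) = y"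
  proof -
    have "add A (sm A (- \<beta>) L) (sm A \<beta> L) = zero A" unfolding sm_add_left[OF L, symmetric] using L by simp
    then show ?thesis using L y by (simp add: add_assoc[symmetric])
  qed
  ultimately have "y = add A (lsum A (map (\<lambda>i. sm A (- \<beta> * \<alpha> i) (b i)) [0..<n])) (sm A \<beta> (add A L (sm A (\<alpha> n) y)))"
    by simp
  then show ?thesis
    by (intro exI[of _ "\<lambda>i. - \<beta> * \<alpha> i"] exI[of _ "sm A \<beta> (add A L (sm A (\<alpha> n) y))"] conjI Cent_closed(3)[OF C])
qed

lemma phi_alg_imp_embeds:
  fixes A :: "('k::field, 'a) liealg"
  assumes A: "phi_alg r A" and fg: "fin_gen A"
  shows "\<exists>s. embeds A (Frs r s :: ('k, 'k ltm set \<times> (nat \<Rightarrow> 'k mpoly)) liealg)"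
proof -
  interpret lie A using A by unfold_locales (simp add: phi_alg_def)
  have met: "metabelian A" and P: "Phi3 A" "Phi4 r A" "Phi5 r A" "Phi6 r A" "Phi7 r A"
    using A by (auto simp: phi_alg_def Phi1_def)
  define Q where "Q m \<longleftrightarrow> (\<exists>x. in_car A m x \<and> phi A m x)" for m
  have "Q 0" by (auto simp: Q_def in_car_def phi_def)
  have nQ: "\<not> Q (Suc r)" using P(2) by (auto simp: Q_def Phi4_def)
  \<comment> \<open>The first length at which \<phi> cannot be satisfied. \<Phi>4 bounds it by r +
    1, so its predecessor \<open>n\<close> is at most r.\<close>
  define m where "m = (LEAST m. \<not> Q m)"
  have m: "\<not> Q m" "m \<le> Suc r" unfolding m_def using LeastI[of "\<lambda>m. \<not> Q m", OF nQ] Least_le[of "\<lambda>m. \<not> Q m", OF nQ] by blast+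
  have "m \<noteq> 0" using m(1) \<open>Q 0\<close> by metis
  then obtain n where n: "m = Suc n" using not0_implies_Suc by blast
  have "Q n" using not_less_Least[of n "\<lambda>m. \<not> Q m"] n unfolding m_def by auto
  then obtain x where x: "in_car A n x" "phi A n x" by (auto simp: Q_def)
  have max: "\<not> phi A (Suc n) y" if "in_car A (Suc n) y" for y using m(1) that unfolding n Q_def by blast
  \<comment> \<open>Padded with zeros, since terms are evaluated under total assignments.\<close>
  define b where "b i = (if i < n then x i else zero A)" for i
  have b: "b i \<in> carrier A" for i using x(1) by (simp add: b_def in_car_def)
  have phi: "phi A n b" using x(2) phi_cong[of n b x A] by (simp add: b_def)
  have span: "\<exists>\<alpha> w. w \<in> Cent A \<and> y = add A (lsum A (map (\<lambda>i. sm A (\<alpha> i) (b i)) [0..<n])) w" if "y \<in> carrier A" for y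
    by (rule phi_maximal_span[OF met P(1) b phi _ that]) (rule max)
  obtain q g where g: "\<And>i. i < q \<Longrightarrow> g i \<in> carrier A" and gen: "carrier A = {teval A g t | t. tvars t \<subseteq> {..<q}}"
    using fg unfolding fin_gen_def by blast
  define pr where "pr y w \<longleftrightarrow> w \<in> Cent A \<and> (\<exists>\<alpha>. y = add A (lsum A (map (\<lambda>i. sm A (\<alpha> i) (b i)) [0..<n])) w)" for y w
  define u where "u i = (if i < q then SOME w. pr (g i) w else zero A)" for i
  have upr: "pr (g i) (u i)" if "i < q" for i
  proof -
    have "\<exists>w. pr (g i) w" using span[OF g[OF that]] unfolding pr_def by blast
    from someI_ex[OF this] show ?thesis using that by (simp add: u_def)
  qed
  interpret ucl_basis A r n q b u
  proof
    show "u j \<in> Cent A" for j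
    proof (cases "j < q")
      case True then show ?thesis using upr[OF True] by (simp add: pr_def)
    qed (simp add: u_def Cent_closed)
    show "n \<le> r" using m(2) n by simp
  qed (use met P b phi span in blast)+
  have "embeds A (Frs r q :: ('k, 'k ltm set \<times> (nat \<Rightarrow> 'k mpoly)) liealg)"
    by (rule embeds_Frs[OF _ gen]) (rule upr[unfolded pr_def, THEN conjunct2])
  then show ?thesis by blast
qed

theorem theorem4p1:
  fixes A :: "('k::{field,finite}, 'a) liealg" and r :: nat
  assumes "r \<ge> 2" and "lie_alg A" and "metabelian A" and "fin_gen A"
  shows "(in_ucl r A \<longleftrightarrow> phi_alg r A) \<and> (phi_alg r A \<longleftrightarrow> (\<exists>s. embeds A (Frs r s :: ('k, 'k ltm set \<times> (nat \<Rightarrow> 'k mpoly)) liealg)))"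
proof -
  have 1: "phi_alg r A" if "in_ucl r A" by (rule ucl_imp_phi_alg[OF assms(1) that assms(3)])
  have 2: "\<exists>s. embeds A (Frs r s :: ('k, 'k ltm set \<times> (nat \<Rightarrow> 'k mpoly)) liealg)" if "phi_alg r A"
    by (rule phi_alg_imp_embeds[OF that assms(4)])
  have 3: "in_ucl r A" if "\<exists>s. embeds A (Frs r s :: ('k, 'k ltm set \<times> (nat \<Rightarrow> 'k mpoly)) liealg)"
    using that embeds_imp_ucl[OF assms(1,2)] by blast
  show ?thesis using 1 2 3 by blast
qed

end
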